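(* Let $\mathcal{F}$ be a family of meromorphic functions in a domain $D\subset\mathbb{C}$. Let $d,k,m$ be positive integers such that $\frac{k+1}{d}+\frac{k+2}{2m}<\frac12$, and let $n$ be a positive integer. Let $a(z)$ and $\psi(z)$ be holomorphic functions in $D$, with $\psi(z)\neq 0$ for all $z\in D$. Suppose that for each $f\in\mathcal{F}$: all zeros of $f$ are of multiplicity at least $d$; all poles of $f$ are multiple (of multiplicity at least $2$); and all zeros in $D$ of $f^{(k)}(z)-a(z)f^n(z)-\psi(z)$ are of multiplicity at least $m$. Then $\mathcal{F}$ is normal in $D$.
   Context: A family of meromorphic functions on a domain $D\subset\mathbb{C}$ is normal in $D$ if every sequence in the family has a subsequence which converges spherically uniformly on compact subsets of $D$ to a meromorphic function or to $\infty$. Here $f^n$ denotes the $n$-th power of $f$ and $f^{(k)}$ its $k$-th derivative. *)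

theory Defs
  imports "HOL-Complex_Analysis.Complex_Analysis"
begin

text \<open>
  A meromorphic function on a domain is a function \<^term>\<open>f :: complex \<Rightarrow> complex\<close> with
  \<^prop>\<open>f nicely_meromorphic_on D\<close>: it has no removable singularities in \<open>D\<close>; its value
  at a pole is the dummy \<open>0\<close>.
\<close>

text \<open>
  The Riemann sphere is the unit sphere of \<open>\<complex> \<times> \<real>\<close> (that is, of \<open>\<real>\<^sup>3\<close>), with \<open>\<infinity>\<close> as
  the north pole. The product metric is Euclidean, so its restriction to the sphere is the chordal
  metric and \<^const>\<open>uniform_limit\<close> below is spherical uniform convergence.
\<close>

definition sphere_infinity :: "complex \<times> real" where
  "sphere_infinity = (0, 1)"

definition sphere_of_complex :: "complex \<Rightarrow> complex \<times> real" where
  "sphere_of_complex w =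
     (2 * w / complex_of_real ((cmod w)\<^sup>2 + 1), ((cmod w)\<^sup>2 - 1) / ((cmod w)\<^sup>2 + 1))"

definition sphere_value :: "(complex \<Rightarrow> complex) \<Rightarrow> complex \<Rightarrow> complex \<times> real" where
  "sphere_value f z = (if is_pole f z then sphere_infinity else sphere_of_complex (f z))"

definition normal_family :: "(complex \<Rightarrow> complex) set \<Rightarrow> complex set \<Rightarrow> bool" where
  "normal_family \<F> D \<longleftrightarrow>
     (\<forall>f :: nat \<Rightarrow> complex \<Rightarrow> complex. range f \<subseteq> \<F> \<longrightarrow>
       (\<exists>r. strict_mono r \<and>
         ((\<exists>g. g nicely_meromorphic_on D \<and>
             (\<forall>K. compact K \<and> K \<subseteq> D \<longrightarrow>
               uniform_limit K (\<lambda>j. sphere_value (f (r j))) (sphere_value g) sequentially)) \<or>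
          (\<forall>K. compact K \<and> K \<subseteq> D \<longrightarrow>
             uniform_limit K (\<lambda>j. sphere_value (f (r j))) (\<lambda>_. sphere_infinity) sequentially))))"

text \<open>
  Zeros are those of the meromorphic function: \<^const>\<open>isolated_zero\<close> and \<^const>\<open>zorder\<close>
  at \<open>z\<close> only depend on the values at points near \<open>z\<close> other than \<open>z\<close> itself, so dummy values at
  poles are irrelevant. For \<open>g\<close> meromorphic on a domain, a zero that is not isolated occurs only
  if \<open>g\<close> vanishes identically (away from a discrete set); such a zero has infinite multiplicity
  and imposes no condition.
\<close>

definition zeros_multiplicity_ge :: "(complex \<Rightarrow> complex) \<Rightarrow> complex set \<Rightarrow> nat \<Rightarrow> bool" where
  "zeros_multiplicity_ge g D m \<longleftrightarrow> (\<forall>z\<in>D. isolated_zero g z \<longrightarrow> zorder g z \<ge> int m)"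

text \<open>A pole of multiplicity \<open>p\<close> has \<^const>\<open>zorder\<close> equal to \<open>-p\<close>.\<close>

definition poles_multiplicity_ge :: "(complex \<Rightarrow> complex) \<Rightarrow> complex set \<Rightarrow> nat \<Rightarrow> bool" where
  "poles_multiplicity_ge g D m \<longleftrightarrow> (\<forall>z\<in>D. is_pole g z \<longrightarrow> zorder g z \<le> - int m)"

end

theory Submission
  imports Defs
begin

text \<open>
  If the family is not normal near a point of \<open>D\<close>, Pang's form of Zalcman's rescaling
  \<open>g\<^sub>j \<zeta> = f\<^sub>j (w\<^sub>j + s\<^sub>j \<zeta>) / s\<^sub>j\<^sup>k\<close> produces functions with locally bounded spherical derivative,
  normalised so that no subsequence has a constant limit, finite or infinite. By Marty's theorem a
  subsequence converges to a nonconstant meromorphic \<open>g\<close> on the plane, and since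
  \<open>f\<^sub>j\<^sup>n = s\<^sub>j\<^sup>n\<^sup>k g\<^sub>j\<^sup>n\<close> the term with \<open>a\<close> disappears in the limit. By Hurwitz's theorem \<open>g\<close>
  inherits the multiplicities of zeros and poles, and the zeros of the \<open>k\<close>-th derivative of \<open>g\<close>
  minus \<open>c\<close> have multiplicity at least \<open>m\<close>, where \<open>c \<noteq> 0\<close> is the value of \<open>\<psi>\<close> at the limit of the
  \<open>w\<^sub>j\<close>.

  Such a \<open>g\<close> is constant. Writing \<open>F\<close> for the \<open>k\<close>-th derivative of \<open>g\<close> minus \<open>c\<close>, Jensen's formula
  for \<open>g F / F'\<close> yields Milloux's inequality \<open>T(r, g) \<le> \<theta> T(r, g) + S(r)\<close>, in which \<open>\<theta> < 1\<close> is
  precisely the gap hypothesis. The error \<open>S(r)\<close> is first of logarithmic size, so that \<open>g\<close> and \<open>F\<close>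
  have finitely many zeros and poles; then the logarithmic derivatives tend to \<open>0\<close>, \<open>T\<close> is bounded,
  \<open>g\<close> has no zeros or poles, and \<open>g' / g\<close> is entire and vanishes at infinity.
\<close>

section \<open>Circle means and the Schwarz kernel\<close>

text \<open>The obstacle is the error term. The usual lemma on the logarithmic derivative averages
  over circles and excludes a set of radii. Here the bound is pointwise, on circles at a definite
  distance from the zeros and poles of \<open>g\<close> and \<open>F\<close>; the price is that this
  distance depends on how many such points there are, hence on the characteristic itself. The
  dependence is only through a logarithm: choosing the radius r in a short interval at x gives W(r)
  \<le> C (1 + ln (x (1 + W(R)) / \<eta>)) with R slightly larger than r, and iteration closes the
  estimate.

  The exponent k of the rescaling leaves k-th derivatives unchanged, which is why \<psi> survives in
  the limit as the constant c. It is admissible because zeros have order above k: the gap hypothesis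
  forces d > 2 (k + 1).

  Poles are handled by passing to reciprocals: near each point a function or its reciprocal is
  holomorphic and bounded by 2, so Montel's theorem applies to one of the two.\<close>

definition circle_mean :: "(complex \<Rightarrow> real) \<Rightarrow> real \<Rightarrow> real" where
  "circle_mean u r = integral {0..1} (\<lambda>t. u (circlepath 0 r t))"

lemma norm_circlepath [simp]: "r \<ge> 0 \<Longrightarrow> norm (circlepath 0 r t) = r"
  by (simp add: circlepath norm_mult)

lemma continuous_on_circlepath:
  assumes "continuous_on (sphere 0 r) u" "r \<ge> 0"
  shows   "continuous_on {0..1} (\<lambda>t. u (circlepath 0 r t))"
proof (rule continuous_on_compose2[OF assms(1)])
  show "continuous_on {0..1} (circlepath 0 r)"
    unfolding circlepath by (intro continuous_intros)
qed (use assms in auto)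

lemma circle_mean_integrable:
  fixes u :: "complex \<Rightarrow> 'a :: banach"
  assumes "continuous_on (sphere 0 r) u" "r \<ge> 0"
  shows   "(\<lambda>t. u (circlepath 0 r t)) integrable_on {0..1}"
  using continuous_on_circlepath[OF assms] by (rule integrable_continuous_interval)

lemma circle_mean_mono:
  assumes "continuous_on (sphere 0 r) u" "continuous_on (sphere 0 r) v" "r \<ge> 0"
  assumes "\<And>z. norm z = r \<Longrightarrow> u z \<le> v z"
  shows   "circle_mean u r \<le> circle_mean v r"
  unfolding circle_mean_def
  by (intro integral_le circle_mean_integrable assms) (use assms in auto)

lemma circle_mean_cong:
  assumes "r \<ge> 0" "\<And>z. norm z = r \<Longrightarrow> u z = v z"
  shows   "circle_mean u r = circle_mean v r"
  unfolding circle_mean_def by (intro integral_cong) (use assms in auto)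

lemma circle_mean_const [simp]: "circle_mean (\<lambda>_. c) r = c"
  by (simp add: circle_mean_def)

lemma circle_mean_add:
  assumes "continuous_on (sphere 0 r) u" "continuous_on (sphere 0 r) v" "r \<ge> 0"
  shows   "circle_mean (\<lambda>z. u z + v z) r = circle_mean u r + circle_mean v r"
  unfolding circle_mean_def by (intro integral_add circle_mean_integrable assms)

lemma circle_mean_diff:
  assumes "continuous_on (sphere 0 r) u" "continuous_on (sphere 0 r) v" "r \<ge> 0"
  shows   "circle_mean (\<lambda>z. u z - v z) r = circle_mean u r - circle_mean v r"
  unfolding circle_mean_def by (intro integral_diff circle_mean_integrable assms)

lemma circle_mean_cmult: "circle_mean (\<lambda>z. c * u z) r = c * circle_mean u r"
  unfolding circle_mean_def by simp

text \<open>The derivative of the parametrised circle is 2 pi i times the point itself, so a contour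
  integral divided by 2 pi i is the mean of the integrand times w. Cauchy's formulas for
  \<open>H 0\<close> and \<open>deriv H z\<close> and Cauchy's theorem become the three
  means.\<close>

lemma holomorphic_circle_integrals:
  assumes "H holomorphic_on ball 0 R'" "0 < R" "R < R'"
  shows   "((\<lambda>t. H (circlepath 0 R t)) has_integral H 0) {0..1}"
    and   "norm z < R \<Longrightarrow>
             ((\<lambda>t. H (circlepath 0 R t) * circlepath 0 R t / (circlepath 0 R t - z)\<^sup>2)
               has_integral deriv H z) {0..1}"
    and   "((\<lambda>t. H (circlepath 0 R t) * circlepath 0 R t) has_integral 0) {0..1}"
proof -
  have cont: "continuous_on (cball 0 R) H" and holo: "H holomorphic_on ball 0 R"
    using assms by (auto intro!: holomorphic_on_imp_continuous_on holomorphic_on_subset[OF assms(1)])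
  have vd: "vector_derivative (circlepath 0 R) (at t within {0..1}) = 2 * pi * \<i> * circlepath 0 R t"
    if "t \<in> {0..1}" for t
    using that by (subst vector_derivative_circlepath01) (auto simp: circlepath algebra_simps)
  have conv: "((\<lambda>t. G (circlepath 0 R t) * circlepath 0 R t) has_integral I) {0..1}"
    if "(G has_contour_integral (2 * pi * \<i> * I)) (circlepath 0 R)" for G I
  proof -
    have "((\<lambda>t. G (circlepath 0 R t) * (2 * pi * \<i> * circlepath 0 R t)) has_integral (2 * pi * \<i> * I)) {0..1}"
      using that unfolding has_contour_integral_def
      by (rule has_integral_eq[rotated]) (simp add: vd)
    from has_integral_mult_right[OF this, of "1 / (2 * pi * \<i>)"] show ?thesis
      by (simp add: field_simps)
  qed
  have nz: "circlepath 0 R t \<noteq> 0" for t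
    using norm_circlepath[of R t] assms(2) by (metis less_irrefl less_le norm_zero)
  have "((\<lambda>u. H u / (u - 0)) has_contour_integral (2 * pi * \<i> * H 0)) (circlepath 0 R)"
    using Cauchy_integral_circlepath[OF cont holo, of 0] assms by simp
  from conv[OF this] show "((\<lambda>t. H (circlepath 0 R t)) has_integral H 0) {0..1}"
    using nz by simp
  show "((\<lambda>t. H (circlepath 0 R t) * circlepath 0 R t / (circlepath 0 R t - z)\<^sup>2)
               has_integral deriv H z) {0..1}" if "norm z < R"
  proof -
    have *: "(\<lambda>u. H u / (u - z)\<^sup>2) contour_integrable_on circlepath 0 R"
            "(H has_field_derivative 1 / (of_real (2 * pi) * \<i>) * contour_integral (circlepath 0 R) (\<lambda>u. H u / (u - z)\<^sup>2)) (at z)"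
      using Cauchy_derivative_integral_circlepath[OF cont holo, of z] that by auto
    from *(2) have "deriv H z = 1 / (of_real (2 * pi) * \<i>) * contour_integral (circlepath 0 R) (\<lambda>u. H u / (u - z)\<^sup>2)"
      by (rule DERIV_imp_deriv)
    hence "contour_integral (circlepath 0 R) (\<lambda>u. H u / (u - z)\<^sup>2) = 2 * pi * \<i> * deriv H z"
      by (simp add: field_simps)
    with *(1) have "((\<lambda>u. H u / (u - z)\<^sup>2) has_contour_integral (2 * pi * \<i> * deriv H z)) (circlepath 0 R)"
      using has_contour_integral_integral by metis
    from conv[OF this] show ?thesis by simp
  qed
  have "(H has_contour_integral 2 * pi * \<i> * 0) (circlepath 0 R)"
    using Cauchy_theorem_disc_simple[of H 0 R' "circlepath 0 R"] assms by (auto simp: subset_iff)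
  from conv[OF this] show "((\<lambda>t. H (circlepath 0 R t) * circlepath 0 R t) has_integral 0) {0..1}" .
qed

lemma circle_mean_Re_holomorphic:
  assumes "H holomorphic_on ball 0 R'" "0 < R" "R < R'"
  shows   "circle_mean (\<lambda>z. Re (H z)) R = Re (H 0)"
  unfolding circle_mean_def
  by (rule integral_unique, rule has_integral_Re, rule holomorphic_circle_integrals[OF assms])

text \<open>The kernel is conjugated on the circle so that the conjugate of \<open>H\<close> integrates to \<open>0\<close>;
  hence only the real part of \<open>H\<close> contributes.\<close>
lemma norm_deriv_le_circle_mean_Re:
  assumes H: "H holomorphic_on ball 0 R'" "0 < R" "R < R'" and z: "norm z < R"
  shows   "norm (deriv H z) \<le> 2 * R / (R - norm z)\<^sup>2 * circle_mean (\<lambda>z. \<bar>Re (H z)\<bar>) R"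
proof -
  define K where "K = (\<lambda>w. w / (w - z)\<^sup>2)"
  \<comment> \<open>The conjugated kernel is singular only at the reflected point of modulus R^2 /
    |z|, which lies outside the circle; \<open>R2\<close> does not reach beyond it.\<close>
  define R2 where "R2 = (if z = 0 then R' else min R' (R\<^sup>2 / norm z))"
  have R2: "R < R2" "R2 \<le> R'"
    using H z by (auto simp: R2_def field_simps power2_eq_square)
  have nz: "(of_real R)\<^sup>2 - cnj z * w \<noteq> 0" if "w \<in> ball 0 R2" for w
  proof
    assume "(of_real R)\<^sup>2 - cnj z * w = 0"
    hence "norm ((of_real R)\<^sup>2 :: complex) = norm (cnj z * w)" by simp
    hence "R\<^sup>2 = norm z * norm w" by (simp add: norm_mult norm_power)
    with that z H(2) show False
      by (cases "z = 0") (auto simp: R2_def field_simps)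
  qed
  \<comment> \<open>On |w| = R the conjugate of w is R^2 / w, which turns the conjugate of
    \<open>K w\<close> into a holomorphic function of w. Its product with \<open>H\<close> has mean
    0 by Cauchy's theorem.\<close>
  have "(\<lambda>w. H w * (of_real R)\<^sup>2 / ((of_real R)\<^sup>2 - cnj z * w)\<^sup>2) holomorphic_on ball 0 R2"
    using R2 nz by (intro holomorphic_intros holomorphic_on_subset[OF H(1)]) auto
  from holomorphic_circle_integrals(3)[OF this H(2) R2(1)]
  have "((\<lambda>t. H (circlepath 0 R t) * cnj (K (circlepath 0 R t))) has_integral 0) {0..1}"
  proof (rule has_integral_eq[rotated])
    fix t :: real
    define w where "w = circlepath 0 R t"
    have w: "norm w = R" using H by (simp add: w_def)
    hence R: "(of_real R)\<^sup>2 = w * cnj w"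
      using complex_norm_square[of w] by simp
    have wz: "w \<noteq> 0" "cnj w - cnj z \<noteq> 0"
      using w z H by (auto simp flip: complex_cnj_diff)
    have "H w * (of_real R)\<^sup>2 / ((of_real R)\<^sup>2 - cnj z * w)\<^sup>2 * w =
            H w * (w * cnj w) * w / (w * (cnj w - cnj z))\<^sup>2"
      by (simp add: R algebra_simps)
    also have "\<dots> = H w * cnj (K w)"
      using wz by (simp add: K_def power_mult_distrib power2_eq_square[of w])
    finally show "H (circlepath 0 R t) * (of_real R)\<^sup>2 / ((of_real R)\<^sup>2 - cnj z * circlepath 0 R t)\<^sup>2 * circlepath 0 R t =
            H (circlepath 0 R t) * cnj (K (circlepath 0 R t))"
      by (simp add: w_def)
  qed
  from has_integral_cnj[THEN iffD2, OF this]
  have 1: "((\<lambda>t. cnj (H (circlepath 0 R t)) * K (circlepath 0 R t)) has_integral 0) {0..1}"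
    by (simp add: o_def)
  have 2: "((\<lambda>t. H (circlepath 0 R t) * K (circlepath 0 R t)) has_integral deriv H z) {0..1}"
    using holomorphic_circle_integrals(2)[OF H z] by (simp add: K_def)
  have 3: "((\<lambda>t. 2 * of_real (Re (H (circlepath 0 R t))) * K (circlepath 0 R t)) has_integral deriv H z) {0..1}"
    using has_integral_add[OF 2 1] by (simp flip: distrib_right add: complex_add_cnj)
  have cont: "continuous_on (sphere 0 R) H"
    using H by (auto intro!: holomorphic_on_imp_continuous_on holomorphic_on_subset[OF H(1)])
  have "norm (deriv H z) \<le> integral {0..1} (\<lambda>t. 2 * R / (R - norm z)\<^sup>2 * \<bar>Re (H (circlepath 0 R t))\<bar>)"
    unfolding integral_unique[OF 3, symmetric]
  proof (rule integral_norm_bound_integral)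
    show "(\<lambda>t. 2 * of_real (Re (H (circlepath 0 R t))) * K (circlepath 0 R t)) integrable_on {0..1}"
      using 3 by blast
    show "(\<lambda>t. 2 * R / (R - norm z)\<^sup>2 * \<bar>Re (H (circlepath 0 R t))\<bar>) integrable_on {0..1}"
      by (rule circle_mean_integrable[where u = "\<lambda>w. 2 * R / (R - norm z)\<^sup>2 * \<bar>Re (H w)\<bar>"])
         (use H z in \<open>auto intro!: continuous_intros cont\<close>)
    fix t :: real
    define w where "w = circlepath 0 R t"
    have w: "norm w = R" using H by (simp add: w_def)
    have "norm (w - z) \<ge> R - norm z"
      using norm_triangle_ineq2[of w z] w by simp
    hence "norm (K w) \<le> R / (R - norm z)\<^sup>2"
      unfolding K_def norm_divide norm_power w
      using z H by (intro divide_left_mono power_mono mult_pos_pos zero_less_power) auto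
    hence "\<bar>Re (H w)\<bar> * norm (K w) \<le> \<bar>Re (H w)\<bar> * (R / (R - norm z)\<^sup>2)"
      by (intro mult_left_mono) auto
    hence "2 * (\<bar>Re (H w)\<bar> * norm (K w)) \<le> 2 * (\<bar>Re (H w)\<bar> * (R / (R - norm z)\<^sup>2))"
      by simp
    thus "norm (2 * of_real (Re (H (circlepath 0 R t))) * K (circlepath 0 R t))
           \<le> 2 * R / (R - norm z)\<^sup>2 * \<bar>Re (H (circlepath 0 R t))\<bar>"
      by (simp add: norm_mult w_def mult_ac)
  qed
  also have "\<dots> = 2 * R / (R - norm z)\<^sup>2 * circle_mean (\<lambda>z. \<bar>Re (H z)\<bar>) R"
    by (simp add: circle_mean_def)
  finally show ?thesis .
qed

section \<open>Blaschke factors\<close>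

definition blaschke :: "real \<Rightarrow> complex \<Rightarrow> complex \<Rightarrow> complex" where
  "blaschke R a z = of_real R * (z - a) / (of_real (R\<^sup>2) - cnj a * z)"

lemma blaschke_denom_nz:
  assumes "norm a * norm z < R\<^sup>2"
  shows   "of_real (R\<^sup>2) - cnj a * z \<noteq> 0"
proof
  assume "of_real (R\<^sup>2) - cnj a * z = 0"
  hence "of_real (R\<^sup>2) = cnj a * z" by simp
  hence "norm (of_real (R\<^sup>2) :: complex) = norm (cnj a * z)" by metis
  hence "R\<^sup>2 = norm a * norm z" by (simp add: norm_mult norm_power)
  with assms show False by simp
qed

lemma norm_blaschke_eq_1:
  assumes "norm z = R" "norm a < R"
  shows   "norm (blaschke R a z) = 1"
proof -
  have "of_real (R\<^sup>2) - cnj a * z = z * cnj (z - a)"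
    using assms(1) complex_norm_square[of z] by (simp add: algebra_simps)
  moreover have "z \<noteq> a" "R > 0" using assms by (auto intro: le_less_trans[OF norm_ge_zero])
  ultimately show ?thesis
    using assms by (simp add: blaschke_def norm_divide norm_mult)
       (simp flip: complex_cnj_diff)
qed

lemma norm_blaschke_0:
  assumes "R > 0"
  shows   "norm (blaschke R a 0) = norm a / R"
  using assms by (simp add: blaschke_def norm_divide norm_mult norm_power power2_eq_square)

lemma blaschke_eq_0_iff:
  assumes "norm a * norm z < R\<^sup>2" "R > 0"
  shows   "blaschke R a z = 0 \<longleftrightarrow> z = a"
  using blaschke_denom_nz[OF assms(1)] assms(2) by (auto simp: blaschke_def)

lemma blaschke_has_field_derivative:
  assumes "norm a * norm z < R\<^sup>2" "z \<noteq> a"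
  shows   "(blaschke R a has_field_derivative
              blaschke R a z * (of_real (R\<^sup>2 - (norm a)\<^sup>2) / ((z - a) * (of_real (R\<^sup>2) - cnj a * z)))) (at z)"
proof -
  define D where "D = of_real (R\<^sup>2) - cnj a * z"
  have D: "D \<noteq> 0" using blaschke_denom_nz[OF assms(1)] by (simp add: D_def)
  have "(blaschke R a has_field_derivative
            (of_real R * D + of_real R * (z - a) * cnj a) / (D * D)) (at z)"
    unfolding blaschke_def [abs_def] D_def
    by (rule derivative_eq_intros refl | use D in \<open>simp add: D_def\<close>)+ 
  also have "of_real R * D + of_real R * (z - a) * cnj a = of_real R * of_real (R\<^sup>2 - (norm a)\<^sup>2)"
    using complex_norm_square[of a] by (simp add: D_def algebra_simps)
  also have "of_real R * of_real (R\<^sup>2 - (norm a)\<^sup>2) / (D * D) =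
               blaschke R a z * (of_real (R\<^sup>2 - (norm a)\<^sup>2) / ((z - a) * D))"
    using D assms(2) by (simp add: blaschke_def D_def)
  finally show ?thesis by (simp add: D_def)
qed

lemma blaschke_analytic:
  assumes "norm a * norm z < R\<^sup>2"
  shows   "blaschke R a analytic_on {z}"
  unfolding blaschke_def [abs_def] using blaschke_denom_nz[OF assms]
  by (intro analytic_intros) auto

lemma zorder_blaschke:
  assumes "norm a * norm z < R\<^sup>2" "R > 0"
  shows   "zorder (blaschke R a) z = (if z = a then 1 else 0)"
proof (cases "z = a")
  case True
  define S :: "complex set" where "S = {w. norm a * norm w < R\<^sup>2}"
  have "zorder (blaschke R a) z = 1"
  proof (rule zorder_eqI)
    show "open S" unfolding S_def by (intro open_Collect_less continuous_intros)
    show "z \<in> S" using assms by (simp add: S_def)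
    show "(\<lambda>w. of_real R / (of_real (R\<^sup>2) - cnj a * w)) holomorphic_on S"
      using blaschke_denom_nz[of a _ R] by (intro holomorphic_intros) (auto simp: S_def)
    show "of_real R / (of_real (R\<^sup>2) - cnj a * z) \<noteq> 0"
      using blaschke_denom_nz[OF assms(1)] assms(2) by simp
  qed (simp add: blaschke_def True)
  thus ?thesis by (simp add: True)
next
  case False
  thus ?thesis
    using zorder_eq_0I[OF blaschke_analytic[OF assms(1)]] blaschke_eq_0_iff[OF assms] by auto
qed

text \<open>All zeros and poles of \<open>f\<close> lie in the discrete set \<open>S\<close>, which may be larger.\<close>
definition divisor_in :: "(complex \<Rightarrow> complex) \<Rightarrow> complex set \<Rightarrow> bool" where
  "divisor_in f S \<longleftrightarrow> f meromorphic_on UNIV \<and> S sparse_in UNIV \<and> 0 \<notin> S \<and>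
     (\<forall>z. z \<notin> S \<longrightarrow> f analytic_on {z} \<and> f z \<noteq> 0)"

lemma divisor_inD:
  assumes "divisor_in f S"
  shows "f meromorphic_on A" "S sparse_in UNIV" "0 \<notin> S" "z \<notin> S \<Longrightarrow> f analytic_on {z}" "z \<notin> S \<Longrightarrow> f z \<noteq> 0"
  using assms meromorphic_on_subset[of f UNIV A] by (auto simp: divisor_in_def)

lemma sparse_in_UNIV_finite_cball:
  assumes "(S :: complex set) sparse_in UNIV"
  shows   "finite (S \<inter> cball 0 r)" "finite (S \<inter> ball 0 r)"
proof -
  have "S sparse_in cball 0 r" using assms by (rule sparse_in_subset) auto
  from sparse_in_compact_finite[OF this] show *: "finite (S \<inter> cball 0 r)" by (simp add: Int_commute)
  show "finite (S \<inter> ball 0 r)" by (rule finite_subset[OF _ *]) auto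
qed

lemma divisor_in_eventually_nz:
  assumes "divisor_in f S"
  shows   "eventually (\<lambda>w. f w \<noteq> 0) (at z)"
proof -
  have "eventually (\<lambda>w. w \<notin> S) (at z)"
    using divisor_inD(2)[OF assms] by (auto simp: sparse_in_def islimpt_iff_eventually)
  thus ?thesis by eventually_elim (use divisor_inD(5)[OF assms] in auto)
qed

lemma divisor_in_zorder_0:
  assumes "divisor_in f S" "z \<notin> S"
  shows   "zorder f z = 0"
  using divisor_inD[OF assms(1)] assms(2) by (intro zorder_eq_0I) auto

text \<open>Dividing \<open>f\<close> by the Blaschke factors of its zeros and poles, with
  multiplicities, leaves a function of order 0 everywhere on a disc slightly larger than
  \<open>ball 0 R\<close>. After removal of singularities it is zero-free on a simply connected set
  and has a holomorphic logarithm \<open>H\<close>. The larger disc lets \<open>H\<close> be used on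
  the circle itself.\<close>

lemma blaschke_factorization:
  assumes div: "divisor_in f S" and R: "R > 0" "\<And>a. a \<in> S \<Longrightarrow> norm a \<noteq> R"
  obtains R' H where "R' > R" "H holomorphic_on ball 0 R'" "S \<inter> ball 0 R' = S \<inter> ball 0 R"
    "\<And>a z :: complex. a \<in> S \<inter> ball 0 R \<Longrightarrow> z \<in> ball 0 R' \<Longrightarrow> norm a * norm z < R\<^sup>2"
    "\<And>z. z \<in> ball 0 R' - S \<Longrightarrow>
        f z = exp (H z) * (\<Prod>a\<in>S\<inter>ball 0 R. blaschke R a z powi zorder f a)"
proof -
  note D = divisor_inD[OF div]
  define A where "A = S \<inter> ball 0 R"
  have fin: "finite A" unfolding A_def using sparse_in_UNIV_finite_cball(2)[OF D(2)] .
  \<comment> \<open>The minimum of this finite set keeps the disc away from the next points of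
    \<open>S\<close> and from the poles of the Blaschke factors, which have modulus R^2 / |a|. The
    entry \<open>R + 1\<close> makes the set nonempty and limits the search to a compact
    disc.\<close>
  define X where "X = insert (R + 1) (norm ` {a\<in>S \<inter> cball 0 (R + 1). norm a > R} \<union> (\<lambda>a. R\<^sup>2 / norm a) ` A)"
  have "finite {a\<in>S \<inter> cball 0 (R + 1). norm a > R}"
    by (rule finite_subset[OF _ sparse_in_UNIV_finite_cball(1)[OF D(2), of "R + 1"]]) auto
  hence finX: "finite X" using fin by (simp add: X_def)
  define R' where "R' = Min X"
  have nz: "a \<noteq> 0" if "a \<in> A" for a using that D(3) by (auto simp: A_def)
  have "R' \<in> X" using finX unfolding R'_def by (intro Min_in) (auto simp: X_def)
  hence R': "R' > R"
    using nz R(1) by (auto simp: X_def A_def field_simps power2_eq_square)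
  have R'_le: "R' \<le> x" if "x \<in> X" for x
    using finX that by (simp add: R'_def)
  have S_R': "S \<inter> ball 0 R' = A"
  proof -
    have "norm a < R" if "a \<in> S" "norm a < R'" for a
    proof (rule ccontr)
      assume "\<not>norm a < R"
      hence "norm a > R" using R(2) that by force
      moreover have "norm a \<le> R + 1" using that R'_le[of "R + 1"] by (simp add: X_def)
      ultimately have "norm a \<in> X" using that by (auto simp: X_def)
      thus False using R'_le[of "norm a"] that by simp
    qed
    thus ?thesis using R' by (auto simp: A_def)
  qed
  have small: "norm a * norm z < R\<^sup>2" if "a \<in> A" "z \<in> ball 0 R'" for a z :: complex
  proof -
    have "R\<^sup>2 / norm a \<in> X" unfolding X_def using that by blast
    hence "norm z < R\<^sup>2 / norm a" using R'_le[of "R\<^sup>2 / norm a"] that by auto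
    thus ?thesis using nz[OF that(1)] by (simp add: field_simps)
  qed
  define P where "P = (\<lambda>z. \<Prod>a\<in>A. blaschke R a z powi (-zorder f a))"
  define G where "G = (\<lambda>z. f z * P z)"
  have bnz: "blaschke R a z \<noteq> 0" if "a \<in> A" "z \<in> ball 0 R' - S" for a z
    using blaschke_eq_0_iff[OF small[of a z] R(1)] that by (auto simp: A_def)
  have anP: "P analytic_on {z}" "P z \<noteq> 0" if "z \<in> ball 0 R' - S" for z
  proof -
    note * = bnz[OF _ that]
    show "P analytic_on {z}"
      unfolding P_def using * that small by (intro analytic_intros blaschke_analytic) auto
    show "P z \<noteq> 0" unfolding P_def using * fin by simp
  qed
  have merob: "(\<lambda>z. blaschke R a z powi n) meromorphic_on B" for a n B
    unfolding blaschke_def by (intro meromorphic_intros)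
  have meroP: "P meromorphic_on B" for B
    unfolding P_def by (intro meromorphic_intros merob)
  have meroG: "G meromorphic_on B" for B
    unfolding G_def by (intro meromorphic_intros D meroP)
  have ev: "eventually (\<lambda>w. w \<in> ball 0 R' - S) (at z)" if "z \<in> ball 0 R'" for z
  proof -
    have "eventually (\<lambda>w. w \<notin> S) (at z)"
      using D(2) by (auto simp: sparse_in_def islimpt_iff_eventually)
    moreover have "eventually (\<lambda>w. w \<in> ball 0 R') (at z)"
      using that by (intro eventually_at_in_open') auto
    ultimately show ?thesis by eventually_elim auto
  qed
  have anG: "G analytic_on {z}" "G z \<noteq> 0" if "z \<in> ball 0 R' - S" for z
    unfolding G_def using that anP[OF that] D by (auto intro!: analytic_intros)
  have ordG: "zorder G z = 0" if z: "z \<in> ball 0 R'" for z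
  proof (cases "z \<in> S")
    case False
    thus ?thesis using anG[of z] z by (intro zorder_eq_0I) auto
  next
    case True
    hence zA: "z \<in> A" using S_R' z by auto
    have evP: "eventually (\<lambda>w. P w \<noteq> 0) (at z)"
      using ev[OF z] by eventually_elim (use anP in auto)
    have evb: "eventually (\<lambda>w. blaschke R a w \<noteq> 0) (at z)" if "a \<in> A" for a
      using ev[OF z] by eventually_elim (use that bnz in auto)
    have "zorder P z = (\<Sum>a\<in>A. zorder (\<lambda>w. blaschke R a w powi (- zorder f a)) z)"
      unfolding P_def using evP unfolding P_def by (intro zorder_prod merob)
    also have "\<dots> = (\<Sum>a\<in>A. if a = z then -zorder f z else 0)"
    proof (rule sum.cong)
      fix a assume a: "a \<in> A"
      have "zorder (\<lambda>w. blaschke R a w powi (- zorder f a)) z = -zorder f a * zorder (blaschke R a) z"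
        using merob[of a 1] evb[OF a] by (intro zorder_power_int eventually_frequently) auto
      thus "zorder (\<lambda>w. blaschke R a w powi (- zorder f a)) z = (if a = z then -zorder f z else 0)"
        using zorder_blaschke[OF small[OF a z] R(1)] by auto
    qed auto
    also have "\<dots> = -zorder f z" using fin zA by simp
    finally show ?thesis
      unfolding G_def
      using zorder_mult[of f z P] D(1) meroP evP divisor_in_eventually_nz[OF div, of z]
      by (simp add: eventually_frequently)
  qed
  define E where "E = remove_sings G"
  have E: "E analytic_on {z}" "E z \<noteq> 0" if z: "z \<in> ball 0 R'" for z
  proof -
    have evG: "eventually (\<lambda>w. G w \<noteq> 0) (at z)"
      using ev[OF z] by eventually_elim (use anG in auto)
    have iso: "isolated_singularity_at G z"
      using meroG by (rule meromorphic_on_isolated_singularity)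
    have "\<not>is_pole G z"
      using isolated_pole_imp_neg_zorder[OF iso] ordG[OF z] by auto
    hence "\<not>is_pole E z"
      using is_pole_cong[OF eventually_remove_sings_eq_at[OF iso] refl] by (simp add: E_def)
    thus an: "E analytic_on {z}"
      unfolding E_def using remove_sings_nicely_meromorphic[OF meroG[of UNIV]]
      by (intro nicely_meromorphic_on_imp_analytic_at[of _ UNIV]) auto
    have "\<not>isolated_zero G z"
      using zorder_isolated_zero_pos'[OF _ iso] ordG[OF z] by auto
    hence nz: "\<not>isolated_zero E z" using iso by (simp add: E_def)
    have "eventually (\<lambda>w. E w \<noteq> 0) (at z)"
      using evG eventually_remove_sings_eq_at[OF iso] by eventually_elim (simp add: E_def)
    thus "E z \<noteq> 0" using nz an by (auto simp: isolated_zero_analytic_iff)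
  qed
  have "E holomorphic_on ball 0 R'"
    using E by (meson analytic_imp_holomorphic analytic_on_analytic_at)
  then obtain H where H: "H holomorphic_on ball 0 R'" "\<And>z. z \<in> ball 0 R' \<Longrightarrow> exp (H z) = E z"
    using holomorphic_logarithm_exists[of "ball 0 R'" E 0] E R R' by auto
  show ?thesis
  proof (rule that[of R' H])
    fix z assume z: "z \<in> ball 0 R' - S"
    have "exp (H z) = f z * P z"
      using z H(2)[of z] anG(1)[OF z] by (simp add: E_def G_def)
    moreover have "P z * (\<Prod>a\<in>A. blaschke R a z powi zorder f a) = 1"
      using anP(2)[OF z] fin unfolding P_def
      by (subst prod.distrib [symmetric]) (auto intro!: prod.neutral simp: power_int_minus)
    ultimately show "f z = exp (H z) * (\<Prod>a\<in>S\<inter>ball 0 R. blaschke R a z powi zorder f a)"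
      by (simp add: A_def mult.assoc)
  qed (use R' S_R' H small in \<open>auto simp: A_def\<close>)
qed

section \<open>Jensen's formula and logarithmic derivatives\<close>

text \<open>For the weight \<open>pole_ord f\<close> this is Nevanlinna's integrated counting
  function N(r, f), and for \<open>zero_ord f\<close> that of 1/f. A divisor set omits 0, so no
  correction term at the origin arises.\<close>

definition wsum :: "complex set \<Rightarrow> real \<Rightarrow> (complex \<Rightarrow> real) \<Rightarrow> real" where
  "wsum S r w = (\<Sum>a\<in>S \<inter> ball 0 r. w a * ln (r / norm a))"

text \<open>On circles that avoid \<open>S\<close> all integrands are continuous, so no logarithmic
  singularity ever has to be integrated.\<close>

definition good_radius :: "complex set \<Rightarrow> real \<Rightarrow> bool" where
  "good_radius S r \<longleftrightarrow> r > 0 \<and> (\<forall>a\<in>S. norm a \<noteq> r)"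

definition zero_ord :: "(complex \<Rightarrow> complex) \<Rightarrow> complex \<Rightarrow> real" where
  "zero_ord f a = max 0 (of_int (zorder f a))"

definition pole_ord :: "(complex \<Rightarrow> complex) \<Rightarrow> complex \<Rightarrow> real" where
  "pole_ord f a = max 0 (- of_int (zorder f a))"

definition proximity :: "(complex \<Rightarrow> complex) \<Rightarrow> real \<Rightarrow> real" where
  "proximity f r = circle_mean (\<lambda>z. ln (max 1 (norm (f z)))) r"

text \<open>The Nevanlinna characteristic \<open>T(r, f) = m(r, f) + N(r, f)\<close>.\<close>
definition characteristic :: "complex set \<Rightarrow> (complex \<Rightarrow> complex) \<Rightarrow> real \<Rightarrow> real" where
  "characteristic S f r = proximity f r + wsum S r (pole_ord f)"

lemma wsum_ln_nonneg:
  assumes "a \<in> S \<inter> ball 0 r"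
  shows   "ln (r / norm a) \<ge> 0"
  using assms by (cases "a = 0") auto

lemma wsum_mono:
  assumes "\<And>a. a \<in> S \<Longrightarrow> v a \<le> w a"
  shows   "wsum S r v \<le> wsum S r w"
  unfolding wsum_def using assms wsum_ln_nonneg[of _ S r]
  by (intro sum_mono mult_right_mono) auto

lemma wsum_nonneg:
  assumes "\<And>a. a \<in> S \<Longrightarrow> w a \<ge> 0"
  shows   "wsum S r w \<ge> 0"
  using wsum_mono[of S "\<lambda>_. 0" w r] assms by (simp add: wsum_def)

lemma wsum_add: "wsum S r (\<lambda>a. v a + w a) = wsum S r v + wsum S r w"
  by (simp add: wsum_def sum.distrib distrib_right)

lemma wsum_cmult: "wsum S r (\<lambda>a. c * w a) = c * wsum S r w"
  by (simp add: wsum_def sum_distrib_left mult.assoc)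

lemma wsum_subset:
  assumes "S' \<subseteq> S" "S sparse_in UNIV" "\<And>a. a \<in> S - S' \<Longrightarrow> w a = 0"
  shows   "wsum S' r w = wsum S r w"
  unfolding wsum_def using assms sparse_in_UNIV_finite_cball(2)[of S r]
  by (intro sum.mono_neutral_left) auto

lemma good_radius_subset: "good_radius S r \<Longrightarrow> S' \<subseteq> S \<Longrightarrow> good_radius S' r"
  by (auto simp: good_radius_def)

lemma good_radiusD:
  assumes "good_radius S r" "divisor_in f S"
  shows   "r > 0" "norm z = r \<Longrightarrow> f z \<noteq> 0" "continuous_on (sphere 0 r) f"
proof -
  have *: "z \<notin> S" if "norm z = r" for z using that assms(1) by (auto simp: good_radius_def)
  show "r > 0" using assms by (simp add: good_radius_def)
  show "norm z = r \<Longrightarrow> f z \<noteq> 0" using * divisor_inD(5)[OF assms(2)] by blast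
  show "continuous_on (sphere 0 r) f"
    using * divisor_inD(4)[OF assms(2)]
    by (intro continuous_at_imp_continuous_on ballI analytic_at_imp_isCont) auto
qed

lemma continuous_on_ln_norm:
  assumes "good_radius S r" "divisor_in f S"
  shows   "continuous_on (sphere 0 r) (\<lambda>z. ln (norm (f z)))"
          "continuous_on (sphere 0 r) (\<lambda>z. ln (max 1 (norm (f z))))"
  using good_radiusD[OF assms] by (auto intro!: continuous_intros)

lemma proximity_nonneg: "proximity f r \<ge> 0"
proof (cases "(\<lambda>t. ln (max 1 (norm (f (circlepath 0 r t))))) integrable_on {0..1}")
  case True
  thus ?thesis unfolding proximity_def circle_mean_def by (rule integral_nonneg) auto
qed (simp add: proximity_def circle_mean_def not_integrable_integral)

lemma characteristic_ge:
  shows "proximity f r \<le> characteristic S f r" "wsum S r (pole_ord f) \<le> characteristic S f r"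
        "0 \<le> characteristic S f r"
  using proximity_nonneg[of f r] wsum_nonneg[of S "pole_ord f" r]
  by (auto simp: characteristic_def pole_ord_def)

text \<open>On |z| = R every Blaschke factor has modulus 1 and only \<open>exp (H z)\<close>
  remains. At the origin the factor of \<open>a\<close> has modulus |a| / R, and the logarithms of
  these moduli add up to the \<open>wsum\<close> term.\<close>

lemma ln_norm_factorization:
  assumes div: "divisor_in f S" and good: "good_radius S R"
  obtains R' H where "R' > R" "H holomorphic_on ball 0 R'" "S \<inter> ball 0 R' = S \<inter> ball 0 R"
    "\<And>a z :: complex. a \<in> S \<inter> ball 0 R \<Longrightarrow> z \<in> ball 0 R' \<Longrightarrow> norm a * norm z < R\<^sup>2"
    "\<And>z. z \<in> ball 0 R' - S \<Longrightarrow>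
        f z = exp (H z) * (\<Prod>a\<in>S\<inter>ball 0 R. blaschke R a z powi zorder f a)"
    "\<And>z. norm z = R \<Longrightarrow> ln (norm (f z)) = Re (H z)"
    "ln (norm (f 0)) = Re (H 0) - wsum S R (\<lambda>a. of_int (zorder f a))"
proof -
  have R: "R > 0" "\<And>a. a \<in> S \<Longrightarrow> norm a \<noteq> R" using good by (auto simp: good_radius_def)
  obtain R' H where *: "R' > R" "H holomorphic_on ball 0 R'" "S \<inter> ball 0 R' = S \<inter> ball 0 R"
    "\<And>a z :: complex. a \<in> S \<inter> ball 0 R \<Longrightarrow> z \<in> ball 0 R' \<Longrightarrow> norm a * norm z < R\<^sup>2"
    and eq: "\<And>z. z \<in> ball 0 R' - S \<Longrightarrow>
        f z = exp (H z) * (\<Prod>a\<in>S\<inter>ball 0 R. blaschke R a z powi zorder f a)"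
    using blaschke_factorization[OF div R] by blast
  have 1: "ln (norm (f z)) = Re (H z)" if z: "norm z = R" for z
  proof -
    have "norm (f z) = exp (Re (H z)) * (\<Prod>a\<in>S\<inter>ball 0 R. norm (blaschke R a z) powi zorder f a)"
      using eq[of z] z R * by (auto simp: norm_mult norm_power_int simp flip: prod_norm)
    also have "(\<Prod>a\<in>S\<inter>ball 0 R. norm (blaschke R a z) powi zorder f a) = 1"
      using norm_blaschke_eq_1[OF z] by (intro prod.neutral) auto
    finally show ?thesis by simp
  qed
  have nz: "a \<noteq> 0" if "a \<in> S" for a using that divisor_inD(3)[OF div] by auto
  have fin: "finite (S \<inter> ball 0 R)" using divisor_inD(2)[OF div] by (rule sparse_in_UNIV_finite_cball)
  have 2: "ln (norm (f 0)) = Re (H 0) - wsum S R (\<lambda>a. of_int (zorder f a))"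
  proof -
    have "norm (f 0) = exp (Re (H 0)) * (\<Prod>a\<in>S\<inter>ball 0 R. norm (blaschke R a 0) powi zorder f a)"
      using eq[of 0] R * divisor_inD(3)[OF div] by (auto simp: norm_mult norm_power_int simp flip: prod_norm)
    also have "(\<Prod>a\<in>S\<inter>ball 0 R. norm (blaschke R a 0) powi zorder f a) =
               (\<Prod>a\<in>S\<inter>ball 0 R. exp (- (zorder f a * ln (R / norm a))))"
    proof (rule prod.cong)
      fix a assume a: "a \<in> S \<inter> ball 0 R"
      have p: "norm a / R > 0" using nz a R by auto
      have "norm (blaschke R a 0) powi zorder f a = (norm a / R) powi zorder f a"
        using norm_blaschke_0[OF R(1), of a] by simp
      also have "\<dots> = exp (zorder f a * ln (norm a / R))"
        using p powr_real_of_int'[of "norm a / R" "zorder f a"] R nz a by (simp add: powr_def)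
      also have "ln (norm a / R) = - ln (R / norm a)"
        using nz a R by (simp add: ln_div)
      finally show "norm (blaschke R a 0) powi zorder f a = exp (- (zorder f a * ln (R / norm a)))"
        by simp
    qed auto
    also have "\<dots> = exp (- wsum S R (\<lambda>a. of_int (zorder f a)))"
      using fin by (simp add: exp_sum wsum_def sum_negf [symmetric])
    finally show ?thesis by (simp add: ln_mult)
  qed
  show ?thesis by (rule that[OF * eq 1 2])
qed

text \<open>The harmonic function \<open>Re (H z)\<close> agrees with ln |f| on the circle, and its
  mean is its value at the origin.\<close>

theorem Jensen_formula:
  assumes div: "divisor_in f S" and good: "good_radius S R"
  shows "circle_mean (\<lambda>z. ln (norm (f z))) R = ln (norm (f 0)) + wsum S R (\<lambda>a. of_int (zorder f a))"
proof -
  have R: "R > 0" using good by (auto simp: good_radius_def)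
  obtain R' H where *: "R' > R" "H holomorphic_on ball 0 R'" "S \<inter> ball 0 R' = S \<inter> ball 0 R"
    "\<And>a z :: complex. a \<in> S \<inter> ball 0 R \<Longrightarrow> z \<in> ball 0 R' \<Longrightarrow> norm a * norm z < R\<^sup>2"
    "\<And>z. z \<in> ball 0 R' - S \<Longrightarrow>
        f z = exp (H z) * (\<Prod>a\<in>S\<inter>ball 0 R. blaschke R a z powi zorder f a)"
    "\<And>z. norm z = R \<Longrightarrow> ln (norm (f z)) = Re (H z)"
    "ln (norm (f 0)) = Re (H 0) - wsum S R (\<lambda>a. of_int (zorder f a))"
    by (fact ln_norm_factorization[OF assms])
  have "circle_mean (\<lambda>z. ln (norm (f z))) R = circle_mean (\<lambda>z. Re (H z)) R"
    using R *(6) by (intro circle_mean_cong) auto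
  also have "\<dots> = Re (H 0)" using circle_mean_Re_holomorphic[OF *(2) R *(1)] .
  finally show ?thesis using *(7) by simp
qed

lemma Jensen_zeros:
  assumes div: "divisor_in f S" and good: "good_radius S R"
  shows "wsum S R (zero_ord f) =
           circle_mean (\<lambda>z. ln (norm (f z))) R - ln (norm (f 0)) + wsum S R (pole_ord f)"
proof -
  have "wsum S R (zero_ord f) = wsum S R (\<lambda>a. of_int (zorder f a) + pole_ord f a)"
    by (intro arg_cong[where f = "wsum S R"] ext) (auto simp: zero_ord_def pole_ord_def)
  thus ?thesis using Jensen_formula[OF assms] by (simp add: wsum_add)
qed

text \<open>Jensen's formula together with ln |f| \<le> ln (max 1 |f|): the half of the first main
  theorem that bounds the zeros by the characteristic.\<close>

lemma wsum_zero_ord_le: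
  assumes div: "divisor_in f S" and good: "good_radius S R"
  shows "wsum S R (zero_ord f) \<le> characteristic S f R - ln (norm (f 0))"
proof -
  have "circle_mean (\<lambda>z. ln (norm (f z))) R \<le> proximity f R"
    unfolding proximity_def
    using good_radiusD[OF good div] continuous_on_ln_norm[OF good div]
    by (intro circle_mean_mono) auto
  thus ?thesis using Jensen_zeros[OF assms] by (simp add: characteristic_def)
qed

lemma wsum_abs_zorder_le:
  assumes div: "divisor_in f S" and good: "good_radius S R"
  shows "wsum S R (\<lambda>a. \<bar>of_int (zorder f a)\<bar>) \<le> 2 * characteristic S f R + \<bar>ln (norm (f 0))\<bar>"
proof -
  have "wsum S R (\<lambda>a. \<bar>of_int (zorder f a)\<bar>) = wsum S R (\<lambda>a. zero_ord f a + pole_ord f a)"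
    by (intro arg_cong[where f = "wsum S R"] ext) (auto simp: zero_ord_def pole_ord_def)
  thus ?thesis using wsum_zero_ord_le[OF assms] characteristic_ge(2)[of S R f]
    by (simp add: wsum_add)
qed

text \<open>Since |x| = 2 max(0, x) - x, it suffices to bound the mean of ln |f| from below, and
  Jensen's formula does so.\<close>

lemma circle_mean_abs_ln_le:
  assumes div: "divisor_in f S" and good: "good_radius S R"
  shows "circle_mean (\<lambda>z. \<bar>ln (norm (f z))\<bar>) R \<le> 2 * characteristic S f R + \<bar>ln (norm (f 0))\<bar>"
proof -
  note c = continuous_on_ln_norm[OF good div] and g = good_radiusD[OF good div]
  have "circle_mean (\<lambda>z. \<bar>ln (norm (f z))\<bar>) R =
          circle_mean (\<lambda>z. 2 * ln (max 1 (norm (f z))) - ln (norm (f z))) R"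
    using g by (intro circle_mean_cong) (auto simp: max_def abs_if)
  also have "\<dots> = 2 * proximity f R - circle_mean (\<lambda>z. ln (norm (f z))) R"
    using c g by (subst circle_mean_diff) (auto simp: circle_mean_cmult proximity_def intro!: continuous_intros)
  finally show ?thesis
    using Jensen_zeros[OF assms] wsum_nonneg[of S "zero_ord f" R] wsum_nonneg[of S "pole_ord f" R]
    by (auto simp: characteristic_def zero_ord_def pole_ord_def)
qed

section \<open>Logarithmic derivatives\<close>

lemma has_field_derivative_prod_log:
  fixes u :: "'a \<Rightarrow> complex \<Rightarrow> complex"
  assumes "finite A" "\<And>a. a \<in> A \<Longrightarrow> (u a has_field_derivative u a z * k a) (at z)"
  shows   "((\<lambda>w. \<Prod>a\<in>A. u a w) has_field_derivative (\<Prod>a\<in>A. u a z) * (\<Sum>a\<in>A. k a)) (at z)"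
  using assms
proof (induction A rule: finite_induct)
  case (insert x A)
  have "((\<lambda>w. u x w * (\<Prod>a\<in>A. u a w)) has_field_derivative
          (u x z * k x) * (\<Prod>a\<in>A. u a z) + ((\<Prod>a\<in>A. u a z) * (\<Sum>a\<in>A. k a)) * u x z) (at z)"
    using insert by (intro DERIV_mult) auto
  thus ?case using insert by (simp add: algebra_simps)
qed auto

text \<open>A pointwise form of the lemma on the logarithmic derivative: on circles that keep a
  distance \<open>\<delta>\<close> from all zeros and poles no exceptional set or averaging is needed.\<close>
lemma log_deriv_bound:
  assumes div: "divisor_in f S" and good: "good_radius S R" and z: "norm z < R"
    and \<delta>: "\<delta> > 0" "\<And>a. a \<in> S \<Longrightarrow> \<delta> \<le> \<bar>norm z - norm a\<bar>"
  shows "norm (deriv f z / f z) \<le>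
           (2 * R / (R - norm z)\<^sup>2 + 2 * R / (\<delta> * (R - norm z))) *
           (2 * characteristic S f R + \<bar>ln (norm (f 0))\<bar>)"
proof -
  have R: "R > 0" using good by (auto simp: good_radius_def)
  obtain R' H where F: "R' > R" "H holomorphic_on ball 0 R'" "S \<inter> ball 0 R' = S \<inter> ball 0 R"
    "\<And>a z :: complex. a \<in> S \<inter> ball 0 R \<Longrightarrow> z \<in> ball 0 R' \<Longrightarrow> norm a * norm z < R\<^sup>2"
    "\<And>z. z \<in> ball 0 R' - S \<Longrightarrow>
        f z = exp (H z) * (\<Prod>a\<in>S\<inter>ball 0 R. blaschke R a z powi zorder f a)"
    "\<And>z. norm z = R \<Longrightarrow> ln (norm (f z)) = Re (H z)"
    "ln (norm (f 0)) = Re (H 0) - wsum S R (\<lambda>a. of_int (zorder f a))"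
    by (fact ln_norm_factorization[OF div good])
  note R' = F(1) and H = F(2) and S = F(3) and small = F(4) and eq = F(5) and ReH = F(6)
  define A where "A = S \<inter> ball 0 R"
  define q where "q = (\<lambda>a. of_real (R\<^sup>2 - (norm a)\<^sup>2) / ((z - a) * (of_real (R\<^sup>2) - cnj a * z)))"
  have fin: "finite A" unfolding A_def using divisor_inD(2)[OF div] by (rule sparse_in_UNIV_finite_cball)
  have zS: "z \<notin> S" using \<delta> by force
  have zR': "z \<in> ball 0 R'" using z R' by simp
  have opn: "open (ball 0 R' - S)"
    using divisor_inD(2)[OF div] by (intro open_Diff sparse_in_UNIV_imp_closed) auto
  have dH: "(H has_field_derivative deriv H z) (at z)"
    using H zR' by (intro holomorphic_derivI) auto
  have "((\<lambda>w. exp (H w) * (\<Prod>a\<in>A. blaschke R a w powi zorder f a)) has_field_derivative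
          (exp (H z) * (\<Prod>a\<in>A. blaschke R a z powi zorder f a)) *
             (deriv H z + (\<Sum>a\<in>A. of_int (zorder f a) * q a))) (at z)"
  proof -
    have "((\<lambda>w. blaschke R a w powi zorder f a) has_field_derivative
             blaschke R a z powi zorder f a * (of_int (zorder f a) * q a)) (at z)" if a: "a \<in> A" for a
    proof -
      have za: "z \<noteq> a" using zS a by (auto simp: A_def)
      have s: "norm a * norm z < R\<^sup>2" using small a zR' by (auto simp: A_def)
      have nz: "blaschke R a z \<noteq> 0" using blaschke_eq_0_iff[OF s R] za by simp
      show ?thesis
        using blaschke_has_field_derivative[OF s za] nz
        by (auto intro!: derivative_eq_intros simp: q_def power_int_diff)
    qed
    from has_field_derivative_prod_log[OF fin this]
    show ?thesis
      by (auto intro!: derivative_eq_intros dH simp: algebra_simps)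
  qed
  also have "?this \<longleftrightarrow> (f has_field_derivative f z * (deriv H z + (\<Sum>a\<in>A. of_int (zorder f a) * q a))) (at z)"
    using eq[of z] zS zR' opn
    by (intro has_field_derivative_cong_ev refl eventually_mono[OF eventually_nhds_in_open[OF opn, of z]])
       (auto simp: A_def eq)
  finally have "deriv f z = f z * (deriv H z + (\<Sum>a\<in>A. of_int (zorder f a) * q a))"
    by (rule DERIV_imp_deriv)
  hence ld: "deriv f z / f z = deriv H z + (\<Sum>a\<in>A. of_int (zorder f a) * q a)"
    using divisor_inD(5)[OF div zS] by simp
  have 1: "norm (deriv H z) \<le> 2 * R / (R - norm z)\<^sup>2 * circle_mean (\<lambda>w. \<bar>ln (norm (f w))\<bar>) R"
  proof -
    have "circle_mean (\<lambda>w. \<bar>ln (norm (f w))\<bar>) R = circle_mean (\<lambda>w. \<bar>Re (H w)\<bar>) R"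
      using ReH R by (intro circle_mean_cong) auto
    thus ?thesis using norm_deriv_le_circle_mean_Re[OF H R R' z] by simp
  qed
  have 2: "norm (\<Sum>a\<in>A. of_int (zorder f a) * q a) \<le>
             2 * R / (\<delta> * (R - norm z)) * wsum S R (\<lambda>a. \<bar>of_int (zorder f a)\<bar>)"
  proof -
    have "norm (\<Sum>a\<in>A. of_int (zorder f a) * q a) \<le>
            (\<Sum>a\<in>A. 2 * R / (\<delta> * (R - norm z)) * (\<bar>of_int (zorder f a)\<bar> * ln (R / norm a)))"
    proof (rule sum_norm_le)
      fix a assume a: "a \<in> A"
      have nz: "norm a > 0" using a divisor_inD(3)[OF div] by (auto simp: A_def)
      have aR: "norm a < R" using a by (simp add: A_def)
      have d: "norm (z - a) \<ge> \<delta>"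
        using \<delta>(2)[of a] a norm_triangle_ineq3[of z a] by (auto simp: A_def)
      have "norm (of_real (R\<^sup>2) :: complex) = R\<^sup>2" by (simp add: norm_power)
      moreover have "norm (cnj a * z) \<le> R * norm z"
        using aR by (auto simp: norm_mult intro!: mult_right_mono)
      ultimately have e: "norm (of_real (R\<^sup>2) - cnj a * z) \<ge> R * (R - norm z)"
        using norm_triangle_ineq2[of "of_real (R\<^sup>2)" "cnj a * z"]
        by (simp add: algebra_simps power2_eq_square)
      \<comment> \<open>From ln x \<le> x - 1 at x = (|a| / R)^2. It converts the numerator of
        \<open>q a\<close> into the weight of \<open>a\<close> in \<open>wsum\<close>, so the sum is
        controlled by the counting functions.\<close>
      have ln: "R\<^sup>2 - (norm a)\<^sup>2 \<le> 2 * R\<^sup>2 * ln (R / norm a)"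
      proof -
        have "ln ((norm a / R)\<^sup>2) \<le> (norm a / R)\<^sup>2 - 1"
          using nz R by (intro ln_le_minus_one) auto
        moreover have "ln ((norm a / R)\<^sup>2) = - 2 * ln (R / norm a)"
          using nz R by (simp add: ln_realpow ln_div)
        ultimately have "1 - (norm a / R)\<^sup>2 \<le> 2 * ln (R / norm a)" by simp
        hence "R\<^sup>2 * (1 - (norm a / R)\<^sup>2) \<le> R\<^sup>2 * (2 * ln (R / norm a))"
          by (intro mult_left_mono) auto
        moreover have "R\<^sup>2 * (1 - (norm a / R)\<^sup>2) = R\<^sup>2 - (norm a)\<^sup>2"
          using R by (simp add: power_divide right_diff_distrib)
        ultimately show ?thesis by (simp add: mult_ac)
      qed
      have "norm (of_real (R\<^sup>2 - (norm a)\<^sup>2) :: complex) = \<bar>R\<^sup>2 - (norm a)\<^sup>2\<bar>"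
        by (rule norm_of_real)
      also have "\<dots> = R\<^sup>2 - (norm a)\<^sup>2" using aR by (simp add: power_mono)
      finally have n: "norm (of_real (R\<^sup>2 - (norm a)\<^sup>2) :: complex) = R\<^sup>2 - (norm a)\<^sup>2" .
      have "norm (q a) = (R\<^sup>2 - (norm a)\<^sup>2) / (norm (z - a) * norm (of_real (R\<^sup>2) - cnj a * z))"
        unfolding q_def norm_divide norm_mult n ..
      also have "\<dots> \<le> (2 * R\<^sup>2 * ln (R / norm a)) / (\<delta> * (R * (R - norm z)))"
      proof (rule frac_le)
        show "0 \<le> 2 * R\<^sup>2 * ln (R / norm a)" using nz aR by simp
        show "0 < \<delta> * (R * (R - norm z))" using \<delta>(1) R z by simp
        show "\<delta> * (R * (R - norm z)) \<le> norm (z - a) * norm (of_real (R\<^sup>2) - cnj a * z)"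
          using d e \<delta>(1) R z by (intro mult_mono) simp_all
      qed (rule ln)
      also have "\<dots> = 2 * R / (\<delta> * (R - norm z)) * ln (R / norm a)"
        using R by (simp add: power2_eq_square)
      finally have "\<bar>of_int (zorder f a)\<bar> * norm (q a) \<le>
                       \<bar>of_int (zorder f a)\<bar> * (2 * R / (\<delta> * (R - norm z)) * ln (R / norm a))"
        by (intro mult_left_mono) auto
      thus "norm (of_int (zorder f a) * q a) \<le>
              2 * R / (\<delta> * (R - norm z)) * (\<bar>of_int (zorder f a)\<bar> * ln (R / norm a))"
        by (simp add: norm_mult mult_ac)
    qed
    also have "\<dots> = 2 * R / (\<delta> * (R - norm z)) * wsum S R (\<lambda>a. \<bar>of_int (zorder f a)\<bar>)"
      by (simp add: wsum_def A_def sum_distrib_left)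
    finally show ?thesis .
  qed
  define C where "C = 2 * characteristic S f R + \<bar>ln (norm (f 0))\<bar>"
  have "norm (deriv f z / f z) \<le> norm (deriv H z) + norm (\<Sum>a\<in>A. of_int (zorder f a) * q a)"
    unfolding ld by (rule norm_triangle_ineq)
  also have "\<dots> \<le> 2 * R / (R - norm z)\<^sup>2 * C + 2 * R / (\<delta> * (R - norm z)) * C"
  proof (intro add_mono)
    have "2 * R / (R - norm z)\<^sup>2 * circle_mean (\<lambda>w. \<bar>ln (norm (f w))\<bar>) R \<le> 2 * R / (R - norm z)\<^sup>2 * C"
      using circle_mean_abs_ln_le[OF div good] R unfolding C_def by (intro mult_left_mono) auto
    with 1 show "norm (deriv H z) \<le> 2 * R / (R - norm z)\<^sup>2 * C" by linarith
    have "2 * R / (\<delta> * (R - norm z)) * wsum S R (\<lambda>a. \<bar>of_int (zorder f a)\<bar>) \<le>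
            2 * R / (\<delta> * (R - norm z)) * C"
      using wsum_abs_zorder_le[OF div good] R z \<delta>(1) unfolding C_def by (intro mult_left_mono) auto
    with 2 show "norm (\<Sum>a\<in>A. of_int (zorder f a) * q a) \<le> 2 * R / (\<delta> * (R - norm z)) * C" by linarith
  qed
  finally show ?thesis by (simp add: C_def distrib_right)
qed

section \<open>Milloux's inequality\<close>

text \<open>Write f = exp h with |h'| \<le> \<Lambda>. On a ball with \<Lambda> \<rho> \<le> 1 the
  real part of h exceeds its value at the centre by at most 1, so |f| \<le> e |f z| there, and
  Cauchy's inequality on the ball of half the radius gives the bound.\<close>

lemma higher_deriv_bound_of_log_deriv:
  assumes holo: "f holomorphic_on ball z \<rho>" and \<rho>: "\<rho> > 0"
    and nz: "\<And>w. w \<in> ball z \<rho> \<Longrightarrow> f w \<noteq> 0"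
    and le: "\<And>w. w \<in> ball z \<rho> \<Longrightarrow> norm (deriv f w / f w) \<le> \<Lambda>" and "\<Lambda> * \<rho> \<le> 1"
  shows "norm ((deriv ^^ k) f z) \<le> fact k * exp 1 / (\<rho> / 2) ^ k * norm (f z)"
proof -
  obtain h where h: "h holomorphic_on ball z \<rho>" "\<And>w. w \<in> ball z \<rho> \<Longrightarrow> exp (h w) = f w"
    using holomorphic_logarithm_exists[of "ball z \<rho>" f z] assms by auto
  have dh: "(h has_field_derivative deriv f w / f w) (at w)" if w: "w \<in> ball z \<rho>" for w
  proof -
    have d: "(h has_field_derivative deriv h w) (at w)"
      using h w by (intro holomorphic_derivI) auto
    have "((\<lambda>w. exp (h w)) has_field_derivative exp (h w) * deriv h w) (at w)"
      by (auto intro!: derivative_eq_intros d)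
    also have "?this \<longleftrightarrow> (f has_field_derivative f w * deriv h w) (at w)"
      using h w by (intro has_field_derivative_cong_ev refl
          eventually_mono[OF eventually_nhds_in_open[of "ball z \<rho>" w]]) auto
    finally have "deriv f w = f w * deriv h w" by (rule DERIV_imp_deriv)
    thus ?thesis using d nz[OF w] by simp
  qed
  have "\<Lambda> \<ge> 0" using le[of z] \<rho> order_trans[OF norm_ge_zero] by auto
  have bd: "norm (f w) \<le> exp 1 * norm (f z)" if w: "w \<in> ball z \<rho>" for w
  proof -
    have "norm (h w - h z) \<le> \<Lambda> * norm (w - z)"
      using dh le \<rho> w
      by (intro field_differentiable_bound[of "ball z \<rho>" h "\<lambda>w. deriv f w / f w"])
         (auto intro: has_field_derivative_at_within)
    also have "\<dots> \<le> \<Lambda> * \<rho>" using w \<open>\<Lambda> \<ge> 0\<close> by (intro mult_left_mono) (auto simp: dist_norm norm_minus_commute)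
    finally have "Re (h w) - Re (h z) \<le> 1"
      using assms(5) complex_Re_le_cmod[of "h w - h z"] by simp
    hence "exp (Re (h w)) \<le> exp (1 + Re (h z))" by simp
    moreover have "norm (f w) = exp (Re (h w))" "norm (f z) = exp (Re (h z))"
      using h(2)[OF w] h(2)[of z] \<rho> by (auto simp flip: norm_exp_eq_Re)
    ultimately show ?thesis by (simp add: exp_add)
  qed
  have "norm ((deriv ^^ k) f z) \<le> fact k * (exp 1 * norm (f z)) / (\<rho> / 2) ^ k"
  proof (rule Cauchy_inequality)
    have "cball z (\<rho> / 2) \<subseteq> ball z \<rho>" using \<rho> by auto
    thus "continuous_on (cball z (\<rho> / 2)) f" "f holomorphic_on ball z (\<rho> / 2)"
      using \<rho> by (auto intro!: holomorphic_on_imp_continuous_on intro: holomorphic_on_subset[OF holo])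
  qed (use \<rho> bd in \<open>auto simp: dist_norm\<close>)
  thus ?thesis by simp
qed

text \<open>One set \<open>S\<close> holds the zeros and poles of \<open>g\<close>, of
  \<open>F\<close> and of all derivatives involved, so that Jensen's formula applies to each of them
  on the same circles. The origin lies off \<open>S\<close>, which makes the terms at 0 finite
  constants.\<close>

locale milloux =
  fixes g :: "complex \<Rightarrow> complex" and c :: complex and k d m :: nat and S :: "complex set"
    and F F1 :: "complex \<Rightarrow> complex"
  defines "F \<equiv> \<lambda>z. (deriv ^^ k) g z - c" and "F1 \<equiv> (deriv ^^ Suc k) g"
  assumes g: "g nicely_meromorphic_on UNIV" and c: "c \<noteq> 0" and d: "d \<ge> k + 2" and m: "m > 0"
    and zeros: "\<And>a. isolated_zero g a \<Longrightarrow> zorder g a \<ge> int d"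
    and poles: "\<And>a. is_pole g a \<Longrightarrow> zorder g a \<le> -2"
    and F_zeros: "\<And>a. isolated_zero F a \<Longrightarrow> zorder F a \<ge> int m"
    and S: "S sparse_in UNIV" "0 \<notin> S"
    and off_S: "\<And>z. z \<notin> S \<Longrightarrow> \<not>is_pole g z" "\<And>z j. z \<notin> S \<Longrightarrow> j \<le> Suc k \<Longrightarrow> (deriv ^^ j) g z \<noteq> 0"
      "\<And>z. z \<notin> S \<Longrightarrow> F z \<noteq> 0"
begin

definition \<Phi> :: "complex \<Rightarrow> complex" where "\<Phi> z = g z * F z / F1 z"

lemma analytic_g: "\<not>is_pole g z \<Longrightarrow> g analytic_on {z}"
  using nicely_meromorphic_on_imp_analytic_at[OF g] by simp

lemma meromorphic_deriv: "(deriv ^^ j) g meromorphic_on A"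
  using g meromorphic_on_subset[of g UNIV A] unfolding nicely_meromorphic_on_def
  by (intro meromorphic_intros) auto

lemma analytic_deriv_g: "\<not>is_pole g z \<Longrightarrow> (deriv ^^ j) g analytic_on {z}"
  using analytic_g by (intro analytic_on_deriv analytic_higher_deriv)

lemma divisor_in_deriv: "j \<le> Suc k \<Longrightarrow> divisor_in ((deriv ^^ j) g) S"
  unfolding divisor_in_def using meromorphic_deriv S off_S analytic_deriv_g by auto

lemma divisor_in_g: "divisor_in g S"
  using divisor_in_deriv[of 0] by simp

lemma analytic_F: "\<not>is_pole g z \<Longrightarrow> F analytic_on {z}"
  unfolding F_def by (intro analytic_on_diff analytic_deriv_g analytic_on_const)

lemma divisor_in_F: "divisor_in F S"
proof -
  have "F meromorphic_on UNIV"
    unfolding F_def by (intro meromorphic_on_diff meromorphic_deriv meromorphic_on_const)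
  thus ?thesis unfolding divisor_in_def using S off_S analytic_F by auto
qed

lemma divisor_in_F1: "divisor_in F1 S"
  unfolding F1_def by (rule divisor_in_deriv) auto

lemma divisor_in_\<Phi>: "divisor_in \<Phi> S"
  using divisor_in_g divisor_in_F divisor_in_F1
  unfolding divisor_in_def \<Phi>_def [abs_def]
  by (auto intro!: meromorphic_intros analytic_intros)

lemma deriv_F: "\<not>is_pole g z \<Longrightarrow> deriv F z = F1 z"
  using analytic_deriv_g[of z k] unfolding F_def F1_def
  by (auto simp: analytic_on_imp_differentiable_at)

lemma eventually_not_in_S: "eventually (\<lambda>z. z \<notin> S) (at a)"
  using S by (auto simp: sparse_in_def islimpt_iff_eventually)

lemma zorder_F1:
  assumes "zorder F a \<noteq> 0"
  shows   "zorder F1 a = zorder F a - 1"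
proof -
  have "zorder F1 a = zorder (deriv F) a"
    using eventually_mono[OF eventually_not_in_S[of a]] deriv_F off_S
    by (intro zorder_cong refl) fastforce
  also have "\<dots> = zorder F a - 1"
    using divisor_in_F divisor_inD(1)[OF divisor_in_F, of "{a}"] assms divisor_in_eventually_nz[OF divisor_in_F, of a]
    by (intro zorder_deriv_minus_1) (auto simp: meromorphic_at_iff eventually_frequently)
  finally show ?thesis .
qed

text \<open>Differentiation lowers the order by one unless the order is 0. The hypothesis keeps the
  orders of \<open>g\<close> and of its first k derivatives away from 0.\<close>

lemma zorder_deriv_g:
  assumes "zorder g a < 0 \<or> zorder g a > int k" "j \<le> Suc k"
  shows   "zorder ((deriv ^^ j) g) a = zorder g a - int j"
  using assms(2)
proof (induction j)
  case (Suc j)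
  have "zorder (deriv ((deriv ^^ j) g)) a = zorder ((deriv ^^ j) g) a - 1"
    using Suc assms(1) meromorphic_deriv[of j "{a}"] divisor_in_eventually_nz[OF divisor_in_deriv[of j], of a]
    by (intro zorder_deriv_minus_1) (auto simp: meromorphic_at_iff eventually_frequently)
  thus ?case using Suc by simp
qed auto

lemma zorder_\<Phi>: "zorder \<Phi> a = zorder g a + zorder F a - zorder F1 a"
proof -
  note nz = divisor_in_eventually_nz[of _ S a, THEN eventually_frequently[rotated]]
  have gF: "divisor_in (\<lambda>z. g z * F z) S"
    using divisor_in_g divisor_in_F unfolding divisor_in_def
    by (auto intro!: meromorphic_intros analytic_intros)
  have "zorder \<Phi> a = zorder (\<lambda>z. g z * F z) a - zorder F1 a"
    unfolding \<Phi>_def [abs_def] using nz[OF gF] nz[OF divisor_in_F1] divisor_inD(1)[OF gF] divisor_inD(1)[OF divisor_in_F1]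
    by (intro zorder_divide) auto
  also have "zorder (\<lambda>z. g z * F z) a = zorder g a + zorder F a"
    using nz[OF divisor_in_g] nz[OF divisor_in_F] divisor_inD(1)[OF divisor_in_g] divisor_inD(1)[OF divisor_in_F]
    by (intro zorder_mult) auto
  finally show ?thesis .
qed

text \<open>A count at each point. At a pole of order p \<ge> 2, \<Phi> has a pole of order p - 1
  and the left side is 1 \<le> p/2. At a zero of order p \<ge> d, \<open>F\<close> takes the value
  -c and \<Phi> vanishes to order k + 1 \<le> (k + 1) p/d. At a zero of \<open>F\<close> where
  \<open>g\<close> has order 0, \<Phi> vanishes to order 1, which is at most 1/m times the order of
  \<open>F\<close>. Elsewhere \<Phi> has order at most 0. The second estimate compares p + k with p
  at a pole, again by p \<ge> 2.\<close>

lemma order_estimates: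
  shows "of_int (zorder \<Phi> a) + pole_ord g a \<le>
           (real k + 1) / real d * zero_ord g a + 1 / 2 * pole_ord g a + 1 / real m * zero_ord F a"
        (is ?A)
    and "pole_ord F a \<le> (1 + real k / 2) * pole_ord g a" (is ?B)
proof -
  note nz = divisor_in_eventually_nz[of _ S a] divisor_in_eventually_nz[of _ S a, THEN eventually_frequently[rotated]]
  have mero: "f meromorphic_on {a}" if "divisor_in f S" for f using divisor_inD(1)[OF that] .
  have iso: "isolated_singularity_at f a" if "divisor_in f S" for f
    using mero[OF that] by (simp add: meromorphic_at_iff)
  define p where "p = zorder g a"
  have zorder_F: "zorder F a = (if p < 0 then p - int k else 0)" if "p < 0 \<or> p > int k"
  proof -
    have z: "zorder ((deriv ^^ k) g) a = p - int k"
      using that unfolding p_def by (intro zorder_deriv_g) auto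
    have "frequently (\<lambda>z. c \<noteq> 0) (at a)" using c by simp
    thus ?thesis
      using zorder_diff1[of "(deriv ^^ k) g" a "\<lambda>_. c"] zorder_diff2[of "(deriv ^^ k) g" a "\<lambda>_. c"]
            nz(2)[OF divisor_in_deriv[of k]] meromorphic_deriv[of k "{a}"] meromorphic_on_const[of c "{a}"] that z c
      unfolding F_def by auto
  qed
  consider "p < 0" | "p > 0" | "p = 0" "zorder F a \<le> 0" | "p = 0" "zorder F a > 0" by linarith
  hence "?A \<and> ?B"
  proof cases
    case 1
    have "is_pole g a"
      using 1 nz(1)[OF divisor_in_g] mero[OF divisor_in_g] by (intro zorder_neg_imp_is_pole) (auto simp: p_def)
    hence "p \<le> -2" using poles by (simp add: p_def)
    moreover have "zorder F a = p - int k" "zorder F1 a = p - int k - 1"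
      using 1 zorder_F zorder_F1[of a] by auto
    moreover have "real k \<le> real k * (- of_int p / 2)"
      using \<open>p \<le> -2\<close> by (intro mult_le_cancel_left1[THEN iffD2]) auto
    ultimately show ?thesis
      using 1 by (auto simp: zorder_\<Phi> pole_ord_def zero_ord_def p_def [symmetric] field_simps)
  next
    case 2
    have "isolated_zero g a"
      using 2 nz(1)[OF divisor_in_g] mero[OF divisor_in_g] by (intro zorder_pos_imp_isolated_zero) (auto simp: p_def)
    hence p: "p \<ge> int d" using zeros by (simp add: p_def)
    hence "zorder F a = 0" using d zorder_F by auto
    moreover have "zorder F1 a = p - int k - 1"
      using zorder_deriv_g[of a "Suc k"] p d by (auto simp: F1_def p_def)
    moreover have "real k + 1 \<le> (real k + 1) / real d * of_int p"
    proof -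
      have "(real k + 1) * real d \<le> (real k + 1) * of_int p" using p by (intro mult_left_mono) auto
      thus ?thesis using d by (simp add: field_simps)
    qed
    ultimately show ?thesis
      using 2 by (auto simp: zorder_\<Phi> pole_ord_def zero_ord_def p_def [symmetric])
  next
    case 3
    have np: "\<not>is_pole g a"
      using isolated_pole_imp_neg_zorder[OF iso[OF divisor_in_g]] 3 by (auto simp: p_def)
    have "zorder F a \<ge> 0" "zorder F1 a \<ge> 0"
      using analytic_F[OF np] analytic_deriv_g[OF np, of "Suc k"] nz(2)[OF divisor_in_F] nz(2)[OF divisor_in_F1]
      by (auto intro!: zorder_ge_0 simp: F1_def)
    with 3 show ?thesis by (auto simp: zorder_\<Phi> pole_ord_def zero_ord_def p_def [symmetric])
  next
    case 4
    have "isolated_zero F a"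
      using 4 nz(1)[OF divisor_in_F] mero[OF divisor_in_F] by (intro zorder_pos_imp_isolated_zero) auto
    hence "zorder F a \<ge> int m" by (rule F_zeros)
    moreover have "zorder F1 a = zorder F a - 1" using 4 by (intro zorder_F1) auto
    moreover have "1 \<le> 1 / real m * of_int (zorder F a)"
      using \<open>zorder F a \<ge> int m\<close> m by (simp add: field_simps)
    ultimately show ?thesis
      using 4 by (auto simp: zorder_\<Phi> pole_ord_def zero_ord_def p_def [symmetric])
  qed
  thus ?A ?B by auto
qed

text \<open>The coefficients of \<open>order_estimates\<close> after each counting function is
  bounded by T(r, g). The last one is 1/m times 1 + k/2, the factor by which T(r, F) may exceed T(r,
  g) up to the error term.\<close>

definition \<theta> :: real where
  "\<theta> = (real k + 1) / real d + 1 / 2 + (real k + 2) / (2 * real m)"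

lemma g_0_nz: "g 0 \<noteq> 0" "F 0 \<noteq> 0" "F1 0 \<noteq> 0" "\<Phi> 0 \<noteq> 0"
  using divisor_in_g divisor_in_F divisor_in_F1 divisor_in_\<Phi> S(2) by (auto simp: divisor_in_def)

text \<open>On the circle |F| is at most (1 + |c|) B max(1, |g|), so passing to \<open>F\<close>
  adds only the logarithm of this factor to the proximity. The factor 1 + k/2 comes from the poles,
  whose orders grow by k.\<close>

lemma characteristic_F_le:
  assumes good: "good_radius S r" and B: "B \<ge> 1"
    and le: "\<And>z. norm z = r \<Longrightarrow> norm ((deriv ^^ k) g z) \<le> B * norm (g z)"
  shows "characteristic S F r \<le> (1 + real k / 2) * characteristic S g r + ln B + ln (1 + norm c)"
proof -
  have r: "r > 0" using good by (simp add: good_radius_def)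
  note cont = continuous_on_ln_norm[OF good]
  have "proximity F r \<le> circle_mean (\<lambda>z. ln (max 1 (norm (g z))) + (ln B + ln (1 + norm c))) r"
    unfolding proximity_def
  proof (intro circle_mean_mono)
    fix z :: complex assume z: "norm z = r"
    have "norm (F z) \<le> norm ((deriv ^^ k) g z) + norm c" unfolding F_def by (rule norm_triangle_ineq4)
    also have "\<dots> \<le> B * norm (g z) + norm c" using le[OF z] by simp
    also have "\<dots> \<le> B * max 1 (norm (g z)) + norm c * (B * max 1 (norm (g z)))"
    proof (intro add_mono mult_left_mono)
      have "1 * 1 \<le> B * max 1 (norm (g z))" using B by (intro mult_mono) auto
      thus "norm c \<le> norm c * (B * max 1 (norm (g z)))"
        using mult_left_mono[of 1 "B * max 1 (norm (g z))" "norm c"] by simp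
    qed (use B in auto)
    finally have *: "norm (F z) \<le> (1 + norm c) * B * max 1 (norm (g z))" by (simp add: algebra_simps)
    have "1 * 1 * 1 \<le> (1 + norm c) * B * max 1 (norm (g z))" using B by (intro mult_mono) auto
    with * have "ln (max 1 (norm (F z))) \<le> ln ((1 + norm c) * B * max 1 (norm (g z)))"
      by (subst ln_le_cancel_iff) auto
    also have "\<dots> = ln (1 + norm c) + ln B + ln (max 1 (norm (g z)))"
    proof -
      have "1 + norm c > 0" "B > 0" "max 1 (norm (g z)) > 0" using B by (auto intro: add_pos_nonneg)
      thus ?thesis by (simp add: ln_mult)
    qed
    finally show "ln (max 1 (norm (F z))) \<le> ln (max 1 (norm (g z))) + (ln B + ln (1 + norm c))" by simp
  qed (use r in \<open>auto intro!: continuous_on_add continuous_on_const cont divisor_in_F divisor_in_g\<close>)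
  also have "\<dots> = proximity g r + (ln B + ln (1 + norm c))"
    unfolding proximity_def using r
    by (subst circle_mean_add) (auto intro!: continuous_on_const cont divisor_in_g)
  finally have 1: "proximity F r \<le> proximity g r + (ln B + ln (1 + norm c))" .
  have 2: "wsum S r (pole_ord F) \<le> (1 + real k / 2) * wsum S r (pole_ord g)"
    using order_estimates(2) by (subst wsum_cmult [symmetric], intro wsum_mono)
  have 3: "proximity g r \<le> (1 + real k / 2) * proximity g r"
    using proximity_nonneg[of g r] by (simp add: distrib_right)
  from 1 2 3 show ?thesis unfolding characteristic_def by (simp add: distrib_left)
qed

text \<open>On a circle where the logarithmic derivatives are at most \<open>B\<close>, the identity
  \<open>c = g\<^sup>(\<^sup>k\<^sup>) - F\<close> makes \<open>\<Phi>\<close> dominate \<open>max 1 |g|\<close> up to a constant factor.\<close>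
lemma milloux_inequality:
  obtains C where "\<And>r B. \<lbrakk>good_radius S r; B \<ge> 1;
      \<And>z. norm z = r \<Longrightarrow> norm ((deriv ^^ k) g z) \<le> B * norm (g z);
      \<And>z. norm z = r \<Longrightarrow> norm (F1 z) \<le> B * norm (g z);
      \<And>z. norm z = r \<Longrightarrow> norm (F1 z) \<le> B * norm (F z)\<rbrakk> \<Longrightarrow>
      characteristic S g r \<le> \<theta> * characteristic S g r + C + 3 * ln B"
proof -
  \<comment> \<open>Below, \<open>c1\<close> and \<open>c1\<close> times |g| are both bounded by 2
    B^2 |\<Phi>|, the first through |c| and the second through the cap at 1. Together they bound
    max(1, |g|).\<close>
  define c1 where "c1 = min 1 (norm c)"
  have c1: "c1 > 0" "c1 \<le> 1" "c1 \<le> norm c" using c by (auto simp: c1_def)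
  define C where "C = ln (2 / c1) + ln (norm (\<Phi> 0)) + (real k + 1) / real d * \<bar>ln (norm (g 0))\<bar> +
                        1 / real m * (ln (1 + norm c) + \<bar>ln (norm (F 0))\<bar>)"
  show ?thesis
  proof (rule that[of C])
    fix r B :: real
    assume good: "good_radius S r" and B: "B \<ge> 1"
      and le: "\<And>z. norm z = r \<Longrightarrow> norm ((deriv ^^ k) g z) \<le> B * norm (g z)"
        "\<And>z. norm z = r \<Longrightarrow> norm (F1 z) \<le> B * norm (g z)"
        "\<And>z. norm z = r \<Longrightarrow> norm (F1 z) \<le> B * norm (F z)"
    have r: "r > 0" using good by (simp add: good_radius_def)
    define T where "T = characteristic S g r"
    note cont = continuous_on_ln_norm[OF good]
    have "proximity g r \<le> circle_mean (\<lambda>z. ln (norm (\<Phi> z)) + (2 * ln B + ln (2 / c1))) r"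
      unfolding proximity_def
    proof (intro circle_mean_mono)
      fix z :: complex assume z: "norm z = r"
      have nz: "g z \<noteq> 0" "F z \<noteq> 0" "F1 z \<noteq> 0" "\<Phi> z \<noteq> 0"
        using good_radiusD(2)[OF good _ z] divisor_in_g divisor_in_F divisor_in_F1 divisor_in_\<Phi> by auto
      define q where "q = norm (F z) / norm (F1 z)"
      have q: "1 \<le> B * q" using le(3)[OF z] nz by (simp add: q_def field_simps)
      have \<Phi>: "norm (\<Phi> z) = norm (g z) * q" by (simp add: \<Phi>_def norm_mult norm_divide q_def)
      \<comment> \<open>The modulus of \<Phi> is |g| q. The derivative term gains the missing factor
        q from 1 \<le> B q, and |F| is q |F1|, where |F1| \<le> B |g|.\<close>
      have "norm c \<le> norm ((deriv ^^ k) g z) + norm (F z)"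
        using norm_triangle_ineq4[of "(deriv ^^ k) g z" "F z"] by (simp add: F_def)
      also have "\<dots> \<le> B * norm (g z) + q * (B * norm (g z))"
      proof (intro add_mono le z)
        have "norm (F z) = q * norm (F1 z)" using nz by (simp add: q_def)
        also have "\<dots> \<le> q * (B * norm (g z))" using le(2)[OF z] by (intro mult_left_mono) (auto simp: q_def)
        finally show "norm (F z) \<le> q * (B * norm (g z))" .
      qed
      also have "\<dots> \<le> B * norm (g z) * (B * q) + q * (B * norm (g z)) * B"
        using q B mult_left_mono[of 1 "B * q" "B * norm (g z)"] mult_left_mono[of 1 B "q * (B * norm (g z))"]
        by (intro add_mono) (auto simp: q_def)
      also have "\<dots> = 2 * B\<^sup>2 * norm (\<Phi> z)" by (simp add: \<Phi> power2_eq_square)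
      finally have 1: "c1 \<le> 2 * B\<^sup>2 * norm (\<Phi> z)" using c1 by linarith
      have "norm (g z) * 1 \<le> norm (g z) * (B * q)" using q by (intro mult_left_mono) auto
      also have "\<dots> = B * norm (\<Phi> z)" by (simp add: \<Phi>)
      also have "\<dots> \<le> 2 * B\<^sup>2 * norm (\<Phi> z)"
        using B by (intro mult_right_mono) (auto simp: power2_eq_square)
      finally have "c1 * norm (g z) \<le> 1 * (2 * B\<^sup>2 * norm (\<Phi> z))" using c1 by (intro mult_mono) auto
      with 1 have "max 1 (norm (g z)) \<le> 2 * B\<^sup>2 * norm (\<Phi> z) / c1" using c1(1) by (simp add: field_simps)
      hence "ln (max 1 (norm (g z))) \<le> ln (2 / c1 * B\<^sup>2 * norm (\<Phi> z))"
        using B c1(1) nz by (subst ln_le_cancel_iff) auto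
      also have "\<dots> = ln (2 / c1) + ln (B\<^sup>2) + ln (norm (\<Phi> z))"
      proof -
        have "2 / c1 > 0" "B\<^sup>2 > 0" "norm (\<Phi> z) > 0" using B c1(1) nz by auto
        thus ?thesis by (metis ln_mult_pos mult_pos_pos)
      qed
      also have "ln (B\<^sup>2) = 2 * ln B" using B by (simp add: ln_realpow)
      finally show "ln (max 1 (norm (g z))) \<le> ln (norm (\<Phi> z)) + (2 * ln B + ln (2 / c1))" by simp
    qed (use r in \<open>auto intro!: continuous_on_add continuous_on_const cont divisor_in_\<Phi> divisor_in_g\<close>)
    also have "\<dots> = circle_mean (\<lambda>z. ln (norm (\<Phi> z))) r + (2 * ln B + ln (2 / c1))"
      using r by (subst circle_mean_add) (auto intro!: continuous_on_const cont divisor_in_\<Phi>)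
    also have "circle_mean (\<lambda>z. ln (norm (\<Phi> z))) r = ln (norm (\<Phi> 0)) + wsum S r (\<lambda>a. of_int (zorder \<Phi> a))"
      by (rule Jensen_formula[OF divisor_in_\<Phi> good])
    \<comment> \<open>Adding the pole count N(r, g) to both sides turns m(r, g) into the
      characteristic on the left and forms on the right the sum that \<open>order_estimates\<close>
      bounds pointwise.\<close>
    finally have "T \<le> 2 * ln B + ln (2 / c1) + ln (norm (\<Phi> 0)) + wsum S r (\<lambda>a. of_int (zorder \<Phi> a) + pole_ord g a)"
      by (simp add: T_def characteristic_def wsum_add)
    also have "wsum S r (\<lambda>a. of_int (zorder \<Phi> a) + pole_ord g a) \<le>
                 wsum S r (\<lambda>a. (real k + 1) / real d * zero_ord g a + 1 / 2 * pole_ord g a + 1 / real m * zero_ord F a)"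
      using order_estimates(1) by (rule wsum_mono)
    also have "\<dots> = (real k + 1) / real d * wsum S r (zero_ord g) + 1 / 2 * wsum S r (pole_ord g) +
                    1 / real m * wsum S r (zero_ord F)"
      by (simp only: wsum_add wsum_cmult)
    also have "\<dots> \<le> (real k + 1) / real d * (T + \<bar>ln (norm (g 0))\<bar>) + 1 / 2 * T +
                    1 / real m * ((1 + real k / 2) * T + ln B + ln (1 + norm c) + \<bar>ln (norm (F 0))\<bar>)"
    proof (intro add_mono mult_left_mono)
      show "wsum S r (zero_ord g) \<le> T + \<bar>ln (norm (g 0))\<bar>"
        using wsum_zero_ord_le[OF divisor_in_g good] by (simp add: T_def)
      show "wsum S r (pole_ord g) \<le> T" unfolding T_def by (rule characteristic_ge)
      show "wsum S r (zero_ord F) \<le> (1 + real k / 2) * T + ln B + ln (1 + norm c) + \<bar>ln (norm (F 0))\<bar>"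
        using wsum_zero_ord_le[OF divisor_in_F good] characteristic_F_le[OF good B le(1)] by (simp add: T_def)
    qed auto
    also have "\<dots> = \<theta> * T + (real k + 1) / real d * \<bar>ln (norm (g 0))\<bar> +
                    1 / real m * (ln (1 + norm c) + \<bar>ln (norm (F 0))\<bar>) + 1 / real m * ln B"
      using d m by (simp add: \<theta>_def field_simps)
    finally have "T \<le> \<theta> * T + C + 2 * ln B + 1 / real m * ln B" by (simp add: C_def)
    moreover have "1 / real m * ln B \<le> 1 * ln B" using m B by (intro mult_right_mono) auto
    ultimately have "T \<le> \<theta> * T + C + 3 * ln B" by linarith
    thus "characteristic S g r \<le> \<theta> * characteristic S g r + C + 3 * ln B"
      by (simp add: T_def)
  qed
qed

end

section \<open>Bounds on compact ranges of radii, and circles away from zeros and poles\<close>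

lemma wsum_mono_radius:
  assumes "S sparse_in UNIV" "0 \<notin> S" "r \<le> R" "\<And>a. a \<in> S \<Longrightarrow> w a \<ge> 0"
  shows   "wsum S r w \<le> wsum S R w"
proof -
  have "wsum S r w \<le> (\<Sum>a\<in>S \<inter> ball 0 r. w a * ln (R / norm a))"
    unfolding wsum_def
  proof (intro sum_mono mult_left_mono)
    fix a assume a: "a \<in> S \<inter> ball 0 r"
    hence "norm a > 0" "norm a < r" using assms(2) by auto
    moreover from this have "r > 0" by linarith
    ultimately show "ln (r / norm a) \<le> ln (R / norm a)"
      using assms(3) by (auto simp: divide_right_mono)
  qed (use assms in auto)
  also have "\<dots> \<le> wsum S R w"
    unfolding wsum_def using assms sparse_in_UNIV_finite_cball(2)[of S R] wsum_ln_nonneg[of _ S R]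
    by (intro sum_mono2) auto
  finally show ?thesis .
qed

lemma divisor_in_quotient_entire:
  assumes "divisor_in f S"
  obtains p q where "p holomorphic_on UNIV" "q holomorphic_on UNIV"
    "\<And>z. z \<notin> S \<Longrightarrow> q z \<noteq> 0" "\<And>z. z \<notin> S \<Longrightarrow> f z = p z / q z"
proof -
  note D = divisor_inD[OF assms]
  define f' where "f' = remove_sings f"
  have "f' nicely_meromorphic_on UNIV"
    unfolding f'_def using D(1) by (rule remove_sings_nicely_meromorphic)
  then obtain h f1 f2 where *: "h holomorphic_on UNIV" "f1 holomorphic_on UNIV" "f2 holomorphic_on UNIV"
    "\<forall>z. f2 z = 0 \<longleftrightarrow> is_pole f' z" "\<forall>z. f' z = h z * f1 z / f2 z"
    by (rule weierstrass_factorization_meromorphic_UNIV) blast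
  show ?thesis
  proof (rule that[of "\<lambda>z. h z * f1 z" f2])
    fix z assume z: "z \<notin> S"
    have an: "f analytic_on {z}" using D(4)[OF z] .
    have "\<not>is_pole f z" using an analytic_at_imp_no_pole by blast
    moreover have "is_pole f' z \<longleftrightarrow> is_pole f z"
      unfolding f'_def using an
      by (intro is_pole_cong eventually_remove_sings_eq_at isolated_singularity_at_analytic) auto
    ultimately show "f2 z \<noteq> 0" using *(4) by auto
    show "f z = h z * f1 z / f2 z" using an *(5) by (metis f'_def remove_sings_at_analytic)
  qed (use * in \<open>auto intro!: holomorphic_intros\<close>)
qed

lemma entire_bounded_cball:
  assumes "p holomorphic_on UNIV"
  obtains M where "M \<ge> 1" "\<And>z. norm z \<le> X \<Longrightarrow> norm (p z) \<le> M"
proof -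
  have "compact (p ` cball 0 X)"
    using assms by (intro compact_continuous_image holomorphic_on_imp_continuous_on)
                   (auto intro: holomorphic_on_subset)
  then obtain M where "\<And>z. z \<in> cball 0 X \<Longrightarrow> norm (p z) \<le> M"
    using compact_imp_bounded bounded_iff by (metis imageI)
  thus ?thesis by (intro that[of "max 1 M"]) (auto simp: le_max_iff_disj)
qed

text \<open>The function may be huge on circles that pass close to a pole, so its proximity is not
  bounded through its size. With f = p/q for entire p and q, the proximity is at most a constant
  minus the mean of ln |q|, and Jensen's formula bounds that mean below by ln |q 0|, uniformly in
  the radius.\<close>

lemma characteristic_bounded:
  assumes div: "divisor_in f S"
  obtains M where "\<And>r. good_radius S r \<Longrightarrow> r \<le> X \<Longrightarrow> characteristic S f r \<le> M"
proof -
  note D = divisor_inD[OF div]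
  obtain p q where pq: "p holomorphic_on UNIV" "q holomorphic_on UNIV"
    "\<And>z. z \<notin> S \<Longrightarrow> q z \<noteq> 0" "\<And>z. z \<notin> S \<Longrightarrow> f z = p z / q z"
    using divisor_in_quotient_entire[OF div] by blast
  obtain Mp where Mp: "Mp \<ge> 1" "\<And>z. norm z \<le> X \<Longrightarrow> norm (p z) \<le> Mp"
    using entire_bounded_cball[OF pq(1)] by blast
  obtain Mq where Mq: "Mq \<ge> 1" "\<And>z. norm z \<le> X \<Longrightarrow> norm (q z) \<le> Mq"
    using entire_bounded_cball[OF pq(2)] by blast
  have an: "q analytic_on {z}" for z
    using pq(2) by (metis UNIV_I analytic_on_analytic_at analytic_on_holomorphic open_UNIV subset_UNIV)
  have divq: "divisor_in q S"
    unfolding divisor_in_def using D an pq(3) analytic_on_imp_meromorphic_on[of q UNIV]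
    by (auto simp: analytic_on_analytic_at[of q UNIV])
  show ?thesis
  proof (rule that)
    fix r assume good: "good_radius S r" and r: "r \<le> X"
    have r0: "r > 0" using good by (simp add: good_radius_def)
    note cont = continuous_on_ln_norm[OF good]
    have "proximity f r \<le> circle_mean (\<lambda>z. (ln Mp + ln Mq) - ln (norm (q z))) r"
      unfolding proximity_def
    proof (intro circle_mean_mono)
      fix z :: complex assume z: "norm z = r"
      hence zS: "z \<notin> S" using good by (auto simp: good_radius_def)
      have q: "q z \<noteq> 0" using pq(3)[OF zS] .
      have "norm (f z) \<le> Mp * Mq / norm (q z)"
        using pq(4)[OF zS] Mp(2)[of z] z r Mq(1) Mp(1) mult_mono[of "norm (p z)" Mp 1 Mq]
        by (auto simp: norm_divide intro!: divide_right_mono)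
      moreover have "1 \<le> Mp * Mq / norm (q z)"
        using q Mq(2)[of z] z r Mp(1) mult_mono[of 1 Mp "norm (q z)" Mq] by (auto simp: field_simps)
      ultimately have "max 1 (norm (f z)) \<le> Mp * Mq / norm (q z)" by simp
      hence "ln (max 1 (norm (f z))) \<le> ln (Mp * Mq / norm (q z))"
        using Mp(1) Mq(1) q by (subst ln_le_cancel_iff) auto
      also have "\<dots> = ln Mp + ln Mq - ln (norm (q z))"
        using Mp(1) Mq(1) q by (simp add: ln_div ln_mult)
      finally show "ln (max 1 (norm (f z))) \<le> (ln Mp + ln Mq) - ln (norm (q z))" .
    qed (use r0 in \<open>auto intro!: continuous_on_diff continuous_on_const cont div divq\<close>)
    also have "\<dots> = ln Mp + ln Mq - circle_mean (\<lambda>z. ln (norm (q z))) r"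
      using r0 by (subst circle_mean_diff) (auto intro!: continuous_on_const cont divq)
    finally have "proximity f r \<le> ln Mp + ln Mq - circle_mean (\<lambda>z. ln (norm (q z))) r" .
    moreover have "circle_mean (\<lambda>z. ln (norm (q z))) r \<ge> ln (norm (q 0))"
    proof -
      have "zorder q a \<ge> 0" for a
        using an divisor_in_eventually_nz[OF divq, of a] by (intro zorder_ge_0) (auto simp: eventually_frequently)
      thus ?thesis using Jensen_formula[OF divq good] wsum_nonneg[of S "\<lambda>a. of_int (zorder q a)" r] by simp
    qed
    ultimately have "proximity f r \<le> ln Mp + ln Mq - ln (norm (q 0))" by simp
    moreover have "wsum S r (pole_ord f) \<le> wsum S X (pole_ord f)"
      using D r by (intro wsum_mono_radius) (auto simp: pole_ord_def)
    ultimately show "characteristic S f r \<le> ln Mp + ln Mq - ln (norm (q 0)) + wsum S X (pole_ord f)"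
      by (simp add: characteristic_def)
  qed
qed

text \<open>The intervals of radius \<eta> / (4 (n + 1)) about the n points of \<open>X\<close> have
  total length below \<eta>/2, and the countable set \<open>Y\<close> is null, so together they
  cannot cover an interval of length \<eta>.\<close>

lemma exists_separated_point:
  fixes X Y :: "real set"
  assumes X: "finite X" and Y: "countable Y" and \<eta>: "\<eta> > 0"
  obtains r where "x \<le> r" "r \<le> x + \<eta>" "r \<notin> Y" "\<And>a. a \<in> X \<Longrightarrow> \<bar>r - a\<bar> \<ge> \<eta> / (4 * (real (card X) + 1))"
proof -
  define \<delta> where "\<delta> = \<eta> / (4 * (real (card X) + 1))"
  have \<delta>: "\<delta> > 0" using \<eta> by (auto simp: \<delta>_def intro!: divide_pos_pos add_nonneg_pos mult_pos_pos)
  have "\<exists>r\<in>{x..x+\<eta>}. r \<notin> Y \<and> (\<forall>a\<in>X. \<bar>r - a\<bar> \<ge> \<delta>)"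
  proof (rule ccontr)
    assume *: "\<not>?thesis"
    have "{x..x+\<eta>} \<subseteq> Y \<union> (\<Union>a\<in>X. {a - \<delta>..a + \<delta>})"
    proof
      fix r assume "r \<in> {x..x+\<eta>}"
      with * have "r \<in> Y \<or> (\<exists>a\<in>X. \<bar>r - a\<bar> < \<delta>)" by force
      thus "r \<in> Y \<union> (\<Union>a\<in>X. {a - \<delta>..a + \<delta>})"
      proof (elim disjE bexE)
        fix a assume "a \<in> X" "\<bar>r - a\<bar> < \<delta>"
        hence "r \<in> {a - \<delta>..a + \<delta>}" by auto
        with \<open>a \<in> X\<close> show ?thesis by blast
      qed auto
    qed
    moreover have Y': "Y \<in> sets lborel" by (rule sets.countable[OF _ Y]) auto
    moreover have X': "(\<Union>a\<in>X. {a - \<delta>..a + \<delta>}) \<in> sets lborel" by (rule sets.finite_UN[OF X]) auto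
    ultimately have "emeasure lborel {x..x+\<eta>} \<le> emeasure lborel (Y \<union> (\<Union>a\<in>X. {a - \<delta>..a + \<delta>}))"
      using emeasure_mono[OF _ sets.Un[OF Y' X']] by blast
    also have "\<dots> \<le> emeasure lborel Y + emeasure lborel (\<Union>a\<in>X. {a - \<delta>..a + \<delta>})"
      by (rule emeasure_subadditive[OF Y' X'])
    also have "emeasure lborel Y = 0" using Y by (rule emeasure_lborel_countable)
    also have "emeasure lborel (\<Union>a\<in>X. {a - \<delta>..a + \<delta>}) \<le> (\<Sum>a\<in>X. emeasure lborel {a - \<delta>..a + \<delta>})"
      using X by (intro emeasure_subadditive_finite) auto
    also have "\<dots> = (\<Sum>a\<in>X. ennreal (2 * \<delta>))" using \<delta> by simp
    also have "\<dots> = ennreal (real (card X) * (2 * \<delta>))"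
      using \<delta> by (simp add: ennreal_mult ennreal_of_nat_eq_real_of_nat)
    finally have "ennreal \<eta> \<le> ennreal (real (card X) * (2 * \<delta>))" using \<eta> by simp
    hence "\<eta> \<le> real (card X) * (2 * \<delta>)" using \<delta> by (subst (asm) ennreal_le_iff) auto
    also have "\<dots> = \<eta> * (real (card X) / (2 * (real (card X) + 1)))" by (simp add: \<delta>_def field_simps)
    also have "\<dots> < \<eta> * 1" using \<eta> by (intro mult_strict_left_mono) auto
    finally show False by simp
  qed
  thus ?thesis using that by (auto simp: \<delta>_def)
qed

lemma characteristic_subset:
  assumes "divisor_in f S'" "S' \<subseteq> S" "S sparse_in UNIV"
  shows   "characteristic S' f r = characteristic S f r"
  unfolding characteristic_def using assms divisor_in_zorder_0[OF assms(1)]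
  by (subst wsum_subset[of S' S]) (auto simp: pole_ord_def)

text \<open>The radius \<open>R\<close> is good for the large set \<open>S\<close>, but the circle
  through \<open>z\<close> is separated only from the divisor \<open>S'\<close> of \<open>f\<close>
  itself. Points of the ball of radius \<delta>/2 keep half of the separation, both from
  \<open>S'\<close> and from \<open>R\<close>; the two terms of \<open>log_deriv_bound\<close> then
  give 8 + 8 = 16.\<close>

lemma log_deriv_bound_near_circle:
  assumes div: "divisor_in f S'" and S: "S' \<subseteq> S" "S sparse_in UNIV" and good: "good_radius S R"
    and \<delta>: "\<delta> > 0" "norm z + \<delta> \<le> R" "\<And>a. a \<in> S' \<Longrightarrow> \<delta> \<le> \<bar>norm z - norm a\<bar>"
    and w: "w \<in> ball z (\<delta> / 2)"
  shows "w \<notin> S'" and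
    "norm (deriv f w / f w) \<le> 16 * R / \<delta>\<^sup>2 * (2 * characteristic S f R + \<bar>ln (norm (f 0))\<bar>)"
proof -
  have good': "good_radius S' R" using good S(1) by (rule good_radius_subset)
  have "\<bar>norm z - norm w\<bar> \<le> norm (z - w)" by (rule norm_triangle_ineq3)
  hence zw: "\<bar>norm z - norm w\<bar> < \<delta> / 2" using w by (auto simp: dist_norm)
  have sep: "\<delta> / 2 \<le> \<bar>norm w - norm a\<bar>" if "a \<in> S'" for a using \<delta>(3)[OF that] zw by linarith
  show "w \<notin> S'" using sep[of w] \<delta>(1) by auto
  have Rw: "R - norm w \<ge> \<delta> / 2" using zw \<delta>(2) by linarith
  have R: "R > 0" using good by (simp add: good_radius_def)
  have "norm (deriv f w / f w) \<le> (2 * R / (R - norm w)\<^sup>2 + 2 * R / (\<delta> / 2 * (R - norm w))) *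
           (2 * characteristic S' f R + \<bar>ln (norm (f 0))\<bar>)"
    using sep \<delta>(1) Rw by (intro log_deriv_bound[OF div good']) auto
  also have "\<dots> \<le> (2 * R / (\<delta> / 2)\<^sup>2 + 2 * R / (\<delta> / 2 * (\<delta> / 2))) *
           (2 * characteristic S' f R + \<bar>ln (norm (f 0))\<bar>)"
    using Rw \<delta>(1) R characteristic_ge(3)[of S' f R]
    by (intro mult_right_mono add_mono divide_left_mono power_mono mult_left_mono) auto
  also have "2 * R / (\<delta> / 2)\<^sup>2 + 2 * R / (\<delta> / 2 * (\<delta> / 2)) = 16 * R / \<delta>\<^sup>2"
    using \<delta>(1) by (simp add: power2_eq_square field_simps)
  finally show "norm (deriv f w / f w) \<le> 16 * R / \<delta>\<^sup>2 * (2 * characteristic S f R + \<bar>ln (norm (f 0))\<bar>)"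
    by (simp add: characteristic_subset[OF div S])
qed

section \<open>Growth of the characteristic\<close>

locale milloux_gap = milloux +
  assumes gap: "\<theta> < 1"
begin

definition W :: "real \<Rightarrow> real" where
  "W r = characteristic S g r + characteristic S F r"

definition C0 :: real where
  "C0 = 1 + \<bar>ln (norm (g 0))\<bar> + \<bar>ln (norm (F 0))\<bar>"

text \<open>The set \<open>S\<close> also contains zeros of derivatives of \<open>g\<close>, which
  \<open>W\<close> does not count. Circles are therefore separated only from the zeros and poles of
  \<open>g\<close> and \<open>F\<close>; the poles of \<open>F\<close> are among those of
  \<open>g\<close>.\<close>

definition Sg where "Sg = {z\<in>S. is_pole g z \<or> g z = 0}"
definition SF where "SF = {z\<in>S. is_pole g z \<or> F z = 0}"

lemma C0_ge_1: "C0 \<ge> 1" by (simp add: C0_def)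

lemma W_nonneg: "W r \<ge> 0"
  using characteristic_ge(3) by (simp add: W_def add_nonneg_nonneg)

lemma subsets: "Sg \<subseteq> S" "SF \<subseteq> S" "Sg \<union> SF \<subseteq> S"
  by (auto simp: Sg_def SF_def)

lemma sparse_subset: "A \<subseteq> S \<Longrightarrow> A sparse_in UNIV"
  using S(1) by (rule sparse_in_subset2)

lemma divisor_in_Sg: "divisor_in g Sg"
  unfolding divisor_in_def
  using sparse_subset[OF subsets(1)] divisor_inD[OF divisor_in_g] analytic_g S(2) off_S(1)
  by (auto simp: Sg_def)

lemma divisor_in_SF: "divisor_in F SF"
  unfolding divisor_in_def
  using sparse_subset[OF subsets(2)] divisor_inD[OF divisor_in_F] analytic_F S(2) off_S(1)
  by (auto simp: SF_def)

lemma zorder_pos_of_zero: "divisor_in f S \<Longrightarrow> f analytic_on {a} \<Longrightarrow> f a = 0 \<Longrightarrow> zorder f a > 0"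
  using divisor_in_eventually_nz[of f S a] by (subst zorder_pos_iff') (auto simp: eventually_frequently)

lemma order_sum_ge_1:
  assumes "a \<in> Sg \<union> SF"
  shows   "\<bar>of_int (zorder g a)\<bar> + \<bar>of_int (zorder F a)\<bar> \<ge> (1 :: real)"
proof (cases "is_pole g a")
  case True
  hence "\<bar>zorder g a\<bar> \<ge> 1" using poles[of a] by auto
  hence "real_of_int \<bar>zorder g a\<bar> \<ge> 1" by (subst of_int_1_le_iff)
  thus ?thesis unfolding of_int_abs by linarith
next
  case False
  hence "\<bar>zorder g a\<bar> \<ge> 1 \<or> \<bar>zorder F a\<bar> \<ge> 1"
    using assms zorder_pos_of_zero[OF divisor_in_g analytic_g[OF False]]
          zorder_pos_of_zero[OF divisor_in_F analytic_F[OF False]]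
    by (auto simp: Sg_def SF_def)
  hence "real_of_int \<bar>zorder g a\<bar> \<ge> 1 \<or> real_of_int \<bar>zorder F a\<bar> \<ge> 1"
    unfolding of_int_1_le_iff .
  thus ?thesis unfolding of_int_abs by linarith
qed

lemma wsum_orders_le:
  assumes "good_radius S R"
  shows   "wsum S R (\<lambda>a. \<bar>of_int (zorder g a)\<bar> + \<bar>of_int (zorder F a)\<bar>) \<le> 2 * W R + C0"
  using wsum_abs_zorder_le[OF divisor_in_g assms] wsum_abs_zorder_le[OF divisor_in_F assms]
  by (simp add: wsum_add W_def C0_def)

text \<open>Each point of \<open>A\<close> has nonzero order for \<open>g\<close> or
  \<open>F\<close> and weight at least ln (R/x), so the number of points is paid for by the counting
  functions at the larger radius.\<close>

lemma card_le:
  assumes good: "good_radius S R" and A: "A \<subseteq> Sg \<union> SF" "A \<subseteq> ball 0 x" and x: "0 < x" "x \<le> R"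
  shows   "real (card A) * ln (R / x) \<le> 2 * W R + C0"
proof -
  have fin: "finite (S \<inter> ball 0 R)" using S(1) by (rule sparse_in_UNIV_finite_cball)
  have "real (card A) * ln (R / x) = (\<Sum>a\<in>A. 1 * ln (R / x))" by simp
  also have "\<dots> \<le> (\<Sum>a\<in>A. (\<bar>of_int (zorder g a)\<bar> + \<bar>of_int (zorder F a)\<bar>) * ln (R / norm a))"
  proof (intro sum_mono mult_mono)
    fix a assume a: "a \<in> A"
    have "a \<noteq> 0" using a A subsets S(2) by auto
    moreover have "norm a < x" using a A by auto
    ultimately show "ln (R / x) \<le> ln (R / norm a)" using x
      by (subst ln_le_cancel_iff) (auto intro!: divide_left_mono)
    show "\<bar>of_int (zorder g a)\<bar> + \<bar>of_int (zorder F a)\<bar> \<ge> (1::real)"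
      using order_sum_ge_1 a A by blast
  qed (use x in auto)
  also have "\<dots> \<le> wsum S R (\<lambda>a. \<bar>of_int (zorder g a)\<bar> + \<bar>of_int (zorder F a)\<bar>)"
    unfolding wsum_def
  proof (rule sum_mono2[OF fin])
    have "ball 0 x \<subseteq> ball (0 :: complex) R" using x by (simp add: subset_ball)
    thus "A \<subseteq> S \<inter> ball 0 R" using A subsets by blast
  next
    fix a assume "a \<in> S \<inter> ball 0 R - A"
    thus "0 \<le> (\<bar>of_int (zorder g a)\<bar> + \<bar>of_int (zorder F a)\<bar>) * ln (R / norm a)"
      using wsum_ln_nonneg[of a S R] by (intro mult_nonneg_nonneg) simp_all
  qed
  also have "\<dots> \<le> 2 * W R + C0" by (rule wsum_orders_le[OF good])
  finally show ?thesis .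
qed

text \<open>With \<theta> < 1 the term \<theta> T(r, g) is absorbed on the left, and T(r, F) is
  bounded in terms of T(r, g).\<close>

lemma W_le_ln:
  obtains C where "C > 0" "\<And>r B. \<lbrakk>good_radius S r; B \<ge> 1;
      \<And>z. norm z = r \<Longrightarrow> norm ((deriv ^^ k) g z) \<le> B * norm (g z);
      \<And>z. norm z = r \<Longrightarrow> norm (F1 z) \<le> B * norm (g z);
      \<And>z. norm z = r \<Longrightarrow> norm (F1 z) \<le> B * norm (F z)\<rbrakk> \<Longrightarrow> W r \<le> C * (1 + ln B)"
proof -
  obtain C where C: "\<And>r B. \<lbrakk>good_radius S r; B \<ge> 1;
      \<And>z. norm z = r \<Longrightarrow> norm ((deriv ^^ k) g z) \<le> B * norm (g z);
      \<And>z. norm z = r \<Longrightarrow> norm (F1 z) \<le> B * norm (g z);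
      \<And>z. norm z = r \<Longrightarrow> norm (F1 z) \<le> B * norm (F z)\<rbrakk> \<Longrightarrow>
      characteristic S g r \<le> \<theta> * characteristic S g r + C + 3 * ln B"
    using milloux_inequality by blast
  define C1 where "C1 = (\<bar>C\<bar> + 3) / (1 - \<theta>)"
  define C2 where "C2 = (2 + real k / 2) * C1 + 1 + ln (1 + norm c)"
  have C1: "C1 > 0" using gap by (auto simp: C1_def intro!: divide_pos_pos)
  have C2: "C2 > 0" using C1 by (auto simp: C2_def intro!: add_nonneg_pos add_pos_nonneg)
  show ?thesis
  proof (rule that[OF C2])
    fix r B
    assume good: "good_radius S r" and B: "B \<ge> 1"
     and le: "\<And>z. norm z = r \<Longrightarrow> norm ((deriv ^^ k) g z) \<le> B * norm (g z)"
      "\<And>z. norm z = r \<Longrightarrow> norm (F1 z) \<le> B * norm (g z)"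
      "\<And>z. norm z = r \<Longrightarrow> norm (F1 z) \<le> B * norm (F z)"
    have lnB: "ln B \<ge> 0" using B by simp
    have "characteristic S g r \<le> \<theta> * characteristic S g r + C + 3 * ln B" using C[OF good B le] .
    hence "(1 - \<theta>) * characteristic S g r \<le> C + 3 * ln B" by (simp add: algebra_simps)
    also have "\<dots> \<le> (\<bar>C\<bar> + 3) * (1 + ln B)"
      using lnB mult_nonneg_nonneg[of "\<bar>C\<bar>" "ln B"] abs_ge_self[of C]
      unfolding distrib_left distrib_right by linarith
    finally have Tg: "characteristic S g r \<le> C1 * (1 + ln B)"
      using gap by (simp add: C1_def field_simps)
    have "W r \<le> (2 + real k / 2) * characteristic S g r + ln B + ln (1 + norm c)"
      using characteristic_F_le[OF good B le(1)] by (simp add: W_def algebra_simps)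
    also have "\<dots> \<le> (2 + real k / 2) * (C1 * (1 + ln B)) + ln B + ln (1 + norm c)"
      using Tg by (intro add_mono mult_left_mono) auto
    also have "\<dots> \<le> C2 * (1 + ln B)"
    proof -
      have "C2 * (1 + ln B) = (2 + real k / 2) * (C1 * (1 + ln B)) + ln B + ln (1 + norm c) +
              1 + ln (1 + norm c) * ln B"
        unfolding C2_def by algebra
      moreover have "0 \<le> ln (1 + norm c) * ln B" using lnB by simp
      ultimately show ?thesis by linarith
    qed
    finally show "W r \<le> C2 * (1 + ln B)" .
  qed
qed

lemma log_derivs_le:
  assumes good: "good_radius S R" and \<delta>: "\<delta> > 0" "r + \<delta> \<le> R"
    and sep: "\<And>a. a \<in> Sg \<union> SF \<Longrightarrow> \<delta> \<le> \<bar>r - norm a\<bar>" and z: "norm z = r" and w: "w \<in> ball z (\<delta> / 2)"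
  shows "norm (deriv g w / g w) \<le> 16 * R / \<delta>\<^sup>2 * (2 * W R + C0)"
    and "norm (deriv F w / F w) \<le> 16 * R / \<delta>\<^sup>2 * (2 * W R + C0)"
    and "w \<notin> Sg" "w \<notin> SF"
proof -
  have R: "R > 0" using good by (simp add: good_radius_def)
  have "norm (deriv g w / g w) \<le> 16 * R / \<delta>\<^sup>2 * (2 * characteristic S g R + \<bar>ln (norm (g 0))\<bar>)"
    using log_deriv_bound_near_circle(2)[OF divisor_in_Sg subsets(1) S(1) good \<delta>(1) _ _ w] sep z \<delta>(2) by auto
  also have "\<dots> \<le> 16 * R / \<delta>\<^sup>2 * (2 * W R + C0)"
    using R characteristic_ge(3)[of S F R] by (intro mult_left_mono) (auto simp: W_def C0_def)
  finally show "norm (deriv g w / g w) \<le> 16 * R / \<delta>\<^sup>2 * (2 * W R + C0)" .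
  have "norm (deriv F w / F w) \<le> 16 * R / \<delta>\<^sup>2 * (2 * characteristic S F R + \<bar>ln (norm (F 0))\<bar>)"
    using log_deriv_bound_near_circle(2)[OF divisor_in_SF subsets(2) S(1) good \<delta>(1) _ _ w] sep z \<delta>(2) by auto
  also have "\<dots> \<le> 16 * R / \<delta>\<^sup>2 * (2 * W R + C0)"
    using R characteristic_ge(3)[of S g R] by (intro mult_left_mono) (auto simp: W_def C0_def)
  finally show "norm (deriv F w / F w) \<le> 16 * R / \<delta>\<^sup>2 * (2 * W R + C0)" .
  show "w \<notin> Sg" "w \<notin> SF"
    using log_deriv_bound_near_circle(1)[OF divisor_in_Sg subsets(1) S(1) good \<delta>(1) _ _ w]
          log_deriv_bound_near_circle(1)[OF divisor_in_SF subsets(2) S(1) good \<delta>(1) _ _ w] sep z \<delta>(2) by auto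
qed

lemma higher_derivs_le:
  assumes \<Lambda>: "\<Lambda> > 0" and r: "good_radius S r" "norm z = r"
    and notin: "\<And>w. w \<in> ball z (1 / \<Lambda>) \<Longrightarrow> w \<notin> Sg"
    and le: "\<And>w. w \<in> ball z (1 / \<Lambda>) \<Longrightarrow> norm (deriv g w / g w) \<le> \<Lambda>"
    and leF: "norm (deriv F z / F z) \<le> \<Lambda>"
  shows "norm ((deriv ^^ j) g z) \<le> fact j * exp 1 * (2 * \<Lambda>) ^ j * norm (g z)"
    and "norm (F1 z) \<le> \<Lambda> * norm (F z)"
proof -
  have "norm ((deriv ^^ j) g z) \<le> fact j * exp 1 / ((1 / \<Lambda>) / 2) ^ j * norm (g z)"
  proof (rule higher_deriv_bound_of_log_deriv)
    show "g holomorphic_on ball z (1 / \<Lambda>)"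
      using notin divisor_inD(4)[OF divisor_in_Sg]
      by (intro analytic_imp_holomorphic) (metis analytic_on_analytic_at)
  qed (use \<Lambda> notin le divisor_inD(5)[OF divisor_in_Sg] in auto)
  thus "norm ((deriv ^^ j) g z) \<le> fact j * exp 1 * (2 * \<Lambda>) ^ j * norm (g z)"
    by (simp add: power_divide power_mult_distrib mult_ac)
  have zS: "z \<notin> S" using r by (auto simp: good_radius_def)
  have "F1 z = deriv F z" using deriv_F off_S(1)[OF zS] by simp
  thus "norm (F1 z) \<le> \<Lambda> * norm (F z)"
    using leF off_S(3)[OF zS] by (simp add: norm_divide field_simps)
qed

text \<open>A derivative of order j costs a factor of size (2 \<Lambda>)^j relative to |g|, so the
  bound \<open>B\<close> is polynomial in \<Lambda> and its logarithm is linear in ln \<Lambda>. The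
  radius 1/\<Lambda> is the one for which |g| stays within a factor e of its value at the
  centre.\<close>

lemma W_le_of_log_derivs:
  obtains C where "C > 0" "\<And>r \<Lambda>. \<lbrakk>good_radius S r; \<Lambda> \<ge> 1;
      \<And>z w. norm z = r \<Longrightarrow> w \<in> ball z (1 / \<Lambda>) \<Longrightarrow> w \<notin> Sg;
      \<And>z w. norm z = r \<Longrightarrow> w \<in> ball z (1 / \<Lambda>) \<Longrightarrow> norm (deriv g w / g w) \<le> \<Lambda>;
      \<And>z. norm z = r \<Longrightarrow> norm (deriv F z / F z) \<le> \<Lambda>\<rbrakk> \<Longrightarrow> W r \<le> C * (1 + ln \<Lambda>)"
proof -
  obtain C where C: "C > 0" "\<And>r B. \<lbrakk>good_radius S r; B \<ge> 1;
      \<And>z. norm z = r \<Longrightarrow> norm ((deriv ^^ k) g z) \<le> B * norm (g z);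
      \<And>z. norm z = r \<Longrightarrow> norm (F1 z) \<le> B * norm (g z);
      \<And>z. norm z = r \<Longrightarrow> norm (F1 z) \<le> B * norm (F z)\<rbrakk> \<Longrightarrow> W r \<le> C * (1 + ln B)"
    using W_le_ln by blast
  define l :: real where "l = ln (fact (Suc k) * exp 1 * 2 ^ Suc k)"
  define K where "K = 1 + \<bar>l\<bar> + real (Suc k)"
  show ?thesis
  proof (rule that[of "C * K"])
    show "C * K > 0" using C(1) by (auto simp: K_def intro!: mult_pos_pos add_pos_nonneg)
    fix r \<Lambda>
    assume good: "good_radius S r" and \<Lambda>: "\<Lambda> \<ge> 1"
      and notin: "\<And>z w. norm z = r \<Longrightarrow> w \<in> ball z (1 / \<Lambda>) \<Longrightarrow> w \<notin> Sg"
      and le: "\<And>z w. norm z = r \<Longrightarrow> w \<in> ball z (1 / \<Lambda>) \<Longrightarrow> norm (deriv g w / g w) \<le> \<Lambda>"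
      and leF: "\<And>z. norm z = r \<Longrightarrow> norm (deriv F z / F z) \<le> \<Lambda>"
    define B where "B = fact (Suc k) * exp 1 * (2 * \<Lambda>) ^ Suc k"
    have B_ge: "fact j * exp 1 * (2 * \<Lambda>) ^ j \<le> B" if "j \<le> Suc k" for j
      unfolding B_def using that \<Lambda> by (intro mult_mono power_increasing fact_mono) auto
    have "\<Lambda> * 1 \<le> B"
      using \<Lambda> fact_ge_1[of "Suc k", where 'a = real] mult_mono[of 1 "fact (Suc k) :: real" 1 "exp 1 :: real"]
        power_increasing[of 1 "Suc k" "2 * \<Lambda>"]
      unfolding B_def mult.commute[of \<Lambda>] by (intro mult_mono) auto
    hence BL: "\<Lambda> \<le> B" "1 \<le> B" using \<Lambda> by auto
    have "W r \<le> C * (1 + ln B)"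
    proof (rule C(2)[OF good BL(2)])
      fix z :: complex assume z: "norm z = r"
      have \<Lambda>0: "\<Lambda> > 0" using \<Lambda> by simp
      note * = higher_derivs_le[OF \<Lambda>0 good z notin[OF z] le[OF z] leF[OF z]]
      have "norm ((deriv ^^ j) g z) \<le> B * norm (g z)" if "j \<le> Suc k" for j
        using *(1)[of j] B_ge[OF that] mult_right_mono[OF B_ge[OF that], of "norm (g z)"] by simp
      from this[of k] this[of "Suc k"]
      show "norm ((deriv ^^ k) g z) \<le> B * norm (g z)" "norm (F1 z) \<le> B * norm (g z)"
        by (simp_all add: F1_def)
      show "norm (F1 z) \<le> B * norm (F z)"
        using *(2) mult_right_mono[OF BL(1), of "norm (F z)"] by simp
    qed
    also have "ln B = l + real (Suc k) * ln \<Lambda>"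
      using \<Lambda> unfolding B_def l_def power_mult_distrib mult.assoc[symmetric]
      by (subst ln_mult_pos) (auto simp: ln_realpow simp del: power_Suc of_nat_Suc)
    also have "C * (1 + (l + real (Suc k) * ln \<Lambda>)) \<le> C * (K * (1 + ln \<Lambda>))"
    proof (rule mult_left_mono)
      have "ln \<Lambda> \<ge> 0" using \<Lambda> by simp
      hence "0 \<le> \<bar>l\<bar> * ln \<Lambda>" by simp
      moreover have "K * (1 + ln \<Lambda>) = 1 + \<bar>l\<bar> + real (Suc k) + ln \<Lambda> + \<bar>l\<bar> * ln \<Lambda> + real (Suc k) * ln \<Lambda>"
        unfolding K_def by algebra
      ultimately show "1 + (l + real (Suc k) * ln \<Lambda>) \<le> K * (1 + ln \<Lambda>)"
        using \<open>ln \<Lambda> \<ge> 0\<close> abs_ge_self[of l] by linarith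
    qed (use C in auto)
    finally show "W r \<le> C * K * (1 + ln \<Lambda>)" by (simp add: mult.assoc)
  qed
qed

end

section \<open>The self-improving estimate and logarithmic growth of the characteristic\<close>

context milloux_gap begin

lemma countable_norm_S: "countable (norm ` S)"
  using sparse_imp_countable[OF open_UNIV S(1)] by simp

text \<open>A radius in the window can be kept at distance about \<eta>/n from the n relevant zeros
  and poles, and \<open>card_le\<close> bounds n by \<open>W R\<close>. So the logarithmic
  derivatives are at most polynomial in x (1 + W R) / \<eta>, and \<open>W_le_of_log_derivs\<close>
  takes the logarithm. The radius \<open>r\<close> is chosen before \<open>R\<close>, so in the
  iteration \<open>R\<close> may be the next chosen radius.\<close>

lemma self_improving:
  obtains C where "C > 0" "\<And>x \<eta>. \<lbrakk>x \<ge> 1; 0 < \<eta>; \<eta> \<le> 1\<rbrakk> \<Longrightarrow>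
    \<exists>r. x \<le> r \<and> r \<le> x + \<eta> / 4 \<and> good_radius S r \<and>
      (\<forall>R. good_radius S R \<longrightarrow> x + \<eta> \<le> R \<longrightarrow> R \<le> x + 2 \<longrightarrow> W r \<le> C * (1 + ln (x * (1 + W R) / \<eta>)))"
proof -
  obtain C1 where C1: "C1 > 0" "\<And>r \<Lambda>. \<lbrakk>good_radius S r; \<Lambda> \<ge> 1;
      \<And>z w. norm z = r \<Longrightarrow> w \<in> ball z (1 / \<Lambda>) \<Longrightarrow> w \<notin> Sg;
      \<And>z w. norm z = r \<Longrightarrow> w \<in> ball z (1 / \<Lambda>) \<Longrightarrow> norm (deriv g w / g w) \<le> \<Lambda>;
      \<And>z. norm z = r \<Longrightarrow> norm (deriv F z / F z) \<le> \<Lambda>\<rbrakk> \<Longrightarrow> W r \<le> C1 * (1 + ln \<Lambda>)"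
    using W_le_of_log_derivs by blast
  \<comment> \<open>Chosen so that 1/\<delta> \<le> E V^2 and \<Lambda> \<le> D V^5 below, with V =
    x (1 + w) / \<eta>.\<close>
  define E where "E = 96 * (C0 + 2)"
  define D where "D = 48 * (C0 + 2) * E\<^sup>2"
  have ED: "E > 0" "D > 0" using C0_ge_1 by (auto simp: E_def D_def)
  define C where "C = C1 * (6 + \<bar>ln D\<bar>)"
  show ?thesis
  proof (rule that[of C])
    show "C > 0" using C1 by (simp add: C_def)
    fix x \<eta> :: real assume x: "x \<ge> 1" and \<eta>: "0 < \<eta>" "\<eta> \<le> 1"
    \<comment> \<open>Points of modulus at least \<open>y\<close> are automatically \<eta>/4 away
      from \<open>r\<close>, so only finitely many remain to be avoided. The other half of the gap,
      from \<open>y\<close> to x + \<eta>, is what \<open>card_le\<close> uses.\<close>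
    define y where "y = x + \<eta> / 2"
    define P where "P = (Sg \<union> SF) \<inter> ball 0 y"
    have finP: "finite P"
      by (rule finite_subset[OF _ sparse_in_UNIV_finite_cball(2)[OF S(1), of y]]) (use subsets in \<open>auto simp: P_def\<close>)
    have \<eta>4: "\<eta> / 4 > 0" using \<eta> by simp
    have finX: "finite (norm ` P)" using finP by simp
    obtain r where r: "x \<le> r" "r \<le> x + \<eta> / 4" "r \<notin> norm ` S"
      "\<And>a. a \<in> norm ` P \<Longrightarrow> \<bar>r - a\<bar> \<ge> \<eta> / 4 / (4 * (real (card (norm ` P)) + 1))"
      using exists_separated_point[OF finX countable_norm_S \<eta>4, of x] by blast
    \<comment> \<open>A lower bound for the separation given by
      \<open>exists_separated_point\<close> in a window of length \<eta>/4, hence 16. There may be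
      fewer distinct moduli than points in \<open>P\<close>, which only enlarges the
      separation.\<close>
    define \<delta> where "\<delta> = \<eta> / (16 * (real (card P) + 1))"
    have \<delta>: "\<delta> > 0" "\<delta> \<le> \<eta> / 16"
      using \<eta> by (auto simp: \<delta>_def field_simps intro!: divide_pos_pos)
    have sep: "\<delta> \<le> \<bar>r - norm a\<bar>" if a: "a \<in> Sg \<union> SF" for a
    proof (cases "norm a < y")
      case True
      hence "\<eta> / 4 / (4 * (real (card (norm ` P)) + 1)) \<le> \<bar>r - norm a\<bar>"
        using a by (intro r(4)) (auto simp: P_def)
      moreover have "\<delta> \<le> \<eta> / 4 / (4 * (real (card (norm ` P)) + 1))"
        unfolding \<delta>_def using \<eta> card_image_le[OF finP, of norm]
        by (auto simp: field_simps intro!: mult_left_mono divide_left_mono)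
      ultimately show ?thesis by linarith
    next
      case False
      thus ?thesis using r(2) \<delta> by (simp add: y_def)
    qed
    have good: "good_radius S r" using r x by (auto simp: good_radius_def)
    show "\<exists>r. x \<le> r \<and> r \<le> x + \<eta> / 4 \<and> good_radius S r \<and>
      (\<forall>R. good_radius S R \<longrightarrow> x + \<eta> \<le> R \<longrightarrow> R \<le> x + 2 \<longrightarrow> W r \<le> C * (1 + ln (x * (1 + W R) / \<eta>)))"
    proof (intro exI[of _ r] conjI allI impI r good)
      fix R assume goodR: "good_radius S R" and R: "x + \<eta> \<le> R" "R \<le> x + 2"
      define w where "w = W R"
      have w: "w \<ge> 0" using W_nonneg by (simp add: w_def)
      define V where "V = x * (1 + w) / \<eta>"
      have R1: "R \<ge> 1" "R \<le> 3 * x" using R x \<eta> by auto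
      have xw: "1 \<le> x * (1 + w)" using x w mult_mono[of 1 x 1 "1 + w"] by simp
      have V: "1 / \<eta> \<le> V" "x * (1 + w) \<le> V" "1 \<le> V"
      proof -
        show "1 / \<eta> \<le> V" unfolding V_def using xw \<eta> by (intro divide_right_mono) auto
        have "x * (1 + w) * \<eta> \<le> x * (1 + w) * 1" using xw \<eta> by (intro mult_left_mono) auto
        thus "x * (1 + w) \<le> V" using \<eta> by (simp add: V_def field_simps)
        with xw show "1 \<le> V" by linarith
      qed
      have CW: "2 * w + C0 + 1 \<le> (C0 + 2) * (1 + w)"
        using w C0_ge_1 mult_nonneg_nonneg[of C0 w] by (simp add: algebra_simps)
      have card: "real (card P) + 1 \<le> (2 * w + C0 + 1) * (6 * x / \<eta>)"
      proof -
        have "1 - y / R \<le> ln (R / y)"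
        proof -
          have "y > 0" using x \<eta> by (simp add: y_def)
          thus ?thesis using R1 ln_le_minus_one[of "y / R"] by (simp add: ln_div)
        qed
        moreover have "\<eta> / (6 * x) \<le> 1 - y / R"
        proof -
          have "\<eta> / (6 * x) \<le> \<eta> / (2 * R)" using R1 \<eta> by (intro divide_left_mono) auto
          also have "\<dots> \<le> (R - y) / R" using R R1 by (simp add: y_def field_simps)
          also have "\<dots> = 1 - y / R" using R1 by (simp add: field_simps)
          finally show ?thesis .
        qed
        ultimately have "real (card P) * (\<eta> / (6 * x)) \<le> real (card P) * ln (R / y)"
          by (intro mult_left_mono) auto
        also have "\<dots> \<le> 2 * w + C0"
          unfolding w_def using x \<eta> R by (intro card_le[OF goodR]) (auto simp: P_def y_def)
        finally have "real (card P) \<le> (2 * w + C0) * (6 * x / \<eta>)"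
          using x \<eta> by (simp add: field_simps)
        moreover have "1 \<le> 6 * x / \<eta>" using x \<eta> by (simp add: field_simps)
        ultimately show ?thesis
          unfolding distrib_right[of "2 * w + C0" 1] mult_1 by (rule add_mono)
      qed
      have "1 / \<delta> = 16 * (real (card P) + 1) * (1 / \<eta>)" using \<eta> by (simp add: \<delta>_def)
      also have "\<dots> \<le> 16 * (((C0 + 2) * (1 + w)) * (6 * x / \<eta>)) * V"
      proof (intro mult_mono)
        have "(2 * w + C0 + 1) * (6 * x / \<eta>) \<le> ((C0 + 2) * (1 + w)) * (6 * x / \<eta>)"
          using CW x \<eta> by (intro mult_right_mono) auto
        with card show "real (card P) + 1 \<le> ((C0 + 2) * (1 + w)) * (6 * x / \<eta>)" by linarith
      qed (use V \<eta> x w C0_ge_1 in auto)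
      also have "\<dots> = E * V\<^sup>2" by (simp add: E_def V_def power2_eq_square)
      finally have \<delta>E: "1 / \<delta> \<le> E * V\<^sup>2" .
      define \<Lambda> where "\<Lambda> = 16 * R / \<delta>\<^sup>2 * (2 * w + C0)"
      have \<delta>2: "\<delta>\<^sup>2 > 0" "\<delta>\<^sup>2 \<le> \<delta>"
        using \<delta> \<eta> mult_left_mono[of \<delta> 1 \<delta>] by (auto simp: power2_eq_square)
      have "16 / \<delta>\<^sup>2 \<le> \<Lambda>"
      proof -
        have "16 / \<delta>\<^sup>2 * (1 * 1) \<le> 16 / \<delta>\<^sup>2 * (R * (2 * w + C0))"
          using R1 w C0_ge_1 \<delta>2 by (intro mult_left_mono mult_mono) auto
        thus ?thesis by (simp add: \<Lambda>_def)
      qed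
      moreover have "2 / \<delta> \<le> 16 / \<delta>\<^sup>2" using \<delta>2 \<delta> by (intro frac_le) auto
      ultimately have \<Lambda>\<delta>: "2 / \<delta> \<le> \<Lambda>" by linarith
      moreover have "1 \<le> 2 / \<delta>" using \<delta> \<eta> by simp
      ultimately have \<Lambda>1: "\<Lambda> \<ge> 1" by linarith
      have "1 / \<Lambda> \<le> \<delta> / 2" using \<Lambda>\<delta> \<Lambda>1 \<delta> by (simp add: field_simps)
      hence sub: "ball z (1 / \<Lambda>) \<subseteq> ball z (\<delta> / 2)" for z :: complex by (rule subset_ball)
      have r\<delta>: "r + \<delta> \<le> R" using r \<delta> R \<eta> by simp
      note ld = log_derivs_le[OF goodR \<delta>(1) r\<delta> sep, folded w_def, folded \<Lambda>_def]
      have "W r \<le> C1 * (1 + ln \<Lambda>)"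
      proof (rule C1(2)[OF good \<Lambda>1])
        fix z :: complex assume z: "norm z = r"
        show "norm (deriv F z / F z) \<le> \<Lambda>" using z \<delta> by (intro ld) auto
        fix w assume "w \<in> ball z (1 / \<Lambda>)"
        hence "w \<in> ball z (\<delta> / 2)" using sub by blast
        from ld(3)[OF _ z this] ld(1)[OF _ z this]
        show "w \<notin> Sg" "norm (deriv g w / g w) \<le> \<Lambda>" by auto
      qed
      also have "ln \<Lambda> \<le> ln (D * V ^ 5)"
      proof -
        have "\<Lambda> = 16 * (R * (2 * w + C0)) * (1 / \<delta>)\<^sup>2" by (simp add: \<Lambda>_def power_divide)
        also have "\<dots> \<le> 16 * ((3 * x) * ((C0 + 2) * (1 + w))) * (E * V\<^sup>2)\<^sup>2"
          using R1 CW w C0_ge_1 x \<delta>E \<delta> by (intro mult_mono power_mono) auto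
        also have "\<dots> = 48 * (C0 + 2) * E\<^sup>2 * (x * (1 + w)) * V ^ 4"
          by (simp add: power_mult_distrib power2_eq_square power4_eq_xxxx mult_ac)
        also have "\<dots> \<le> 48 * (C0 + 2) * E\<^sup>2 * V * V ^ 4"
          using V C0_ge_1 by (intro mult_right_mono mult_left_mono) auto
        also have "\<dots> = D * V ^ 5" by (simp add: D_def eval_nat_numeral)
        finally show ?thesis using \<Lambda>1 by (subst ln_le_cancel_iff) auto
      qed
      also have "ln (D * V ^ 5) = ln D + 5 * ln V" using ED V by (subst ln_mult_pos) (auto simp: ln_realpow)
      also have "C1 * (1 + (ln D + 5 * ln V)) \<le> C1 * ((6 + \<bar>ln D\<bar>) * (1 + ln V))"
      proof (rule mult_left_mono)
        have "ln V \<ge> 0" using V by simp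
        moreover from this have "0 \<le> \<bar>ln D\<bar> * ln V" by simp
        moreover have "(6 + \<bar>ln D\<bar>) * (1 + ln V) = 6 + \<bar>ln D\<bar> + 6 * ln V + \<bar>ln D\<bar> * ln V" by algebra
        ultimately show "1 + (ln D + 5 * ln V) \<le> (6 + \<bar>ln D\<bar>) * (1 + ln V)"
          using abs_ge_self[of "ln D"] by linarith
      qed (use C1 in auto)
      finally show "W r \<le> C * (1 + ln (x * (1 + W R) / \<eta>))"
        using C1(1) by (simp add: C_def V_def w_def mult.assoc)
    qed
  qed
qed

lemma W_bounded: obtains M where "\<And>r. good_radius S r \<Longrightarrow> r \<le> X \<Longrightarrow> W r \<le> M"
proof -
  obtain M1 where M1: "\<And>r. good_radius S r \<Longrightarrow> r \<le> X \<Longrightarrow> characteristic S g r \<le> M1"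
    using characteristic_bounded[OF divisor_in_g] by blast
  obtain M2 where M2: "\<And>r. good_radius S r \<Longrightarrow> r \<le> X \<Longrightarrow> characteristic S F r \<le> M2"
    using characteristic_bounded[OF divisor_in_F] by blast
  show ?thesis using M1 M2 by (intro that[of "M1 + M2"]) (auto simp: W_def intro: add_mono)
qed

text \<open>The estimate of \<open>W\<close> by its own logarithm at a slightly larger radius is iterated along
  radii with geometrically decreasing gaps. These stay bounded, and so does \<open>W\<close> along them,
  which makes the remainder vanish in the limit.\<close>
lemma W_log_growth:
  obtains K where "K > 0" "\<And>x. x \<ge> 1 \<Longrightarrow> \<exists>r. x \<le> r \<and> r \<le> x + 1 \<and> good_radius S r \<and> W r \<le> K * (1 + ln x)"
proof -
  obtain C where C: "C > 0" "\<And>x \<eta>. \<lbrakk>x \<ge> 1; 0 < \<eta>; \<eta> \<le> 1\<rbrakk> \<Longrightarrow>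
    \<exists>r. x \<le> r \<and> r \<le> x + \<eta> / 4 \<and> good_radius S r \<and>
      (\<forall>R. good_radius S R \<longrightarrow> x + \<eta> \<le> R \<longrightarrow> R \<le> x + 2 \<longrightarrow> W r \<le> C * (1 + ln (x * (1 + W R) / \<eta>)))"
    using self_improving by blast
  define B where "B = C * ln 2"
  define A0 where "A0 = C * (1 + ln 3) + 1 / 2 + C * \<bar>ln (2 * C)\<bar>"
  define K where "K = 2 * (A0 + B)"
  have pos: "A0 > 0" "B > 0" "C \<le> A0"
    using C(1) mult_nonneg_nonneg[of C "ln 3"] by (auto simp: A0_def B_def algebra_simps intro!: add_pos_nonneg)
  show ?thesis
  proof (rule that[of K])
    show "K > 0" using pos by (simp add: K_def)
    fix X :: real assume X: "X \<ge> 1"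
    define A where "A = A0 + C * ln X"
    \<comment> \<open>The gaps (1/2)^j sum to 2, so all radii stay below X + 3; each halving of the
      gap costs one ln 2 in the estimate.\<close>
    define x where "x = (\<lambda>j::nat. X + 2 - 2 * (1 / 2) ^ j)"
    have p: "0 < (1 / 2 :: real) ^ j" "(1 / 2 :: real) ^ j \<le> 1" for j by (auto intro: power_le_one)
    have x: "1 \<le> x j" "x j \<le> X + 2" "x (Suc j) = x j + (1 / 2) ^ j" "X \<le> x j" for j
      using X p[of j] by (auto simp: x_def)
    have "\<forall>j. \<exists>r. x j \<le> r \<and> r \<le> x j + (1 / 2) ^ j / 4 \<and> good_radius S r \<and>
      (\<forall>R. good_radius S R \<longrightarrow> x j + (1 / 2) ^ j \<le> R \<longrightarrow> R \<le> x j + 2 \<longrightarrow>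
           W r \<le> C * (1 + ln (x j * (1 + W R) / (1 / 2) ^ j)))"
      using C(2)[OF x(1) p] by blast
    then obtain r where r: "\<And>j. x j \<le> r j" "\<And>j. r j \<le> x j + (1 / 2) ^ j / 4" "\<And>j. good_radius S (r j)"
      "\<And>j R. good_radius S R \<Longrightarrow> x j + (1 / 2) ^ j \<le> R \<Longrightarrow> R \<le> x j + 2 \<Longrightarrow>
           W (r j) \<le> C * (1 + ln (x j * (1 + W R) / (1 / 2) ^ j))"
      by metis
    obtain M where M: "\<And>r. good_radius S r \<Longrightarrow> r \<le> X + 3 \<Longrightarrow> W r \<le> M" using W_bounded by blast
    have step: "W (r j) \<le> A + real j * B + 1 / 2 * W (r (Suc j))" for j
    proof -
      define w where "w = W (r (Suc j))"
      have w: "w \<ge> 0" using W_nonneg by (simp add: w_def)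
      have "W (r j) \<le> C * (1 + ln (x j * (1 + w) / (1 / 2) ^ j))"
        unfolding w_def using r(1)[of "Suc j"] r(2)[of "Suc j"] r(3) x(3)[of j] p[of j]
        by (intro r(4)) auto
      also have "ln (x j * (1 + w) / (1 / 2) ^ j) = ln (x j) + ln (1 + w) + real j * ln 2"
        using x(1)[of j] w by (simp add: ln_mult ln_div ln_realpow power_divide)
      also have "ln (x j) \<le> ln (3 * X)" using x(1,2)[of j] X by (subst ln_le_cancel_iff) auto
      also have "ln (3 * X) = ln 3 + ln X" using X by (subst ln_mult_pos) auto
      also have "C * (1 + (ln 3 + ln X + ln (1 + w) + real j * ln 2)) =
                   C * (1 + ln 3) + C * ln X + C * ln (1 + w) + real j * B"
        by (simp add: B_def algebra_simps)
      \<comment> \<open>From ln u \<le> u - 1 at u = (1 + w) / (2 C): the logarithm is traded for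
        half of w, which makes the recursion contract.\<close>
      also have "C * ln (1 + w) \<le> 1 / 2 + w / 2 + C * \<bar>ln (2 * C)\<bar>"
      proof -
        have "ln (1 + w) - ln (2 * C) = ln ((1 + w) / (2 * C))" using w C(1) by (subst ln_div) auto
        also have "\<dots> \<le> (1 + w) / (2 * C)" using w C(1) ln_le_minus_one[of "(1 + w) / (2 * C)"] by simp
        finally have "ln (1 + w) \<le> (1 + w) / (2 * C) + \<bar>ln (2 * C)\<bar>" by linarith
        hence "C * ln (1 + w) \<le> C * ((1 + w) / (2 * C) + \<bar>ln (2 * C)\<bar>)" using C(1) by (intro mult_left_mono) auto
        also have "\<dots> = 1 / 2 + w / 2 + C * \<bar>ln (2 * C)\<bar>" using C(1) by (simp add: field_simps)
        finally show ?thesis .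
      qed
      finally show ?thesis using C(1) by (simp add: A_def A0_def w_def)
    qed
    \<comment> \<open>The subtracted term solves a_j = A + j B + a_(j+1) / 2 exactly, so the
      difference satisfies the homogeneous inequality.\<close>
    define U where "U = (\<lambda>j. W (r j) - (2 * A + 2 * B + 2 * B * real j))"
    have U: "U j \<le> 1 / 2 * U (Suc j)" for j
      using step[of j] by (simp add: U_def algebra_simps)
    have U0: "U 0 \<le> (1 / 2) ^ j * U j" for j
    proof (induction j)
      case (Suc j)
      have "(1 / 2) ^ j * U j \<le> (1 / 2) ^ j * (1 / 2 * U (Suc j))" by (intro mult_left_mono U) auto
      also have "\<dots> = (1 / 2) ^ Suc j * U (Suc j)" by simp
      finally show ?case using Suc by linarith
    qed auto
    have "U 0 \<le> (1 / 2) ^ j * M" for j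
    proof -
      have "A \<ge> 0" using pos C(1) X by (simp add: A_def)
      moreover have "0 \<le> 2 * B * real j" using pos by simp
      ultimately have "U j \<le> W (r j)" using pos unfolding U_def by linarith
      also have "\<dots> \<le> M" using r(2)[of j] x(2)[of j] p(2)[of j] by (intro M r) auto
      finally have "(1 / 2) ^ j * U j \<le> (1 / 2) ^ j * M" by (intro mult_left_mono) auto
      with U0[of j] show ?thesis by linarith
    qed
    moreover have "(\<lambda>j. (1 / 2) ^ j * M) \<longlonglongrightarrow> 0 * M"
      by (intro tendsto_mult LIMSEQ_realpow_zero) auto
    ultimately have "U 0 \<le> 0 * M" by (intro LIMSEQ_le_const) auto
    hence "W (r 0) \<le> 2 * A + 2 * B" by (simp add: U_def)
    also have "\<dots> \<le> K * (1 + ln X)"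
    proof -
      have "C * ln X \<le> (A0 + B) * ln X" using pos X by (intro mult_right_mono) auto
      thus ?thesis by (simp add: A_def K_def algebra_simps)
    qed
    finally show "\<exists>r. X \<le> r \<and> r \<le> X + 1 \<and> good_radius S r \<and> W r \<le> K * (1 + ln X)"
      using r(1)[of 0] r(2)[of 0] r(3)[of 0] by (intro exI[of _ "r 0"]) (auto simp: x_def)
  qed
qed

end

section \<open>Finitely many zeros and poles, then none\<close>

context milloux_gap begin

text \<open>By \<open>card_le\<close>, n zeros and poles force W(r) to grow at least like (n/2) ln
  r, while \<open>W_log_growth\<close> provides arbitrarily large radii with growth K ln r; so n
  cannot exceed 2 K.\<close>

lemma finite_Sg_SF: "finite (Sg \<union> SF)"
proof (rule ccontr)
  assume inf: "infinite (Sg \<union> SF)"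
  obtain K where K: "K > 0" "\<And>x. x \<ge> 1 \<Longrightarrow> \<exists>r. x \<le> r \<and> r \<le> x + 1 \<and> good_radius S r \<and> W r \<le> K * (1 + ln x)"
    using W_log_growth by blast
  define n where "n = nat \<lceil>2 * K\<rceil> + 1"
  obtain A where A: "finite A" "card A = n" "A \<subseteq> Sg \<union> SF"
    using infinite_arbitrarily_large[OF inf] by blast
  have n: "real n \<ge> 2 * K + 1" unfolding n_def using K(1) by (simp add: real_nat_ceiling_ge)
  have "bounded A" using A(1) by (rule finite_imp_bounded)
  then obtain b where b: "\<And>a. a \<in> A \<Longrightarrow> norm a \<le> b" unfolding bounded_iff by blast
  define y where "y = max 1 (b + 1)"
  have y: "y \<ge> 1" "A \<subseteq> ball 0 y" using b by (force simp: y_def)+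
  define x where "x = max y (exp (2 * K + C0 + real n * ln y + 1))"
  have x: "x \<ge> y" "x \<ge> 1" "x \<ge> exp (2 * K + C0 + real n * ln y + 1)" using y(1) by (auto simp: x_def)
  obtain r where r: "x \<le> r" "r \<le> x + 1" "good_radius S r" "W r \<le> K * (1 + ln x)"
    using K(2)[OF x(2)] by blast
  have "real n * (ln x - ln y) = real n * ln (x / y)" using x y by (simp add: ln_div)
  also have "\<dots> \<le> real n * ln (r / y)"
    using r x y by (intro mult_left_mono) (auto intro!: divide_right_mono)
  also have "\<dots> \<le> 2 * W r + C0"
    unfolding A(2)[symmetric] using y x r by (intro card_le[OF r(3) A(3)]) auto
  also have "\<dots> \<le> 2 * (K * (1 + ln x)) + C0" using r(4) by simp
  finally have "(real n - 2 * K) * ln x \<le> 2 * K + C0 + real n * ln y" by (simp add: algebra_simps)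
  moreover have "1 * ln x \<le> (real n - 2 * K) * ln x" using n x by (intro mult_right_mono) auto
  moreover have "ln x \<ge> 2 * K + C0 + real n * ln y + 1"
    using x(2,3) by (subst ln_ge_iff) auto
  ultimately show False by linarith
qed

text \<open>All zeros and poles lie in a bounded disc, so for large |z| = r their moduli differ from
  r by at least r/2. With R between 4 r and 5 r the bound is 320/r times a term of size ln
  r.\<close>

lemma log_derivs_small:
  assumes "\<epsilon> > 0"
  obtains r0 where "r0 \<ge> 1" "\<And>z. norm z \<ge> r0 \<Longrightarrow> norm (deriv g z / g z) \<le> \<epsilon> \<and> norm (deriv F z / F z) \<le> \<epsilon> \<and> z \<notin> Sg"
proof -
  obtain K where K: "K > 0" "\<And>x. x \<ge> 1 \<Longrightarrow> \<exists>r. x \<le> r \<and> r \<le> x + 1 \<and> good_radius S r \<and> W r \<le> K * (1 + ln x)"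
    using W_log_growth by blast
  have "bounded (Sg \<union> SF)" using finite_Sg_SF by (rule finite_imp_bounded)
  then obtain y where y: "\<And>a. a \<in> Sg \<union> SF \<Longrightarrow> norm a \<le> y"
    unfolding bounded_iff by blast
  have "((\<lambda>r. 320 * (2 * K * (1 + ln 4) + C0) * inverse r + 640 * K * (ln r / r)) \<longlongrightarrow>
          320 * (2 * K * (1 + ln 4) + C0) * 0 + 640 * K * 0) at_top"
    by (intro tendsto_intros ln_x_over_x_tendsto_0 tendsto_inverse_0_at_top filterlim_ident)
  hence "eventually (\<lambda>r. 320 * (2 * K * (1 + ln 4) + C0) * inverse r + 640 * K * (ln r / r) < \<epsilon>) at_top"
    using assms by (auto dest!: order_tendstoD(2)[where a = \<epsilon>])
  hence "eventually (\<lambda>r. 320 / r * (2 * (K * (1 + ln (4 * r))) + C0) < \<epsilon>) at_top"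
    using eventually_gt_at_top[of 0]
  proof eventually_elim
    case (elim r)
    have "ln (4 * r) = ln 4 + ln r" using elim by (subst ln_mult_pos) auto
    thus ?case using elim by (simp add: field_simps)
  qed
  then obtain r1 where r1: "\<And>r. r \<ge> r1 \<Longrightarrow> 320 / r * (2 * (K * (1 + ln (4 * r))) + C0) < \<epsilon>"
    unfolding eventually_at_top_linorder by blast
  define r0 where "r0 = max 1 (max r1 (2 * y))"
  show ?thesis
  proof (rule that[of r0])
    show "r0 \<ge> 1" by (simp add: r0_def)
    fix z :: complex assume z: "norm z \<ge> r0"
    define r where "r = norm z"
    have r: "r \<ge> 1" "r \<ge> r1" "r \<ge> 2 * y" using z by (auto simp: r0_def r_def)
    obtain R where R: "4 * r \<le> R" "R \<le> 4 * r + 1" "good_radius S R" "W R \<le> K * (1 + ln (4 * r))"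
      using K(2)[of "4 * r"] r(1) by auto
    have sep: "r / 2 \<le> \<bar>r - norm a\<bar>" if "a \<in> Sg \<union> SF" for a
      using y[OF that] r by linarith
    have w: "z \<in> ball z (r / 2 / 2)" using r(1) by simp
    have \<delta>: "r / 2 > 0" "r + r / 2 \<le> R" using r R by auto
    note ld = log_derivs_le[OF R(3) \<delta> sep r_def[symmetric] w]
    have "16 * R / (r / 2)\<^sup>2 * (2 * W R + C0) \<le> 16 * (5 * r) / (r / 2)\<^sup>2 * (2 * (K * (1 + ln (4 * r))) + C0)"
      using R r W_nonneg[of R] C0_ge_1 by (intro mult_mono divide_right_mono) auto
    also have "\<dots> = 320 / r * (2 * (K * (1 + ln (4 * r))) + C0)"
      using r(1) by (simp add: power2_eq_square)
    also have "\<dots> \<le> \<epsilon>" using r1[OF r(2)] by simp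
    finally show "norm (deriv g z / g z) \<le> \<epsilon> \<and> norm (deriv F z / F z) \<le> \<epsilon> \<and> z \<notin> Sg"
      using ld by auto
  qed
qed

text \<open>Once the logarithmic derivatives are at most 1, \<open>W_le_of_log_derivs\<close>
  applies with \<Lambda> = 1, whose logarithm vanishes.\<close>

lemma W_bounded_at_infinity:
  obtains M r0 where "\<And>r. good_radius S r \<Longrightarrow> r \<ge> r0 \<Longrightarrow> W r \<le> M"
proof -
  obtain C1 where C1: "C1 > 0" "\<And>r \<Lambda>. \<lbrakk>good_radius S r; \<Lambda> \<ge> 1;
      \<And>z w. norm z = r \<Longrightarrow> w \<in> ball z (1 / \<Lambda>) \<Longrightarrow> w \<notin> Sg;
      \<And>z w. norm z = r \<Longrightarrow> w \<in> ball z (1 / \<Lambda>) \<Longrightarrow> norm (deriv g w / g w) \<le> \<Lambda>;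
      \<And>z. norm z = r \<Longrightarrow> norm (deriv F z / F z) \<le> \<Lambda>\<rbrakk> \<Longrightarrow> W r \<le> C1 * (1 + ln \<Lambda>)"
    using W_le_of_log_derivs by blast
  obtain r0 where r0: "\<And>z. norm z \<ge> r0 \<Longrightarrow> norm (deriv g z / g z) \<le> 1 \<and> norm (deriv F z / F z) \<le> 1 \<and> z \<notin> Sg"
    using log_derivs_small[of 1] by auto
  show ?thesis
  proof (rule that)
    fix r assume good: "good_radius S r" and r: "r \<ge> r0 + 1"
    have far: "norm w \<ge> r0" if "norm z = r" "w \<in> ball z (1 / 1)" for z w :: complex
      using that r norm_triangle_ineq2[of z w] by (auto simp: dist_norm)
    show "W r \<le> C1 * (1 + ln 1)"
    proof (rule C1(2)[OF good])
      fix z w :: complex assume "norm z = r" "w \<in> ball z (1 / 1)"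
      from r0[OF far[OF this]] show "w \<notin> Sg" "norm (deriv g w / g w) \<le> 1" by auto
    next
      fix z :: complex assume "norm z = r"
      thus "norm (deriv F z / F z) \<le> 1" using r r0[of z] by auto
    qed auto
  qed
qed

text \<open>By \<open>card_le\<close> a single zero or pole contributes ln (r/y), which is
  unbounded, to a quantity that is bounded.\<close>

lemma Sg_empty: "Sg = {}"
proof (rule ccontr)
  assume "Sg \<noteq> {}"
  then obtain a where a: "a \<in> Sg" by blast
  obtain M r0 where M: "\<And>r. good_radius S r \<Longrightarrow> r \<ge> r0 \<Longrightarrow> W r \<le> M"
    using W_bounded_at_infinity by blast
  obtain K where K: "K > 0" "\<And>x. x \<ge> 1 \<Longrightarrow> \<exists>r. x \<le> r \<and> r \<le> x + 1 \<and> good_radius S r \<and> W r \<le> K * (1 + ln x)"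
    using W_log_growth by blast
  define y where "y = norm a + 1"
  have y: "y > 0" by (simp add: y_def add_nonneg_pos)
  define x where "x = Max {1, r0, y, y * exp (2 * M + C0 + 1)}"
  have x: "x \<ge> 1" "x \<ge> r0" "x \<ge> y" "x \<ge> y * exp (2 * M + C0 + 1)" by (simp_all add: x_def)
  obtain r where r: "x \<le> r" "good_radius S r" using K(2)[OF x(1)] by blast
  have "real (card {a}) * ln (r / y) \<le> 2 * W r + C0"
    using a r x y by (intro card_le[OF r(2)]) (auto simp: y_def)
  also have "\<dots> \<le> 2 * M + C0" using M[OF r(2)] r(1) x(2) by simp
  finally have "ln (r / y) \<le> 2 * M + C0" by simp
  moreover have "exp (2 * M + C0 + 1) \<le> r / y" using r x y by (simp add: field_simps)
  hence "ln (r / y) \<ge> 2 * M + C0 + 1" using r x y by (subst ln_ge_iff) auto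
  ultimately show False by linarith
qed

text \<open>Liouville's theorem makes g'/g vanish, hence also \<open>F1\<close>. This contradicts
  the locale itself: the origin is off \<open>S\<close>, so \<open>F1\<close> is nonzero
  there.\<close>

theorem no_milloux_gap: False
proof -
  have off: "g analytic_on {z}" "g z \<noteq> 0" for z
    using divisor_inD(4,5)[OF divisor_in_Sg, of z] Sg_empty by auto
  have an: "g analytic_on UNIV" using off(1) by (metis analytic_on_analytic_at)
  hence holo: "g holomorphic_on UNIV" by (rule analytic_imp_holomorphic)
  have "((\<lambda>z. deriv g z / g z) \<longlongrightarrow> 0) at_infinity"
    unfolding Lim_at_infinity
  proof (intro allI impI)
    fix e :: real assume e: "e > 0"
    hence "e / 2 > 0" by simp
    from log_derivs_small[OF this] obtain r0 where
      r0: "\<And>z. norm z \<ge> r0 \<Longrightarrow> norm (deriv g z / g z) \<le> e / 2" by metis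
    show "\<exists>b. \<forall>z. b \<le> norm z \<longrightarrow> dist (deriv g z / g z) 0 < e"
    proof (intro exI allI impI)
      fix z :: complex assume "r0 \<le> norm z"
      from r0[OF this] show "dist (deriv g z / g z) 0 < e" using e by simp
    qed
  qed
  moreover have "(\<lambda>z. deriv g z / g z) holomorphic_on UNIV"
    using off by (intro holomorphic_intros holomorphic_deriv holo) auto
  ultimately have "deriv g z / g z = 0" for z by (intro Liouville_weak_0)
  hence "deriv g = (\<lambda>_. 0)" using off by auto
  hence "F1 z = 0" for z
    unfolding F1_def funpow_Suc_right by (simp add: higher_deriv_const)
  thus False using g_0_nz by simp
qed

end

section \<open>Rigidity of meromorphic functions on the plane\<close>

lemma deriv_shift: "deriv (\<lambda>z. f (z + p)) = (\<lambda>z. deriv f (z + p))" for p :: "'a :: real_normed_field"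
  by (simp add: deriv_def DERIV_shift fun_eq_iff)

lemma higher_deriv_shift: "(deriv ^^ n) (\<lambda>z. f (z + p)) = (\<lambda>z. (deriv ^^ n) f (z + p))"
  for p :: "'a :: real_normed_field"
  by (induction n) (simp_all add: deriv_shift)

lemma cosparse_const_imp_deriv_0:
  fixes f :: "complex \<Rightarrow> complex"
  assumes "eventually (\<lambda>z. f z = b) (cosparse UNIV)"
  shows   "eventually (\<lambda>z. deriv f z = 0) (cosparse UNIV)"
proof -
  define X where "X = {z. f z \<noteq> b}"
  have X: "X sparse_in UNIV" using assms by (simp add: X_def eventually_cosparse)
  hence opn: "open (-X)" using sparse_in_UNIV_imp_closed by blast
  have "deriv f z = 0" if "z \<notin> X" for z
  proof -
    have "deriv f z = deriv (\<lambda>_. b) z"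
      using that by (intro deriv_cong_ev eventually_mono[OF eventually_nhds_in_open[OF opn]]) (auto simp: X_def)
    thus ?thesis by simp
  qed
  hence "{z. deriv f z \<noteq> 0} \<subseteq> X" by auto
  thus ?thesis using X sparse_in_subset2 by (auto simp: eventually_cosparse)
qed

lemma zorder_ge_imp_higher_deriv_0:
  assumes an: "f analytic_on {z}" and ord: "zorder f z \<ge> int n" and j: "j < n"
  shows   "(deriv ^^ j) f z = 0"
proof (rule ccontr)
  assume nz: "(deriv ^^ j) f z \<noteq> 0"
  define l where "l = (LEAST l. (deriv ^^ l) f z \<noteq> 0)"
  have l: "(deriv ^^ l) f z \<noteq> 0" unfolding l_def by (rule LeastI[of _ j]) (rule nz)
  have l': "(deriv ^^ i) f z = 0" if "i < l" for i
    using not_less_Least[of i "\<lambda>l. (deriv ^^ l) f z \<noteq> 0"] that by (auto simp: l_def)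
  have "l \<le> j" unfolding l_def by (rule Least_le) (rule nz)
  moreover have "zorder f z = int l" using an l l' by (intro zorder_zero_eqI') auto
  ultimately show False using ord j by simp
qed

lemma entire_eq_0_of_higher_derivs:
  assumes "f holomorphic_on UNIV" "\<And>j. (deriv ^^ j) f a = 0"
  shows   "f z = 0"
  using holomorphic_fun_eq_0_on_connected[OF assms(1), of a z] assms(2) Convex.connected_UNIV by auto

lemma milloux_not_polynomial:
  assumes g: "g nicely_meromorphic_on UNIV"
    and zeros: "\<And>a. isolated_zero g a \<Longrightarrow> zorder g a \<ge> int d" and d: "k < d"
    and ev: "eventually (\<lambda>z. (deriv ^^ Suc k) g z = 0) (cosparse UNIV)"
  shows   "\<exists>b. \<forall>z. g z = b"
proof -
  have mero: "(deriv ^^ j) g meromorphic_on A" for j A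
    using g meromorphic_on_subset[of g UNIV A] unfolding nicely_meromorphic_on_def
    by (intro meromorphic_intros) auto
  have "\<not>is_pole g a" for a
  proof
    assume "is_pole g a"
    hence "is_pole ((deriv ^^ j) g) a" for j
      by (induction j) (auto simp: is_pole_deriv_iff[OF mero])
    hence "eventually (\<lambda>z. (deriv ^^ Suc k) g z \<noteq> 0) (at a)"
      by (metis non_zero_neighbour_pole)
    moreover have "eventually (\<lambda>z. (deriv ^^ Suc k) g z = 0) (at a)"
      using ev by (rule eventually_cosparse_imp_eventually_at) auto
    ultimately have "eventually (\<lambda>z. False) (at a)" by eventually_elim auto
    thus False by simp
  qed
  hence an: "g analytic_on UNIV"
    using nicely_meromorphic_without_singularities[OF g] by simp
  hence holo: "g holomorphic_on UNIV" by (rule analytic_imp_holomorphic)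
  have F1: "(deriv ^^ Suc k) g z = 0" for z
  proof (rule tendsto_unique[of "at z"])
    have "(deriv ^^ Suc k) g analytic_on {z}"
      using an by (intro analytic_higher_deriv) (auto intro: analytic_on_subset)
    thus "(deriv ^^ Suc k) g \<midarrow>z\<rightarrow> (deriv ^^ Suc k) g z"
      using analytic_at_imp_isCont isContD by blast
    have "eventually (\<lambda>z. (deriv ^^ Suc k) g z = 0) (at z)"
      using ev by (rule eventually_cosparse_imp_eventually_at) auto
    thus "(deriv ^^ Suc k) g \<midarrow>z\<rightarrow> 0" by (rule tendsto_eventually)
  qed simp
  have high: "(deriv ^^ j) g z = 0" if "j > k" for j z
  proof -
    have "(deriv ^^ (i + Suc k)) g = (\<lambda>_. 0)" for i
    proof (induction i)
      case 0
      thus ?case using F1 by (simp add: fun_eq_iff)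
    next
      case (Suc i)
      have "(deriv ^^ (Suc i + Suc k)) g = deriv ((deriv ^^ (i + Suc k)) g)" by simp
      also have "\<dots> = (\<lambda>_. 0)" unfolding Suc.IH by (simp add: fun_eq_iff)
      finally show ?case .
    qed
    from this[of "j - Suc k"] show ?thesis using that by simp
  qed
  show ?thesis
  proof (cases "\<exists>a. g a = 0")
    case True
    then obtain a where a: "g a = 0" by blast
    have "g z = 0" for z
    proof (cases "isolated_zero g a")
      case True
      have an_a: "g analytic_on {a}" using an by (rule analytic_on_subset) auto
      \<comment> \<open>Derivatives of order below d vanish by the multiplicity, those of order
        above k because \<open>g\<close> is a polynomial; k < d covers all orders.\<close>
      have "(deriv ^^ j) g a = 0" for j
        using zorder_ge_imp_higher_deriv_0[OF an_a zeros[OF True], of j] high[of j a] d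
        by (cases "j < d") auto
      thus ?thesis using entire_eq_0_of_higher_derivs[OF holo] by blast
    next
      case False
      have "g analytic_on {a}" using an by (rule analytic_on_subset) auto
      hence "eventually (\<lambda>z. g z = 0) (at a)"
        using a False by (intro non_isolated_zero_imp_eventually_zero)
      hence "eventually (\<lambda>z. g z = 0) (nhds a)" using a by (simp add: eventually_nhds_conv_at)
      then obtain U where "open U" "a \<in> U" "\<And>z. z \<in> U \<Longrightarrow> g z = 0" by (auto simp: eventually_nhds)
      thus ?thesis using analytic_continuation_open[of U UNIV g "\<lambda>_. 0"] holo by auto
    qed
    thus ?thesis by blast
  next
    case False
    define c where "c = (\<lambda>j. (deriv ^^ j) g 0 / fact j)"
    have poly: "g z = (\<Sum>j\<le>k. c j * z ^ j)" for z
    proof -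
      have "(\<lambda>j. (deriv ^^ j) g 0 / fact j * (z - 0) ^ j) sums g z"
        by (rule holomorphic_power_series[of g 0 "norm z + 1"]) (use holo in \<open>auto intro: holomorphic_on_subset\<close>)
      moreover have "(\<lambda>j. c j * z ^ j) sums (\<Sum>j\<le>k. c j * z ^ j)"
        by (rule sums_finite) (auto simp: c_def high)
      ultimately show ?thesis by (simp add: c_def sums_unique2)
    qed
    have "\<not>(c 0 = 0 \<or> (\<exists>i\<in>{1..k}. c i \<noteq> 0))"
      using fundamental_theorem_of_algebra[of c k] poly False by metis
    hence "g z = c 0" for z
      unfolding poly by (subst sum.remove[of _ 0]) (auto intro!: sum.neutral)
    thus ?thesis by blast
  qed
qed

text \<open>The locale asks for the origin to be off the exceptional set. All hypotheses are
  invariant under translation, so a point \<open>p\<close> outside that set is moved to the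
  origin.\<close>

theorem milloux_rigidity:
  fixes g :: "complex \<Rightarrow> complex" and d k m :: nat
  assumes g: "g nicely_meromorphic_on UNIV" and c: "c \<noteq> 0" and "d > 0" "m > 0"
    and gap: "(real k + 1) / real d + (real k + 2) / (2 * real m) < 1 / 2"
    and zeros: "\<And>a. isolated_zero g a \<Longrightarrow> zorder g a \<ge> int d"
    and poles: "\<And>a. is_pole g a \<Longrightarrow> zorder g a \<le> -2"
    and F_zeros: "\<And>a. isolated_zero (\<lambda>z. (deriv ^^ k) g z - c) a \<Longrightarrow> zorder (\<lambda>z. (deriv ^^ k) g z - c) a \<ge> int m"
  shows "\<exists>b. \<forall>z. g z = b"
proof (rule ccontr)
  assume nonconst: "\<not>?thesis"
  have d: "d \<ge> k + 2"
  proof -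
    have "(real k + 1) / real d < 1 / 2"
      using gap by (smt (verit) divide_nonneg_nonneg of_nat_0_le_iff)
    hence "2 * (real k + 1) < real d" using \<open>d > 0\<close> by (simp add: field_simps)
    hence "real (2 * (k + 1)) < real d" by simp
    hence "2 * (k + 1) < d" by (subst (asm) of_nat_less_iff)
    thus ?thesis by simp
  qed
  have mero: "(deriv ^^ j) g meromorphic_on A" for j A
    using g meromorphic_on_subset[of g UNIV A] unfolding nicely_meromorphic_on_def
    by (intro meromorphic_intros) auto
  \<comment> \<open>If a derivative of lower order vanished identically, so would the one of order k
    + 1, which is the polynomial case.\<close>
  have not0: "\<not>eventually (\<lambda>z. (deriv ^^ j) g z = 0) (cosparse UNIV)" if "j \<le> Suc k" for j
  proof
    assume "eventually (\<lambda>z. (deriv ^^ j) g z = 0) (cosparse UNIV)"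
    hence "eventually (\<lambda>z. (deriv ^^ (i + j)) g z = 0) (cosparse UNIV)" for i
      by (induction i) (auto intro: cosparse_const_imp_deriv_0)
    from this[of "Suc k - j"] that have "eventually (\<lambda>z. (deriv ^^ Suc k) g z = 0) (cosparse UNIV)"
      by (simp del: funpow.simps(2))
    from milloux_not_polynomial[OF g zeros _ this] d nonconst show False by auto
  qed
  have nz: "eventually (\<lambda>z. (deriv ^^ j) g z \<noteq> 0) (cosparse UNIV)" if "j \<le> Suc k" for j
    using meromorphic_imp_constant_or_avoid[OF mero[of j UNIV], of 0] not0[OF that] by auto
  have nzF: "eventually (\<lambda>z. (deriv ^^ k) g z \<noteq> c) (cosparse UNIV)"
    using meromorphic_imp_constant_or_avoid[OF mero[of k UNIV], of c] not0[of "Suc k"]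
          cosparse_const_imp_deriv_0[of "(deriv ^^ k) g" c] by auto
  have np: "eventually (\<lambda>z. \<not>is_pole g z) (cosparse UNIV)"
    using mero[of 0 UNIV] by (auto intro: meromorphic_on_imp_not_pole_cosparse)
  have "eventually (\<lambda>z. \<forall>j\<in>{..Suc k}. (deriv ^^ j) g z \<noteq> 0) (cosparse UNIV)"
    using nz by (intro eventually_ball_finite) auto
  with np nzF have ev: "eventually (\<lambda>z. \<not>is_pole g z \<and> (\<forall>j\<in>{..Suc k}. (deriv ^^ j) g z \<noteq> 0) \<and>
      (deriv ^^ k) g z \<noteq> c) (cosparse UNIV)" by eventually_elim auto
  define S0 where "S0 = {z. \<not>(\<not>is_pole g z \<and> (\<forall>j\<in>{..Suc k}. (deriv ^^ j) g z \<noteq> 0) \<and> (deriv ^^ k) g z \<noteq> c)}"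
  have S0: "S0 sparse_in UNIV" using ev unfolding eventually_cosparse S0_def .
  obtain p where p: "p \<notin> S0"
  proof -
    have "frequently (\<lambda>z. z \<notin> S0) (cosparse UNIV)"
      using ev by (intro eventually_frequently) (auto simp: S0_def)
    thus ?thesis using that frequently_ex by blast
  qed
  define S where "S = {z. z + p \<in> S0}"
  define h where "h = (\<lambda>z. g (z + p))"
  have dh: "(deriv ^^ j) h z = (deriv ^^ j) g (z + p)" for j z
    unfolding h_def by (simp add: higher_deriv_shift)
  have fm: "filtermap (\<lambda>z. z + p) (at a) = at (a + p)" for a
    using filtermap_at_shift[of "-p" a] by simp
  have pole: "is_pole h a \<longleftrightarrow> is_pole g (a + p)" for a
    using is_pole_compose_iff[OF fm, of g a] by (simp add: h_def o_def)
  have zero: "isolated_zero (\<lambda>z. u (z + p)) a \<longleftrightarrow> isolated_zero u (a + p)" for u :: "complex \<Rightarrow> complex" and a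
    unfolding isolated_zero_def fm[symmetric] by (simp add: filterlim_filtermap eventually_filtermap)
  have ord: "zorder (\<lambda>z. u (z + p)) a = zorder u (a + p)" for u :: "complex \<Rightarrow> complex" and a
    by (subst (1 2) zorder_shift) (simp add: add_ac)
  have nice: "h nicely_meromorphic_on UNIV"
    unfolding nicely_meromorphic_on_def
  proof (intro conjI ballI)
    show "h meromorphic_on UNIV"
      unfolding h_def
    proof (rule meromorphic_on_compose[of g UNIV "\<lambda>z. z + p"])
      show "g meromorphic_on UNIV" using mero[of 0 UNIV] by simp
      show "(\<lambda>z. z + p) analytic_on UNIV" by (intro analytic_intros)
    qed auto
    fix a :: complex
    have "is_pole g (a + p) \<and> g (a + p) = 0 \<or> g \<midarrow>(a + p)\<rightarrow> g (a + p)"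
      using g unfolding nicely_meromorphic_on_def by blast
    moreover have "h \<midarrow>a\<rightarrow> h a \<longleftrightarrow> g \<midarrow>(a + p)\<rightarrow> g (a + p)"
      unfolding h_def by (subst fm[symmetric]) (simp add: filterlim_filtermap)
    ultimately show "is_pole h a \<and> h a = 0 \<or> h \<midarrow>a\<rightarrow> h a"
      unfolding pole by (simp add: h_def)
  qed
  have S: "S sparse_in UNIV"
  proof -
    have "S = (+) (-p) ` S0"
    proof safe
      fix z assume "z \<in> S"
      hence "z = -p + (z + p)" "z + p \<in> S0" by (auto simp: S_def)
      thus "z \<in> (+) (-p) ` S0" by blast
    qed (auto simp: S_def)
    thus ?thesis using sparse_in_translate_UNIV[OF S0, of "-p"] by metis
  qed
  interpret M: milloux h c k d m S "\<lambda>z. (deriv ^^ k) h z - c" "(deriv ^^ Suc k) h"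
  proof unfold_locales
    show "zorder (\<lambda>z. (deriv ^^ k) h z - c) a \<ge> int m" if "isolated_zero (\<lambda>z. (deriv ^^ k) h z - c) a" for a
      using that F_zeros[of "a + p"] zero[of "\<lambda>z. (deriv ^^ k) g z - c" a]
            ord[of "\<lambda>z. (deriv ^^ k) g z - c" a] by (simp add: dh)
    show "zorder h a \<ge> int d" if "isolated_zero h a" for a
      using that zeros unfolding h_def ord zero by blast
    show "zorder h a \<le> -2" if "is_pole h a" for a
      using that poles unfolding pole unfolding h_def ord by blast
    fix z j assume "z \<notin> S"
    hence z: "z + p \<notin> S0" by (simp add: S_def)
    show "\<not>is_pole h z" "(deriv ^^ k) h z - c \<noteq> 0"
      using z unfolding pole dh S0_def by auto
    show "(deriv ^^ j) h z \<noteq> 0" if "j \<le> Suc k"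
      using z that unfolding dh S0_def by blast
  qed (use nice c d \<open>m > 0\<close> S p in \<open>auto simp: S_def\<close>)
  \<comment> \<open>The number \<theta> is the left side of the gap hypothesis plus 1/2.\<close>
  interpret M: milloux_gap h c k d m S "\<lambda>z. (deriv ^^ k) h z - c" "(deriv ^^ Suc k) h"
    by unfold_locales (use gap in \<open>unfold M.\<theta>_def, linarith\<close>)
  show False by (rule M.no_milloux_gap)
qed

section \<open>Marty's theorem\<close>

text \<open>A bound for the spherical derivative with the denominator cleared. Poles are left out
  because \<open>deriv\<close> carries no information there; the bound reaches them through the
  reciprocal, in \<open>bounded_spherical_deriv_inverse\<close>.\<close>

definition bounded_spherical_deriv :: "(complex \<Rightarrow> complex) \<Rightarrow> real \<Rightarrow> complex set \<Rightarrow> bool" where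
  "bounded_spherical_deriv f L B \<longleftrightarrow> f nicely_meromorphic_on B \<and>
     (\<forall>z\<in>B. \<not>is_pole f z \<longrightarrow> norm (deriv f z) \<le> L * (1 + (norm (f z))\<^sup>2))"

text \<open>The bound 2 is chosen because a function of modulus at most 1 at the centre of a small
  enough ball stays below it on the whole ball.\<close>

definition finite_type :: "(complex \<Rightarrow> complex) \<Rightarrow> complex set \<Rightarrow> bool" where
  "finite_type f B \<longleftrightarrow> f holomorphic_on B \<and> (\<forall>z\<in>B. norm (f z) \<le> 2)"

text \<open>Since \<open>inverse 0 = 0\<close>, the pointwise inverse of a nicely meromorphic function has the right
  value \<open>0\<close> at the poles. The last clause excludes the zero function.\<close>
definition infinite_type :: "(complex \<Rightarrow> complex) \<Rightarrow> complex set \<Rightarrow> bool" where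
  "infinite_type f B \<longleftrightarrow> (\<lambda>z. inverse (f z)) holomorphic_on B \<and> (\<forall>z\<in>B. norm (inverse (f z)) \<le> 2) \<and>
     (\<forall>z\<in>B. is_pole f z \<or> f z \<noteq> 0)"

text \<open>Truncation at 3 makes the modulus continuous across poles, so that the intermediate
  value theorem can detect a first crossing of the level 2 before poles have been excluded.\<close>

lemma continuous_truncated_norm:
  assumes f: "f nicely_meromorphic_on B" and B: "open B"
  shows   "continuous_on B (\<lambda>z. if is_pole f z then 3 else min 3 (norm (f z)))"
proof (rule continuous_at_imp_continuous_on, safe)
  fix z assume z: "z \<in> B"
  define v where "v = (\<lambda>z. if is_pole f z then 3 else min 3 (norm (f z)))"
  show "isCont v z"
  proof (cases "is_pole f z")
    case True
    have "eventually (\<lambda>w. norm (f w) \<ge> 3) (at z)"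
      using True unfolding is_pole_def filterlim_at_infinity_conv_norm_at_top filterlim_at_top by blast
    hence "eventually (\<lambda>w. v w = v z) (at z)"
      by eventually_elim (auto simp: v_def True)
    thus ?thesis unfolding isCont_def by (rule tendsto_eventually)
  next
    case False
    hence an: "f analytic_on {z}" using f z by (intro nicely_meromorphic_on_imp_analytic_at)
    then obtain U where U: "open U" "z \<in> U" "f holomorphic_on U" by (auto simp: analytic_at)
    have "eventually (\<lambda>w. w \<in> U) (nhds z)" using U by (intro eventually_nhds_in_open) auto
    hence ev: "eventually (\<lambda>w. v w = min 3 (norm (f w))) (nhds z)"
    proof eventually_elim
      case (elim w)
      hence "f analytic_on {w}" using U by (auto simp: analytic_at)
      hence "\<not>is_pole f w" by (rule analytic_at_imp_no_pole)
      thus ?case by (simp add: v_def)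
    qed
    have "isCont (\<lambda>w. min 3 (norm (f w))) z"
      using analytic_at_imp_isCont[OF an] by (intro continuous_intros)
    with isCont_cong[OF ev] show ?thesis by simp
  qed
qed

text \<open>Along a segment from the centre, up to the first point where the modulus is 2, the
  derivative is at most L (1 + 2^2) = 5 L. So f has moved by at most 5 L \<delta> < 1, and its
  modulus cannot have risen from 1 to 2.\<close>

lemma finite_type_of_small_center:
  assumes f: "bounded_spherical_deriv f L (ball z0 \<delta>)" and \<delta>: "5 * L * \<delta> < 1" "\<delta> > 0" "L \<ge> 0"
    and z0: "\<not>is_pole f z0" "norm (f z0) \<le> 1"
  shows   "finite_type f (ball z0 \<delta>)"
proof -
  have nice: "f nicely_meromorphic_on ball z0 \<delta>"
    and bound: "\<And>z. z \<in> ball z0 \<delta> \<Longrightarrow> \<not>is_pole f z \<Longrightarrow> norm (deriv f z) \<le> L * (1 + (norm (f z))\<^sup>2)"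
    using f by (auto simp: bounded_spherical_deriv_def)
  define v where "v = (\<lambda>z. if is_pole f z then 3 else min 3 (norm (f z)))"
  have v: "continuous_on (ball z0 \<delta>) v" unfolding v_def using nice by (rule continuous_truncated_norm) auto
  have main: "v z1 < 2" if z1: "z1 \<in> ball z0 \<delta>" for z1
  proof (rule ccontr)
    assume ge: "\<not>v z1 < 2"
    define \<phi> where "\<phi> = (\<lambda>t. z0 + of_real t * (z1 - z0))"
    have \<phi>_in: "\<phi> t \<in> ball z0 \<delta>" if "t \<in> {0..1}" for t
    proof -
      have "norm (\<phi> t - z0) \<le> 1 * norm (z1 - z0)"
        unfolding \<phi>_def using that by (simp add: norm_mult mult_left_le_one_le)
      thus ?thesis using z1 by (simp add: dist_norm norm_minus_commute)
    qed
    have cont: "continuous_on {0..1} (\<lambda>t. v (\<phi> t))"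
      by (rule continuous_on_compose2[OF v]) (use \<phi>_in in \<open>auto simp: \<phi>_def intro!: continuous_intros\<close>)
    have v0: "v (\<phi> 0) \<le> 1" using z0 by (simp add: v_def \<phi>_def)
    have v1: "v (\<phi> 1) \<ge> 2" using ge by (simp add: \<phi>_def)
    define A where "A = {0..1} \<inter> (\<lambda>t. v (\<phi> t)) -` {2}"
    have "closed A" unfolding A_def by (intro continuous_closed_preimage cont) auto
    hence "compact ({0..1} \<inter> A)" by (intro compact_Int_closed) auto
    moreover have "{0..1} \<inter> A = A" by (auto simp: A_def)
    ultimately have "compact A" by simp
    moreover have "A \<noteq> {}"
      using IVT'[of "\<lambda>t. v (\<phi> t)" 0 2 1] cont v0 v1 by (auto simp: A_def)
    ultimately have "\<exists>t\<in>A. \<forall>s\<in>A. t \<le> s" by (rule compact_attains_inf)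
    then obtain t where t: "t \<in> A" "\<And>s. s \<in> A \<Longrightarrow> t \<le> s" by blast
    have t01: "t \<in> {0..1}" "v (\<phi> t) = 2" using t by (auto simp: A_def)
    have le2: "v (\<phi> s) \<le> 2" if "s \<in> {0..t}" for s
    proof (rule ccontr)
      assume gt: "\<not>v (\<phi> s) \<le> 2"
      have "\<exists>s'\<ge>0. s' \<le> s \<and> v (\<phi> s') = 2"
        by (rule IVT') (use gt v0 that t01 in \<open>auto intro: continuous_on_subset[OF cont]\<close>)
      then obtain s' where s': "0 \<le> s'" "s' \<le> s" "v (\<phi> s') = 2" by blast
      hence "s' \<in> A" using that t01 by (auto simp: A_def)
      hence "t = s" using t(2)[of s'] s' that by auto
      thus False using gt t01 by simp
    qed
    have seg: "\<exists>s\<in>{0..t}. w = \<phi> s" if w: "w \<in> closed_segment z0 (\<phi> t)" for w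
    proof -
      obtain u where u: "0 \<le> u" "u \<le> 1" "w = (1 - u) *\<^sub>R z0 + u *\<^sub>R \<phi> t"
        using w by (auto simp: closed_segment_def)
      have "w = \<phi> (u * t)" unfolding u(3) \<phi>_def by (simp add: algebra_simps scaleR_conv_of_real)
      moreover have "u * t \<in> {0..t}" using u t01 by (auto simp: mult_left_le_one_le)
      ultimately show ?thesis by blast
    qed
    have np: "\<not>is_pole f w" "norm (f w) \<le> 2" "w \<in> ball z0 \<delta>" if w: "w \<in> closed_segment z0 (\<phi> t)" for w
    proof -
      obtain s where s: "s \<in> {0..t}" "w = \<phi> s" using seg[OF w] by blast
      show "\<not>is_pole f w" "norm (f w) \<le> 2"
        using le2[OF s(1)] s(2) by (auto simp: v_def split: if_splits)
      show "w \<in> ball z0 \<delta>" using \<phi>_in[of s] s t01 by auto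
    qed
    have "norm (f (\<phi> t) - f z0) \<le> 5 * L * norm (\<phi> t - z0)"
    proof (rule field_differentiable_bound[of "closed_segment z0 (\<phi> t)" f "deriv f"])
      fix w assume w: "w \<in> closed_segment z0 (\<phi> t)"
      have "f analytic_on {w}"
        using np[OF w] nice by (intro nicely_meromorphic_on_imp_analytic_at)
      thus "(f has_field_derivative deriv f w) (at w within closed_segment z0 (\<phi> t))"
        using analytic_on_imp_differentiable_at DERIV_deriv_iff_field_differentiable
        by (metis has_field_derivative_at_within insertI1)
      have "norm (deriv f w) \<le> L * (1 + (norm (f w))\<^sup>2)" using bound np[OF w] by blast
      also have "\<dots> \<le> L * (1 + 2\<^sup>2)" using np(2)[OF w] \<delta> by (intro mult_left_mono add_mono power_mono) auto
      finally show "norm (deriv f w) \<le> 5 * L" by simp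
    qed auto
    also have "\<dots> \<le> 5 * L * \<delta>"
      using \<phi>_in[OF t01(1)] \<delta> by (intro mult_left_mono) (auto simp: dist_norm norm_minus_commute)
    finally have "norm (f (\<phi> t) - f z0) < 1" using \<delta> by simp
    moreover have "norm (f (\<phi> t)) = 2" using t01(2) by (auto simp: v_def min_def split: if_splits)
    ultimately show False using z0(2) norm_triangle_ineq2[of "f (\<phi> t)" "f z0"] by linarith
  qed
  hence np: "\<not>is_pole f z \<and> norm (f z) \<le> 2" if "z \<in> ball z0 \<delta>" for z
    using main[OF that] by (auto simp: v_def split: if_splits)
  have "f analytic_on ball z0 \<delta>"
    using np nice by (intro nicely_meromorphic_without_singularities) auto
  thus ?thesis using np by (auto simp: finite_type_def dest: analytic_imp_holomorphic)
qed

text \<open>The spherical derivative is invariant under w \<mapsto> 1/w. At a pole of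
  \<open>f\<close> the reciprocal is regular, and the inequality at nearby points passes to the
  limit.\<close>

lemma bounded_spherical_deriv_inverse:
  assumes f: "bounded_spherical_deriv f L B" and B: "open B" and L: "L \<ge> 0"
  shows   "bounded_spherical_deriv (\<lambda>z. inverse (f z)) L B"
  unfolding bounded_spherical_deriv_def
proof (intro conjI ballI impI)
  have nice: "f nicely_meromorphic_on B"
    and bound: "\<And>z. z \<in> B \<Longrightarrow> \<not>is_pole f z \<Longrightarrow> norm (deriv f z) \<le> L * (1 + (norm (f z))\<^sup>2)"
    using f by (auto simp: bounded_spherical_deriv_def)
  define h where "h = (\<lambda>z. inverse (f z))"
  show nice': "(\<lambda>z. inverse (f z)) nicely_meromorphic_on B"
    using nice by (rule nicely_meromorphic_on_inverse)
  have reg: "norm (deriv h z) \<le> L * (1 + (norm (h z))\<^sup>2)"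
    if "z \<in> B" "\<not>is_pole f z" "f z \<noteq> 0" for z
  proof -
    have "f analytic_on {z}" using nice that by (intro nicely_meromorphic_on_imp_analytic_at)
    hence "(f has_field_derivative deriv f z) (at z)"
      using analytic_on_imp_differentiable_at DERIV_deriv_iff_field_differentiable by blast
    hence "(h has_field_derivative - (deriv f z / (f z)\<^sup>2)) (at z)"
      unfolding h_def using that by (auto intro!: derivative_eq_intros simp: power2_eq_square field_simps)
    hence "norm (deriv h z) = norm (deriv f z) / (norm (f z))\<^sup>2"
      by (simp add: DERIV_imp_deriv norm_divide norm_power)
    also have "\<dots> \<le> L * (1 + (norm (f z))\<^sup>2) / (norm (f z))\<^sup>2"
      using bound[OF that(1,2)] by (intro divide_right_mono) auto
    also have "\<dots> = L * (1 + (norm (h z))\<^sup>2)"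
    proof -
      have nh: "norm (h z) = 1 / norm (f z)" by (simp add: h_def norm_inverse inverse_eq_divide norm_divide)
      show ?thesis using that unfolding nh by (simp add: power_divide field_simps)
    qed
    finally show ?thesis .
  qed
  fix z assume z: "z \<in> B" "\<not>is_pole (\<lambda>z. inverse (f z)) z"
  have an: "h analytic_on {z}" unfolding h_def using nice' z by (intro nicely_meromorphic_on_imp_analytic_at)
  consider "is_pole f z" | "\<not>is_pole f z" "f z = 0" | "\<not>is_pole f z" "f z \<noteq> 0" by blast
  thus "norm (deriv (\<lambda>z. inverse (f z)) z) \<le> L * (1 + (norm (inverse (f z)))\<^sup>2)"
  proof cases
    case 1
    have "eventually (\<lambda>w. w \<in> B) (at z)" using B z by (intro eventually_at_in_open') auto
    moreover have "eventually (\<lambda>w. f w \<noteq> 0) (at z)" using 1 by (rule non_zero_neighbour_pole)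
    moreover have "eventually (\<lambda>w. f analytic_on {w}) (at z)"
    proof -
      have "isolated_singularity_at f z" using nice z(1)
        by (auto simp: nicely_meromorphic_on_def meromorphic_on_altdef)
      thus ?thesis using isolated_singularity_at_altdef by blast
    qed
    ultimately have ev: "eventually (\<lambda>w. norm (deriv h w) \<le> L * (1 + (norm (h w))\<^sup>2)) (at z)"
      by eventually_elim (use reg analytic_at_imp_no_pole in blast)
    have "isCont h z" "isCont (deriv h) z"
      using an analytic_deriv[of h "{z}"] by (auto intro: analytic_at_imp_isCont)
    hence "((\<lambda>w. norm (deriv h w)) \<longlongrightarrow> norm (deriv h z)) (at z)"
      "((\<lambda>w. L * (1 + (norm (h w))\<^sup>2)) \<longlongrightarrow> L * (1 + (norm (h z))\<^sup>2)) (at z)"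
      by (auto simp: isCont_def intro!: tendsto_intros)
    from tendsto_le[OF _ this(2,1) ev] show ?thesis by (simp add: h_def)
  next
    \<comment> \<open>A zero at which the reciprocal has no pole is not isolated, so
      \<open>f\<close> and its pointwise reciprocal vanish nearby.\<close>
    case 2
    have "\<not>isolated_zero f z" using z(2) by (simp add: is_pole_inverse_iff)
    moreover have "f analytic_on {z}" using nice z 2 by (intro nicely_meromorphic_on_imp_analytic_at)
    ultimately have "eventually (\<lambda>w. f w = 0) (nhds z)"
      using 2 by (intro non_isolated_zero_imp_eventually_zero')
    hence "eventually (\<lambda>w. h w = 0) (nhds z)" by eventually_elim (simp add: h_def)
    hence "deriv h z = deriv (\<lambda>_. 0) z" by (intro deriv_cong_ev) auto
    thus ?thesis using L by (simp add: h_def)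
  next
    case 3
    thus ?thesis using reg z(1) by (simp add: h_def)
  qed
qed

text \<open>According to the value at the centre, \<open>finite_type_of_small_center\<close> applies
  to \<open>f\<close> or to its reciprocal.\<close>

lemma spherical_dichotomy:
  assumes f: "bounded_spherical_deriv f L (ball z0 \<delta>)" and \<delta>: "5 * L * \<delta> < 1" "\<delta> > 0" "L \<ge> 0"
  shows   "finite_type f (ball z0 \<delta>) \<or> infinite_type f (ball z0 \<delta>)"
proof (cases "\<not>is_pole f z0 \<and> norm (f z0) \<le> 1")
  case True
  thus ?thesis using finite_type_of_small_center[OF f \<delta>] by blast
next
  case False
  have nice: "f nicely_meromorphic_on ball z0 \<delta>" using f by (simp add: bounded_spherical_deriv_def)
  have z0: "z0 \<in> ball z0 \<delta>" using \<delta> by simp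
  define h where "h = (\<lambda>z. inverse (f z))"
  have "\<not>is_pole h z0"
  proof
    assume "is_pole h z0"
    hence iz: "isolated_zero f z0" by (simp add: h_def is_pole_inverse_iff)
    hence "f z0 = 0" using nicely_meromorphic_on_subset[OF nice] z0
      by (intro zero_isolated_zero_nicely_meromorphic) auto
    moreover have "\<not>is_pole f z0" using iz unfolding isolated_zero_def is_pole_def
      by (metis at_neq_bot not_tendsto_and_filterlim_at_infinity)
    ultimately show False using False by simp
  qed
  moreover have "norm (h z0) \<le> 1"
  proof (cases "is_pole f z0")
    case True
    hence "f z0 = 0" using nice z0 by (intro is_pole_zero_at_nicely_mero)
    thus ?thesis by (simp add: h_def)
  next
    case False
    hence "norm (f z0) > 1" using \<open>\<not> (\<not> is_pole f z0 \<and> norm (f z0) \<le> 1)\<close> by simp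
    thus ?thesis by (simp add: h_def norm_inverse inverse_le_1_iff)
  qed
  ultimately have "finite_type h (ball z0 \<delta>)"
    using finite_type_of_small_center[OF _ \<delta>] bounded_spherical_deriv_inverse[OF f _ \<delta>(3)]
    by (simp add: h_def)
  \<comment> \<open>A regular zero of \<open>f\<close> where the reciprocal is holomorphic would
    force \<open>f\<close> to vanish on the whole ball, against the case assumption at the
    centre.\<close>
  moreover have "is_pole f z \<or> f z \<noteq> 0" if z: "z \<in> ball z0 \<delta>" for z
  proof (rule ccontr)
    assume *: "\<not>?thesis"
    hence an: "f analytic_on {z}" using nice z by (intro nicely_meromorphic_on_imp_analytic_at) auto
    have "h analytic_on {z}"
      using \<open>finite_type h (ball z0 \<delta>)\<close> z unfolding finite_type_def analytic_at by blast
    hence "\<not>is_pole h z" by (rule analytic_at_imp_no_pole)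
    hence "\<not>isolated_zero f z" by (simp add: h_def is_pole_inverse_iff)
    hence "eventually (\<lambda>w. f w = 0) (at z)"
      using * an by (intro non_isolated_zero_imp_eventually_zero) auto
    hence fr: "frequently (\<lambda>w. f w = 0) (at z)" by (intro eventually_frequently) auto
    have zero: "f w = 0" if "w \<in> ball z0 \<delta>" for w
      by (rule frequently_eq_meromorphic_imp_constant[OF fr nice]) (use z that in auto)
    have "eventually (\<lambda>w. w \<in> ball z0 \<delta>) (at z0)" using \<delta> by (intro eventually_at_in_open') auto
    hence "eventually (\<lambda>w. f w = 0) (at z0)" by eventually_elim (rule zero)
    have "\<not>is_pole f z0"
    proof
      assume "is_pole f z0"
      hence "eventually (\<lambda>w. f w \<noteq> 0) (at z0)" by (rule non_zero_neighbour_pole)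
      with \<open>eventually (\<lambda>w. f w = 0) (at z0)\<close> have "eventually (\<lambda>w. False) (at z0)"
        by eventually_elim auto
      thus False by simp
    qed
    thus False using False zero[OF z0] by simp
  qed
  ultimately show ?thesis by (simp add: finite_type_def infinite_type_def h_def)
qed

lemma finite_type_subset: "finite_type f B \<Longrightarrow> C \<subseteq> B \<Longrightarrow> finite_type f C"
  unfolding finite_type_def using holomorphic_on_subset by blast

lemma infinite_type_subset: "infinite_type f B \<Longrightarrow> C \<subseteq> B \<Longrightarrow> infinite_type f C"
  unfolding infinite_type_def using holomorphic_on_subset by blast

section \<open>Local uniform limits of either type, and diagonal subsequences\<close>

definition fin_limit :: "(nat \<Rightarrow> complex \<Rightarrow> complex) \<Rightarrow> (complex \<Rightarrow> complex) \<Rightarrow> complex set \<Rightarrow> bool" where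
  "fin_limit F g B \<longleftrightarrow> finite_type g B \<and> (\<forall>\<^sub>F j in sequentially. finite_type (F j) B) \<and>
     uniform_limit B F g sequentially"

text \<open>Here \<open>q\<close> is the limit of the reciprocals, so the sequence itself tends to
  1/q; identically vanishing \<open>q\<close> means divergence to infinity.\<close>

definition inf_limit :: "(nat \<Rightarrow> complex \<Rightarrow> complex) \<Rightarrow> (complex \<Rightarrow> complex) \<Rightarrow> complex set \<Rightarrow> bool" where
  "inf_limit F q B \<longleftrightarrow> finite_type q B \<and> (\<forall>\<^sub>F j in sequentially. infinite_type (F j) B) \<and>
     uniform_limit B (\<lambda>j z. inverse (F j z)) q sequentially"

lemma fin_limit_subset: "fin_limit F g B \<Longrightarrow> C \<subseteq> B \<Longrightarrow> fin_limit F g C"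
  unfolding fin_limit_def
  by (auto intro: finite_type_subset uniform_limit_on_subset elim!: eventually_mono)

lemma inf_limit_subset: "inf_limit F q B \<Longrightarrow> C \<subseteq> B \<Longrightarrow> inf_limit F q C"
  unfolding inf_limit_def
  by (auto intro: finite_type_subset infinite_type_subset uniform_limit_on_subset elim!: eventually_mono)

text \<open>The hypothesis on \<open>k1\<close> and \<open>k2\<close> is the form in which
  \<open>subsequence_diagonalization_lemma\<close> asks for stability: from some index on,
  \<open>k2\<close> picks later terms of \<open>k1\<close>.\<close>

lemma eventually_reindex:
  assumes "eventually (\<lambda>j. Q (k1 j)) sequentially" and "\<And>j. N \<le> j \<Longrightarrow> \<exists>j'. j \<le> j' \<and> k2 j = k1 j'"
  shows   "eventually (\<lambda>j. Q (k2 j)) (sequentially :: nat filter)"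
proof -
  obtain M where M: "\<And>j. j \<ge> M \<Longrightarrow> Q (k1 j)" using assms(1) by (auto simp: eventually_sequentially)
  have "Q (k2 j)" if "j \<ge> max M N" for j
    using assms(2)[of j] that M by (metis max.bounded_iff order_trans)
  thus ?thesis unfolding eventually_sequentially by blast
qed

lemma fin_limit_reindex:
  assumes "fin_limit (\<lambda>j. F (k1 j)) g B" "\<And>j. N \<le> j \<Longrightarrow> \<exists>j'. j \<le> j' \<and> k2 j = k1 j'"
  shows   "fin_limit (\<lambda>j. F (k2 j)) g B"
proof -
  have re: "eventually (\<lambda>j. Q (k1 j)) sequentially \<Longrightarrow> eventually (\<lambda>j. Q (k2 j)) sequentially" for Q
    using eventually_reindex[of Q k1 N k2] assms(2) by blast
  show ?thesis
    using assms(1) re[of "\<lambda>i. finite_type (F i) B"] re[of "\<lambda>i. \<forall>x\<in>B. dist (F i x) (g x) < e" for e]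
    unfolding fin_limit_def uniform_limit_iff by blast
qed

lemma inf_limit_reindex:
  assumes "inf_limit (\<lambda>j. F (k1 j)) g B" "\<And>j. N \<le> j \<Longrightarrow> \<exists>j'. j \<le> j' \<and> k2 j = k1 j'"
  shows   "inf_limit (\<lambda>j. F (k2 j)) g B"
proof -
  have re: "eventually (\<lambda>j. Q (k1 j)) sequentially \<Longrightarrow> eventually (\<lambda>j. Q (k2 j)) sequentially" for Q
    using eventually_reindex[of Q k1 N k2] assms(2) by blast
  show ?thesis
    using assms(1) re[of "\<lambda>i. infinite_type (F i) B"] re[of "\<lambda>i. \<forall>x\<in>B. dist (inverse (F i x)) (g x) < e" for e]
    unfolding inf_limit_def uniform_limit_iff by blast
qed

lemma limit_cong_eventually:
  assumes ev: "eventually (\<lambda>j. G j = F j) sequentially"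
  shows   "fin_limit G h B \<Longrightarrow> fin_limit F h B" "inf_limit G h B \<Longrightarrow> inf_limit F h B"
proof -
  have *: "eventually (\<lambda>j. Q (F j)) sequentially" if "eventually (\<lambda>j. Q (G j)) sequentially" for Q
    using ev that by eventually_elim simp
  show "fin_limit G h B \<Longrightarrow> fin_limit F h B"
    unfolding fin_limit_def uniform_limit_iff
    using *[of "\<lambda>f. finite_type f B"] *[of "\<lambda>f. \<forall>x\<in>B. dist (f x) (h x) < e" for e] by blast
  show "inf_limit G h B \<Longrightarrow> inf_limit F h B"
    unfolding inf_limit_def uniform_limit_iff
    using *[of "\<lambda>f. infinite_type f B"] *[of "\<lambda>f. \<forall>x\<in>B. dist (inverse (f x)) (h x) < e" for e] by blast
qed

text \<open>Montel's theorem gives locally uniform convergence on the ball of radius 2 \<delta>; the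
  closed ball of radius \<delta> is compact in it, so convergence is uniform on the smaller
  ball.\<close>

lemma finite_type_subsequence:
  assumes F: "\<And>j. finite_type (F j) (ball z (2 * \<delta>))" and \<delta>: "\<delta> > 0"
  obtains h k where "strict_mono (k :: nat \<Rightarrow> nat)" "finite_type h (ball z \<delta>)"
    "uniform_limit (ball z \<delta>) (\<lambda>j. F (k j)) h sequentially"
proof -
  define \<H> where "\<H> = {f. finite_type f (ball z (2 * \<delta>))}"
  obtain h k where h: "h holomorphic_on ball z (2 * \<delta>)" "strict_mono (k :: nat \<Rightarrow> nat)"
          "\<And>x. x \<in> ball z (2 * \<delta>) \<Longrightarrow> ((\<lambda>n. F (k n) x) \<longlongrightarrow> h x) sequentially"
          "\<And>K. \<lbrakk>compact K; K \<subseteq> ball z (2 * \<delta>)\<rbrakk> \<Longrightarrow> uniform_limit K (F \<circ> k) h sequentially"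
  proof (rule Montel[of "ball z (2 * \<delta>)" \<H> F])
    show "\<exists>B. \<forall>h\<in>\<H>. \<forall>z\<in>K. norm (h z) \<le> B" if "K \<subseteq> ball z (2 * \<delta>)" for K
      using that by (intro exI[of _ 2]) (auto simp: \<H>_def finite_type_def)
  qed (use F in \<open>auto simp: \<H>_def finite_type_def\<close>)
  have sub: "ball z \<delta> \<subseteq> ball z (2 * \<delta>)" "cball z \<delta> \<subseteq> ball z (2 * \<delta>)" using \<delta> by auto
  show ?thesis
  proof (rule that[OF h(2)])
    have "norm (h x) \<le> 2" if "x \<in> ball z (2 * \<delta>)" for x
    proof (rule LIMSEQ_le_const2)
      show "(\<lambda>n. norm (F (k n) x)) \<longlonglongrightarrow> norm (h x)" using h(3)[OF that] by (rule tendsto_norm)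
    qed (use F that in \<open>auto simp: finite_type_def\<close>)
    thus "finite_type h (ball z \<delta>)"
      using h(1) sub(1) by (auto simp: finite_type_def intro: holomorphic_on_subset)
    have "uniform_limit (cball z \<delta>) (F \<circ> k) h sequentially" by (rule h(4)) (use sub in auto)
    hence "uniform_limit (ball z \<delta>) (F \<circ> k) h sequentially" by (rule uniform_limit_on_subset) auto
    thus "uniform_limit (ball z \<delta>) (\<lambda>j. F (k j)) h sequentially" by (simp add: o_def)
  qed
qed

text \<open>If almost all functions are of infinite type, Montel's theorem is applied to the
  reciprocals of a tail; otherwise infinitely many are of finite type and give the
  subsequence.\<close>

lemma spherical_subsequence:
  assumes F: "\<And>j. bounded_spherical_deriv (F j) L (ball z (2 * \<delta>))"
    and \<delta>: "5 * L * (2 * \<delta>) < 1" "\<delta> > 0" "L \<ge> 0"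
  shows "\<exists>k. strict_mono (k :: nat \<Rightarrow> nat) \<and>
           ((\<exists>h. fin_limit (\<lambda>j. F (k j)) h (ball z \<delta>)) \<or> (\<exists>q. inf_limit (\<lambda>j. F (k j)) q (ball z \<delta>)))"
proof -
  have sub: "ball z \<delta> \<subseteq> ball z (2 * \<delta>)" using \<delta> by auto
  have dich: "finite_type (F j) (ball z (2 * \<delta>)) \<or> infinite_type (F j) (ball z (2 * \<delta>))" for j
    using spherical_dichotomy[OF F \<delta>(1) _ \<delta>(3)] \<delta>(2) by auto
  show ?thesis
  proof (cases "eventually (\<lambda>j. infinite_type (F j) (ball z (2 * \<delta>))) sequentially")
    case True
    then obtain N where N: "\<And>j. j \<ge> N \<Longrightarrow> infinite_type (F j) (ball z (2 * \<delta>))"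
      by (auto simp: eventually_sequentially)
    have "finite_type (\<lambda>w. inverse (F (j + N) w)) (ball z (2 * \<delta>))" for j
      using N[of "j + N"] by (auto simp: infinite_type_def finite_type_def)
    then obtain h k where hk: "strict_mono (k :: nat \<Rightarrow> nat)" "finite_type h (ball z \<delta>)"
      "uniform_limit (ball z \<delta>) (\<lambda>j. (\<lambda>w. inverse (F (k j + N) w))) h sequentially"
      using finite_type_subsequence[of "\<lambda>j w. inverse (F (j + N) w)" z \<delta>] \<delta>(2) by blast
    have "inf_limit (\<lambda>j. F (k j + N)) h (ball z \<delta>)"
      unfolding inf_limit_def using hk(2,3) N infinite_type_subset[OF _ sub]
      by (auto intro!: always_eventually)
    moreover have "strict_mono (\<lambda>j. k j + N)" using hk(1) by (simp add: strict_mono_def)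
    ultimately show ?thesis by blast
  next
    case False
    then obtain s where s: "strict_mono (s :: nat \<Rightarrow> nat)" "\<And>j. \<not>infinite_type (F (s j)) (ball z (2 * \<delta>))"
      using not_eventually_sequentiallyD by blast
    hence fin: "finite_type (F (s j)) (ball z (2 * \<delta>))" for j using dich by blast
    then obtain h k where hk: "strict_mono (k :: nat \<Rightarrow> nat)" "finite_type h (ball z \<delta>)"
      "uniform_limit (ball z \<delta>) (\<lambda>j. F (s (k j))) h sequentially"
      using finite_type_subsequence[of "\<lambda>j. F (s j)" z \<delta>] \<delta>(2) by blast
    have "fin_limit (\<lambda>j. F (s (k j))) h (ball z \<delta>)"
      unfolding fin_limit_def using hk(2,3) fin finite_type_subset[OF _ sub]
      by (auto intro!: always_eventually)
    moreover have "strict_mono (\<lambda>j. s (k j))" using s(1) hk(1) by (simp add: strict_mono_def)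
    ultimately show ?thesis by blast
  qed
qed

text \<open>The bound is asked only eventually, because rescaled functions are controlled on discs
  that grow with the index.\<close>

definition locally_spherically_bounded :: "(nat \<Rightarrow> complex \<Rightarrow> complex) \<Rightarrow> complex set \<Rightarrow> bool" where
  "locally_spherically_bounded F D \<longleftrightarrow> (\<forall>z\<in>D. \<exists>\<delta>>0. \<exists>L. ball z \<delta> \<subseteq> D \<and>
     (\<forall>\<^sub>F j in sequentially. bounded_spherical_deriv (F j) L (ball z \<delta>)))"

lemma bounded_spherical_deriv_mono:
  assumes "bounded_spherical_deriv f L B" "L \<le> L'" "B' \<subseteq> B"
  shows   "bounded_spherical_deriv f L' B'"
proof -
  have "L * (1 + (norm (f z))\<^sup>2) \<le> L' * (1 + (norm (f z))\<^sup>2)" for z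
    using assms(2) by (intro mult_right_mono) auto
  thus ?thesis
    using assms nicely_meromorphic_on_subset order_trans unfolding bounded_spherical_deriv_def by (metis subsetD)
qed

lemma spherical_diagonal_subsequence:
  assumes D: "D \<noteq> {}" and F: "locally_spherically_bounded F D"
  obtains k B where "strict_mono (k :: nat \<Rightarrow> nat)" "(\<Union>i::nat. B i) = D"
    "\<And>i. \<exists>c r. r > 0 \<and> B i = ball c r"
    "\<And>i. (\<exists>h. fin_limit (\<lambda>j. F (k j)) h (B i)) \<or> (\<exists>q. inf_limit (\<lambda>j. F (k j)) q (B i))"
proof -
  have "\<exists>\<delta> L. \<delta> > 0 \<and> L \<ge> 0 \<and> 5 * L * (2 * \<delta>) < 1 \<and> ball z (2 * \<delta>) \<subseteq> D \<and>
     (\<forall>\<^sub>F j in sequentially. bounded_spherical_deriv (F j) L (ball z (2 * \<delta>)))" if z: "z \<in> D" for z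
  proof -
    obtain \<delta> L where *: "\<delta> > 0" "ball z \<delta> \<subseteq> D" "\<forall>\<^sub>F j in sequentially. bounded_spherical_deriv (F j) L (ball z \<delta>)"
      using F z unfolding locally_spherically_bounded_def by blast
    define L' where "L' = max L 0"
    \<comment> \<open>This keeps 10 L' \<delta>' below 1/2, hence below the bound 1 that the
      dichotomy demands.\<close>
    define \<delta>' where "\<delta>' = min (\<delta> / 2) (1 / (20 * (L' + 1)))"
    have L': "L' \<ge> 0" "L \<le> L'" by (auto simp: L'_def)
    hence \<delta>': "\<delta>' > 0" "2 * \<delta>' \<le> \<delta>" using *(1) by (auto simp: \<delta>'_def)
    have "\<delta>' \<le> 1 / (20 * (L' + 1))" by (simp add: \<delta>'_def)
    hence "10 * L' * \<delta>' \<le> 10 * L' * (1 / (20 * (L' + 1)))" using L' by (intro mult_left_mono) auto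
    hence "5 * L' * (2 * \<delta>') \<le> 10 * L' * (1 / (20 * (L' + 1)))" by simp
    also have "\<dots> < 1" using L' by (simp add: field_simps)
    finally have "5 * L' * (2 * \<delta>') < 1" .
    moreover have sub: "ball z (2 * \<delta>') \<subseteq> ball z \<delta>" using \<delta>' by auto
    moreover have "\<forall>\<^sub>F j in sequentially. bounded_spherical_deriv (F j) L' (ball z (2 * \<delta>'))"
      using *(3) by eventually_elim (rule bounded_spherical_deriv_mono[OF _ L'(2) sub])
    ultimately show ?thesis using \<delta>'(1) L'(1) *(2) by (intro exI[of _ \<delta>'] exI[of _ L']) auto
  qed
  then obtain \<delta> L where \<delta>L: "\<And>z. z \<in> D \<Longrightarrow> \<delta> z > 0" "\<And>z. z \<in> D \<Longrightarrow> L z \<ge> 0"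
     "\<And>z. z \<in> D \<Longrightarrow> 5 * L z * (2 * \<delta> z) < 1" "\<And>z. z \<in> D \<Longrightarrow> ball z (2 * \<delta> z) \<subseteq> D"
     "\<And>z. z \<in> D \<Longrightarrow> (\<forall>\<^sub>F j in sequentially. bounded_spherical_deriv (F j) (L z) (ball z (2 * \<delta> z)))"
    by metis
  obtain C where C: "countable C" "C \<subseteq> D" "D \<subseteq> (\<Union>z\<in>C. ball z (\<delta> z))"
  proof -
    obtain \<F>' where F': "\<F>' \<subseteq> (\<lambda>z. ball z (\<delta> z)) ` D" "countable \<F>'" "\<Union>\<F>' = \<Union>((\<lambda>z. ball z (\<delta> z)) ` D)"
      using Lindelof[of "(\<lambda>z. ball z (\<delta> z)) ` D"] by auto
    obtain C where C: "countable C" "C \<subseteq> D" "\<F>' = (\<lambda>z. ball z (\<delta> z)) ` C"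
      using countable_subset_image[of \<F>' "\<lambda>z. ball z (\<delta> z)" D] F' by auto
    have "D \<subseteq> (\<Union>z\<in>D. ball z (\<delta> z))" using \<delta>L(1) by force
    thus ?thesis using that[of C] C F'(3) by auto
  qed
  have "C \<noteq> {}" using C D by auto
  define c where "c = from_nat_into C"
  have c: "c i \<in> D" "range c = C" for i
    using C \<open>C \<noteq> {}\<close> from_nat_into[of C i] by (auto simp: c_def range_from_nat_into)
  \<comment> \<open>Finitely many members may violate the bound on the ball around
    \<open>c i\<close>. They are replaced by 0, which satisfies it, and limits are not
    affected.\<close>
  define G where "G = (\<lambda>i j. if bounded_spherical_deriv (F j) (L (c i)) (ball (c i) (2 * \<delta> (c i))) then F j else (\<lambda>_. 0))"
  have G: "bounded_spherical_deriv (G i j) (L (c i)) (ball (c i) (2 * \<delta> (c i)))" for i j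
    using \<delta>L(2)[OF c(1)] by (auto simp: G_def bounded_spherical_deriv_def)
  define B where "B = (\<lambda>i. ball (c i) (\<delta> (c i)))"
  define P where "P = (\<lambda>i r. (\<exists>h. fin_limit (\<lambda>j. G i (r j)) h (B i)) \<or> (\<exists>q. inf_limit (\<lambda>j. G i (r j)) q (B i)))"
  obtain k where k: "strict_mono (k :: nat \<Rightarrow> nat)" "\<And>i. P i (id \<circ> k)"
  proof (rule subsequence_diagonalization_lemma[of P id])
    show "\<exists>k. strict_mono (k :: nat \<Rightarrow> nat) \<and> P i (r \<circ> k)" for i and r :: "nat \<Rightarrow> nat"
      using spherical_subsequence[of "\<lambda>j. G i (r j)" "L (c i)" "c i" "\<delta> (c i)"] G \<delta>L(1,2,3)[OF c(1)]
      unfolding P_def B_def o_def by blast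
    show "P i (r \<circ> k2)" if "P i (r \<circ> k1)" "\<And>j. N \<le> j \<Longrightarrow> \<exists>j'. j \<le> j' \<and> k2 j = k1 j'"
      for i and r k1 k2 :: "nat \<Rightarrow> nat" and N
      using that(1) fin_limit_reindex[of "\<lambda>j. G i (r j)" k1 _ "B i" N k2, OF _ that(2)]
            inf_limit_reindex[of "\<lambda>j. G i (r j)" k1 _ "B i" N k2, OF _ that(2)]
      unfolding P_def o_def by blast
  qed (rule that)
  show ?thesis
  proof (rule that[OF k(1)])
    show "(\<Union>i. B i) = D"
    proof
      show "(\<Union>i. B i) \<subseteq> D"
      proof
        fix z assume "z \<in> (\<Union>i. B i)"
        then obtain i where i: "z \<in> ball (c i) (\<delta> (c i))" by (auto simp: B_def)
        moreover have "\<delta> (c i) > 0" using \<delta>L(1) c(1) by blast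
        ultimately have "z \<in> ball (c i) (2 * \<delta> (c i))" by auto
        thus "z \<in> D" using \<delta>L(4)[OF c(1)] by blast
      qed
      show "D \<subseteq> (\<Union>i. B i)" using C(3) unfolding B_def c(2)[symmetric] by auto
    qed
    show "\<exists>z r. r > 0 \<and> B i = ball z r" for i
      using \<delta>L(1)[OF c(1)] by (auto simp: B_def)
    fix i
    have "\<forall>\<^sub>F j in sequentially. bounded_spherical_deriv (F (k j)) (L (c i)) (ball (c i) (2 * \<delta> (c i)))"
      using \<delta>L(5)[OF c(1)] k(1) by (rule eventually_subseq[rotated])
    hence ev: "\<forall>\<^sub>F j in sequentially. G i (k j) = F (k j)" by eventually_elim (simp add: G_def)
    show "(\<exists>h. fin_limit (\<lambda>j. F (k j)) h (B i)) \<or> (\<exists>q. inf_limit (\<lambda>j. F (k j)) q (B i))"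
      using k(2)[of i] limit_cong_eventually[OF ev] unfolding P_def id_o by blast
  qed
qed

section \<open>Gluing local limits\<close>

lemma nicely_meromorphic_on_cong_open:
  assumes "f nicely_meromorphic_on B" "open B" "\<And>z. z \<in> B \<Longrightarrow> f z = g z"
  shows   "g nicely_meromorphic_on B"
proof -
  have ev: "eventually (\<lambda>w. f w = g w) (at z)" if "z \<in> B" for z
    using eventually_at_in_open'[OF assms(2) that] by eventually_elim (rule assms(3))
  have "g meromorphic_on B"
    using assms(1) meromorphic_on_cong[OF ev refl] unfolding nicely_meromorphic_on_def by blast
  moreover have "(is_pole g z \<and> g z = 0) \<or> g \<midarrow>z\<rightarrow> g z" if z: "z \<in> B" for z
  proof -
    have "(is_pole f z \<and> f z = 0) \<or> f \<midarrow>z\<rightarrow> f z" using assms(1) z by (auto simp: nicely_meromorphic_on_def)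
    thus ?thesis
      using is_pole_cong[OF ev[OF z] refl] filterlim_cong[OF refl refl ev[OF z], of "nhds (g z)"] assms(3)[OF z] by simp
  qed
  ultimately show ?thesis by (simp add: nicely_meromorphic_on_def)
qed

lemma nicely_meromorphic_on_UN:
  assumes "\<And>i. f nicely_meromorphic_on (B i)"
  shows   "f nicely_meromorphic_on (\<Union>i. B i)"
proof -
  have "f meromorphic_on (\<Union>i. B i)"
    using assms by (intro meromorphic_on_UN) (simp add: nicely_meromorphic_on_def)
  thus ?thesis using assms unfolding nicely_meromorphic_on_def by blast
qed

lemma fin_limit_pointwise: "fin_limit F h B \<Longrightarrow> z \<in> B \<Longrightarrow> (\<lambda>j. F j z) \<longlonglongrightarrow> h z"
  unfolding fin_limit_def by (elim conjE) (rule tendsto_uniform_limitI)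

lemma inf_limit_pointwise: "inf_limit F q B \<Longrightarrow> z \<in> B \<Longrightarrow> (\<lambda>j. inverse (F j z)) \<longlonglongrightarrow> q z"
  unfolding inf_limit_def by (elim conjE) (rule tendsto_uniform_limitI)

text \<open>A function of infinite type has no regular zero, so on the overlap the product of
  \<open>F j\<close> with its reciprocal is eventually exactly 1 despite the convention
  \<open>inverse 0 = 0\<close>.\<close>

lemma fin_limit_inf_limit:
  assumes h: "fin_limit F h B" and q: "inf_limit F q B'" and z: "z \<in> B" "z \<in> B'" and B: "open B"
  shows   "h z * q z = 1"
proof -
  have "(\<lambda>j. F j z * inverse (F j z)) \<longlonglongrightarrow> h z * q z"
    using fin_limit_pointwise[OF h z(1)] inf_limit_pointwise[OF q z(2)] by (rule tendsto_mult)
  moreover have "eventually (\<lambda>j. F j z * inverse (F j z) = 1) sequentially"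
  proof -
    have "eventually (\<lambda>j. finite_type (F j) B) sequentially" "eventually (\<lambda>j. infinite_type (F j) B') sequentially"
      using h q by (auto simp: fin_limit_def inf_limit_def)
    thus ?thesis
    proof eventually_elim
      case (elim j)
      have "F j analytic_on {z}" using elim(1) B z(1) unfolding finite_type_def analytic_at by blast
      hence "\<not>is_pole (F j) z" by (rule analytic_at_imp_no_pole)
      hence "F j z \<noteq> 0" using elim(2) z(2) by (auto simp: infinite_type_def)
      thus ?case by simp
    qed
  qed
  hence "(\<lambda>j. F j z * inverse (F j z)) \<longlonglongrightarrow> 1" by (rule tendsto_eventually)
  ultimately show ?thesis by (rule LIMSEQ_unique)
qed

lemma fin_limit_cong:
  assumes "fin_limit F h B" "\<And>z. z \<in> B \<Longrightarrow> h z = h' z"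
  shows   "fin_limit F h' B"
proof -
  have "finite_type h' B"
    using assms holomorphic_cong[OF refl, of B h h'] by (auto simp: fin_limit_def finite_type_def)
  moreover have "uniform_limit B F h' sequentially"
    using assms unfolding fin_limit_def uniform_limit_iff by (auto elim!: eventually_mono)
  ultimately show ?thesis using assms(1) by (simp add: fin_limit_def)
qed

lemma inf_limit_cong:
  assumes "inf_limit F q B" "\<And>z. z \<in> B \<Longrightarrow> q z = q' z"
  shows   "inf_limit F q' B"
proof -
  have "finite_type q' B"
    using assms holomorphic_cong[OF refl, of B q q'] by (auto simp: inf_limit_def finite_type_def)
  moreover have "uniform_limit B (\<lambda>j z. inverse (F j z)) q' sequentially"
    using assms unfolding inf_limit_def uniform_limit_iff by (auto elim!: eventually_mono)
  ultimately show ?thesis using assms(1) by (simp add: inf_limit_def)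
qed

definition spherical_limit :: "(nat \<Rightarrow> complex \<Rightarrow> complex) \<Rightarrow> (complex \<Rightarrow> complex) \<Rightarrow> complex set \<Rightarrow> bool" where
  "spherical_limit F g D \<longleftrightarrow> g nicely_meromorphic_on D \<and> (\<forall>z\<in>D. \<exists>\<rho>>0. ball z \<rho> \<subseteq> D \<and>
     (fin_limit F g (ball z \<rho>) \<or>
      infinite_type g (ball z \<rho>) \<and> inf_limit F (\<lambda>z. inverse (g z)) (ball z \<rho>)))"

definition diverges_spherically :: "(nat \<Rightarrow> complex \<Rightarrow> complex) \<Rightarrow> complex set \<Rightarrow> bool" where
  "diverges_spherically F D \<longleftrightarrow> (\<forall>z\<in>D. \<exists>\<rho>>0. ball z \<rho> \<subseteq> D \<and> inf_limit F (\<lambda>_. 0) (ball z \<rho>))"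

text \<open>On each ball of a countable cover the limit is of finite or infinite type. Balls where
  the reciprocals tend to 0 identically cannot meet the others, by the identity theorem, so
  connectedness leaves divergence everywhere or on no ball. In the second case the local limits
  agree on overlaps and glue to a meromorphic function.\<close>

theorem Marty_compactness:
  assumes D: "D \<noteq> {}" "connected D" and F: "locally_spherically_bounded F D"
  obtains k where "strict_mono (k :: nat \<Rightarrow> nat)"
    "(\<exists>g. spherical_limit (\<lambda>j. F (k j)) g D) \<or> diverges_spherically (\<lambda>j. F (k j)) D"
proof -
  obtain k B where k: "strict_mono (k :: nat \<Rightarrow> nat)" and UB: "(\<Union>i::nat. B i) = D"
    and ball: "\<And>i. \<exists>c r. r > 0 \<and> B i = ball c r"
    and lim: "\<And>i. (\<exists>h. fin_limit (\<lambda>j. F (k j)) h (B i)) \<or> (\<exists>q. inf_limit (\<lambda>j. F (k j)) q (B i))"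
    by (rule spherical_diagonal_subsequence[OF D(1) F]) (rule that)
  define G where "G = (\<lambda>j. F (k j))"
  note lim = lim[folded G_def]
  have B: "open (B i)" "connected (B i)" "B i \<noteq> {}" for i
  proof -
    obtain c r where "r > 0" "B i = ball c r" using ball[of i] by blast
    thus "open (B i)" "connected (B i)" "B i \<noteq> {}" by simp_all
  qed
  have inner: "\<exists>\<rho>>0. ball z \<rho> \<subseteq> B i" if "z \<in> B i" for z i
    using B(1)[of i] that by (meson openE)
  define Z where "Z = {i. inf_limit G (\<lambda>_. 0) (B i)}"
  have disj: "B i \<inter> B l = {}" if i: "i \<in> Z" and l: "l \<notin> Z" for i l
  proof (rule ccontr)
    assume "B i \<inter> B l \<noteq> {}"
    then obtain z where z: "z \<in> B i" "z \<in> B l" by blast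
    have i': "inf_limit G (\<lambda>_. 0) (B i)" using i by (simp add: Z_def)
    from lim[of l] show False
    proof (elim disjE exE)
      fix h assume "fin_limit G h (B l)"
      from fin_limit_inf_limit[OF this i' z(2,1) B(1)] show False by simp
    next
      fix q assume q: "inf_limit G q (B l)"
      have "q w = 0" if "w \<in> B i \<inter> B l" for w
        using inf_limit_pointwise[OF i', of w] inf_limit_pointwise[OF q, of w] that LIMSEQ_unique by blast
      hence "q w = 0" if "w \<in> B l" for w
        using analytic_continuation_open[of "B i \<inter> B l" "B l" q "\<lambda>_. 0" w] B q z that
        by (auto simp: inf_limit_def finite_type_def)
      hence "inf_limit G (\<lambda>_. 0) (B l)" by (intro inf_limit_cong[OF q])
      thus False using l by (simp add: Z_def)
    qed
  qed
  have "(\<Union>i\<in>Z. B i) = {} \<or> (\<Union>i\<in>-Z. B i) = {}"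
  proof (rule ccontr)
    assume *: "\<not>?thesis"
    have "open (\<Union>i\<in>Z. B i)" "open (\<Union>i\<in>-Z. B i)" using B by auto
    moreover have "D \<subseteq> (\<Union>i\<in>Z. B i) \<union> (\<Union>i\<in>-Z. B i)" using UB by blast
    moreover have "(\<Union>i\<in>Z. B i) \<inter> (\<Union>i\<in>-Z. B i) \<inter> D = {}" using disj by blast
    moreover have "(\<Union>i\<in>Z. B i) \<inter> D \<noteq> {}" "(\<Union>i\<in>-Z. B i) \<inter> D \<noteq> {}" using * UB by auto
    ultimately show False using D(2) unfolding connected_def by blast
  qed
  hence "-Z = {} \<or> Z = {}" using B(3) by blast
  thus ?thesis
  proof
    assume "-Z = {}"
    hence all: "inf_limit G (\<lambda>_. 0) (B i)" for i by (auto simp: Z_def)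
    have "diverges_spherically G D"
      unfolding diverges_spherically_def
    proof
      fix z assume "z \<in> D"
      then obtain i where "z \<in> B i" using UB by blast
      then obtain \<rho> where "\<rho> > 0" "ball z \<rho> \<subseteq> B i" using inner by blast
      thus "\<exists>\<rho>>0. ball z \<rho> \<subseteq> D \<and> inf_limit G (\<lambda>_. 0) (ball z \<rho>)"
        using inf_limit_subset[OF all] UB by blast
    qed
    thus ?thesis using that[OF k] by (simp add: G_def)
  next
    assume Z: "Z = {}"
    \<comment> \<open>The value is independent of the ball by \<open>fin_limit_inf_limit\<close>.
      Where the reciprocals tend to 0, the convention \<open>inverse 0 = 0\<close> yields the dummy
      value of a pole.\<close>
    define g where "g = (\<lambda>z. if \<exists>h i. fin_limit G h (B i) \<and> z \<in> B i then lim (\<lambda>j. G j z)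
                             else inverse (lim (\<lambda>j. inverse (G j z))))"
    have g_fin: "g z = h z" if "fin_limit G h (B i)" "z \<in> B i" for h i z
      using fin_limit_pointwise[OF that] that limI by (auto simp: g_def)
    have g_inf: "inverse (g z) = q z" if q: "inf_limit G q (B i)" "z \<in> B i" for q i z
    proof (cases "\<exists>h i. fin_limit G h (B i) \<and> z \<in> B i")
      case True
      then obtain h l where l: "fin_limit G h (B l)" "z \<in> B l" by blast
      have "h z * q z = 1" using fin_limit_inf_limit[OF l(1) q(1) l(2) q(2) B(1)] .
      thus ?thesis using g_fin[OF l] by (metis inverse_unique)
    next
      case False
      thus ?thesis using inf_limit_pointwise[OF q] limI by (auto simp: g_def)
    qed
    have inf_type: "infinite_type g (B i) \<and> g nicely_meromorphic_on (B i)" if q: "inf_limit G q (B i)" for q i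
    proof
      have q_hol: "q holomorphic_on B i" "\<And>z. z \<in> B i \<Longrightarrow> norm (q z) \<le> 2"
        using q by (auto simp: inf_limit_def finite_type_def)
      have q_an: "q analytic_on {z}" if "z \<in> B i" for z using q_hol B(1) that unfolding analytic_at by blast
      have g_eq: "g z = inverse (q z)" if "z \<in> B i" for z using g_inf[OF q that] by (metis inverse_inverse_eq)
      have "q nicely_meromorphic_on B i"
        using q_hol B(1) analytic_on_open by (intro analytic_on_imp_nicely_meromorphic_on) blast
      hence "(\<lambda>z. inverse (q z)) nicely_meromorphic_on B i" by (rule nicely_meromorphic_on_inverse)
      thus "g nicely_meromorphic_on B i"
        by (rule nicely_meromorphic_on_cong_open[OF _ B(1)]) (simp add: g_eq)
      show "infinite_type g (B i)"
        unfolding infinite_type_def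
      proof (intro conjI ballI)
        show "(\<lambda>z. inverse (g z)) holomorphic_on B i"
          using q_hol(1) holomorphic_cong[OF refl, of "B i" "\<lambda>z. inverse (g z)" q] g_inf[OF q] by auto
        fix z assume z: "z \<in> B i"
        show "norm (inverse (g z)) \<le> 2" using g_inf[OF q z] q_hol(2)[OF z] by simp
        show "is_pole g z \<or> g z \<noteq> 0"
        \<comment> \<open>With \<open>Z\<close> empty, \<open>q\<close> is not identically 0, so its
          zeros are isolated and become poles of \<open>g\<close>.\<close>
        proof (cases "q z = 0")
          case True
          have "isolated_zero q z"
          proof (rule ccontr)
            assume "\<not>isolated_zero q z"
            hence "eventually (\<lambda>w. q w = 0) (nhds z)"
              using q_an[OF z] True by (intro non_isolated_zero_imp_eventually_zero')
            then obtain U where U: "open U" "z \<in> U" "\<And>w. w \<in> U \<Longrightarrow> q w = 0" by (auto simp: eventually_nhds)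
            have "q w = 0" if "w \<in> B i" for w
              using analytic_continuation_open[of "U \<inter> B i" "B i" q "\<lambda>_. 0" w] B U q_hol(1) z that by auto
            hence "inf_limit G (\<lambda>_. 0) (B i)" by (intro inf_limit_cong[OF q])
            thus False using Z by (auto simp: Z_def)
          qed
          hence "is_pole (\<lambda>z. inverse (q z)) z" by (simp add: is_pole_inverse_iff)
          moreover have ev: "eventually (\<lambda>w. g w = inverse (q w)) (at z)"
            using eventually_at_in_open'[OF B(1) z] by eventually_elim (rule g_eq)
          ultimately show ?thesis using is_pole_cong[OF ev refl] by simp
        next
          case False
          thus ?thesis using g_eq[OF z] by simp
        qed
      qed
    qed
    have fin_lim: "fin_limit G g (B i)" if h: "fin_limit G h (B i)" for h i
      by (rule fin_limit_cong[OF h]) (simp add: g_fin[OF h])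
    have "g nicely_meromorphic_on B i" for i
      using lim[of i]
    proof (elim disjE exE)
      fix h assume "fin_limit G h (B i)"
      hence "g holomorphic_on B i" using fin_lim by (auto simp: fin_limit_def finite_type_def)
      thus ?thesis using B(1) analytic_on_open by (intro analytic_on_imp_nicely_meromorphic_on) blast
    next
      fix q assume "inf_limit G q (B i)"
      from inf_type[OF this] show ?thesis by blast
    qed
    hence "g nicely_meromorphic_on (\<Union>i. B i)" by (rule nicely_meromorphic_on_UN)
    moreover have "\<exists>\<rho>>0. ball z \<rho> \<subseteq> D \<and> (fin_limit G g (ball z \<rho>) \<or>
            infinite_type g (ball z \<rho>) \<and> inf_limit G (\<lambda>z. inverse (g z)) (ball z \<rho>))" if z: "z \<in> D" for z
    proof -
      obtain i where i: "z \<in> B i" using UB z by blast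
      then obtain \<rho> where \<rho>: "\<rho> > 0" "ball z \<rho> \<subseteq> B i" using inner by blast
      have "fin_limit G g (B i) \<or> infinite_type g (B i) \<and> inf_limit G (\<lambda>z. inverse (g z)) (B i)"
        using lim[of i]
      proof (elim disjE exE)
        fix q assume q: "inf_limit G q (B i)"
        have "inf_limit G (\<lambda>z. inverse (g z)) (B i)"
          by (rule inf_limit_cong[OF q]) (simp add: g_inf[OF q])
        thus ?thesis using inf_type[OF q] by blast
      next
        fix h assume "fin_limit G h (B i)"
        from fin_lim[OF this] show ?thesis ..
      qed
      hence "fin_limit G g (ball z \<rho>) \<or>
              infinite_type g (ball z \<rho>) \<and> inf_limit G (\<lambda>z. inverse (g z)) (ball z \<rho>)"
        using fin_limit_subset[OF _ \<rho>(2)] inf_limit_subset[OF _ \<rho>(2)] infinite_type_subset[OF _ \<rho>(2)] by metis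
      thus ?thesis using \<rho> UB by blast
    qed
    ultimately have "spherical_limit G g D" using UB by (auto simp: spherical_limit_def)
    thus ?thesis using that[OF k] by (auto simp: G_def)
  qed
qed

section \<open>Normality on the Riemann sphere\<close>

text \<open>The half turn of the sphere about the real axis, which corresponds to w \<mapsto> 1/w.
  Being an isometry, it transfers uniform convergence of reciprocals to the functions
  themselves.\<close>

definition sphere_flip :: "complex \<times> real \<Rightarrow> complex \<times> real" where
  "sphere_flip p = (cnj (fst p), - snd p)"

lemma dist_sphere_flip [simp]: "dist (sphere_flip p) (sphere_flip q) = dist p q"
proof -
  have "dist (cnj (fst p)) (cnj (fst q)) = dist (fst p) (fst q)"
    by (metis complex_cnj_diff complex_mod_cnj dist_norm)
  thus ?thesis by (simp add: sphere_flip_def dist_prod_def dist_real_def abs_minus_commute)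
qed

lemma sphere_of_complex_inverse:
  assumes "w \<noteq> 0"
  shows   "sphere_of_complex w = sphere_flip (sphere_of_complex (inverse w))"
proof -
  define s where "s = (norm w)\<^sup>2"
  have s: "s > 0" "s + 1 \<noteq> 0" "of_real s = w * cnj w"
    using assms complex_norm_square[of w] by (auto simp: s_def add_nonneg_eq_0_iff)
  have s1: "complex_of_real s + 1 \<noteq> 0" using s(2) by (metis of_real_1 of_real_add of_real_eq_0_iff)
  have n: "(norm (inverse w))\<^sup>2 = 1 / s" by (simp add: s_def norm_inverse inverse_eq_divide norm_divide power_divide)
  have "cnj (2 * inverse w / complex_of_real (1 / s + 1)) = 2 * w / complex_of_real (s + 1)"
    using assms s s1 by (simp add: field_simps)
  moreover have "- ((1 / s - 1) / (1 / s + 1)) = (s - 1) / (s + 1)"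
  proof -
    have "1 / s - 1 = (1 - s) / s" "1 / s + 1 = (s + 1) / s" using s(1) by (simp_all add: field_simps)
    hence "(1 / s - 1) / (1 / s + 1) = (1 - s) / (s + 1)" using s(1) by simp
    thus ?thesis by (simp add: minus_divide_left)
  qed
  ultimately show ?thesis
    unfolding sphere_of_complex_def sphere_flip_def n by (simp add: s_def)
qed

lemma sphere_infinity_eq: "sphere_infinity = sphere_flip (sphere_of_complex 0)"
  by (simp add: sphere_infinity_def sphere_flip_def sphere_of_complex_def)

lemma continuous_on_sphere_of_complex: "continuous_on A sphere_of_complex"
proof -
  have "(norm w)\<^sup>2 + 1 \<noteq> 0" for w :: complex by (metis add_nonneg_eq_0_iff zero_le_power2 zero_le_one zero_neq_one)
  hence "complex_of_real ((norm w)\<^sup>2 + 1) \<noteq> 0" "(norm w)\<^sup>2 + 1 \<noteq> 0" for w :: complex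
    by (metis of_real_eq_0_iff, metis)
  thus ?thesis unfolding sphere_of_complex_def [abs_def] by (intro continuous_intros) auto
qed

lemma sphere_value_finite_type:
  assumes "finite_type f B" "open B" "z \<in> B"
  shows   "sphere_value f z = sphere_of_complex (f z)"
proof -
  have "f analytic_on {z}" using assms unfolding finite_type_def analytic_at by blast
  hence "\<not>is_pole f z" by (rule analytic_at_imp_no_pole)
  thus ?thesis by (simp add: sphere_value_def)
qed

text \<open>At a pole the reciprocal is continuous with limit 0, hence has value 0, whose flip is
  the point at infinity.\<close>

lemma sphere_value_infinite_type:
  assumes "infinite_type f B" "open B" "z \<in> B"
  shows   "sphere_value f z = sphere_flip (sphere_of_complex (inverse (f z)))"
proof (cases "is_pole f z")
  case True
  have "(\<lambda>z. inverse (f z)) analytic_on {z}" using assms unfolding infinite_type_def analytic_at by blast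
  hence "isCont (\<lambda>z. inverse (f z)) z" by (rule analytic_at_imp_isCont)
  hence "(\<lambda>z. inverse (f z)) \<midarrow>z\<rightarrow> inverse (f z)" by (simp add: isCont_def)
  moreover have "(\<lambda>z. inverse (f z)) \<midarrow>z\<rightarrow> 0" using is_pole_tendsto[OF True] by (simp add: o_def)
  ultimately have "inverse (f z) = 0" by (intro LIM_unique)
  thus ?thesis using True by (simp add: sphere_value_def sphere_infinity_eq)
next
  case False
  hence "f z \<noteq> 0" using assms by (auto simp: infinite_type_def)
  hence "sphere_of_complex (f z) = sphere_flip (sphere_of_complex (inverse (f z)))"
    by (rule sphere_of_complex_inverse)
  thus ?thesis using False by (simp add: sphere_value_def)
qed

text \<open>Values of modulus at most 2 lie in a compact disc, on which
  \<open>sphere_of_complex\<close> is uniformly continuous.\<close>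

lemma uniform_limit_sphere_of_complex:
  assumes lim: "uniform_limit B F h sequentially"
    and F: "\<forall>\<^sub>F j in sequentially. \<forall>z\<in>B. norm (F j z) \<le> 2" and h: "\<And>z. z \<in> B \<Longrightarrow> norm (h z) \<le> 2"
  shows "uniform_limit B (\<lambda>j z. sphere_of_complex (F j z)) (\<lambda>z. sphere_of_complex (h z)) sequentially"
  unfolding uniform_limit_iff
proof safe
  fix e :: real assume e: "e > 0"
  have "uniformly_continuous_on (cball 0 2) sphere_of_complex"
    by (intro compact_uniformly_continuous continuous_on_sphere_of_complex) auto
  then obtain \<delta> where \<delta>: "\<delta> > 0" "\<And>w w'. w \<in> cball 0 2 \<Longrightarrow> w' \<in> cball 0 2 \<Longrightarrow> dist w' w < \<delta> \<Longrightarrow>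
      dist (sphere_of_complex w') (sphere_of_complex w) < e"
    using e unfolding uniformly_continuous_on_def by metis
  have "\<forall>\<^sub>F j in sequentially. \<forall>z\<in>B. dist (F j z) (h z) < \<delta>"
    using lim \<delta>(1) by (simp add: uniform_limit_iff)
  thus "\<forall>\<^sub>F j in sequentially. \<forall>z\<in>B. dist (sphere_of_complex (F j z)) (sphere_of_complex (h z)) < e"
    using F by eventually_elim (use \<delta>(2) h in auto)
qed

lemma uniform_limit_sphere_value_fin:
  assumes lim: "fin_limit F g B" and B: "open B"
  shows "uniform_limit B (\<lambda>j. sphere_value (F j)) (sphere_value g) sequentially"
proof -
  have g: "finite_type g B" and F: "\<forall>\<^sub>F j in sequentially. finite_type (F j) B"
    using lim by (auto simp: fin_limit_def)
  have "uniform_limit B (\<lambda>j z. sphere_of_complex (F j z)) (\<lambda>z. sphere_of_complex (g z)) sequentially"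
    using lim unfolding fin_limit_def
    by (intro uniform_limit_sphere_of_complex) (auto simp: finite_type_def elim: eventually_mono)
  moreover have "\<forall>\<^sub>F j in sequentially. \<forall>z\<in>B. sphere_of_complex (F j z) = sphere_value (F j) z"
    using F by eventually_elim (use sphere_value_finite_type[OF _ B] in auto)
  ultimately show ?thesis
    using sphere_value_finite_type[OF g B] by (subst (asm) uniform_limit_cong) auto
qed

lemma uniform_limit_sphere_value_inf:
  assumes lim: "inf_limit F q B" and B: "open B"
  shows "uniform_limit B (\<lambda>j. sphere_value (F j)) (\<lambda>z. sphere_flip (sphere_of_complex (q z))) sequentially"
proof -
  have F: "\<forall>\<^sub>F j in sequentially. infinite_type (F j) B" using lim by (auto simp: inf_limit_def)
  have "uniform_limit B (\<lambda>j z. sphere_of_complex (inverse (F j z))) (\<lambda>z. sphere_of_complex (q z)) sequentially"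
    using lim unfolding inf_limit_def
    by (intro uniform_limit_sphere_of_complex) (auto simp: finite_type_def infinite_type_def elim: eventually_mono)
  hence "uniform_limit B (\<lambda>j z. sphere_flip (sphere_of_complex (inverse (F j z))))
           (\<lambda>z. sphere_flip (sphere_of_complex (q z))) sequentially"
    by (simp add: uniform_limit_iff)
  moreover have "\<forall>\<^sub>F j in sequentially. \<forall>z\<in>B. sphere_flip (sphere_of_complex (inverse (F j z))) = sphere_value (F j) z"
    using F by eventually_elim (use sphere_value_infinite_type[OF _ B] in auto)
  ultimately show ?thesis by (subst (asm) uniform_limit_cong) auto
qed

lemma uniform_limit_compact_of_local:
  assumes "\<And>z. z \<in> D \<Longrightarrow> \<exists>\<rho>>0. uniform_limit (ball z \<rho>) F h sequentially" and K: "compact K" "K \<subseteq> D"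
  shows   "uniform_limit K F h sequentially"
proof -
  obtain \<rho> where \<rho>: "\<And>z. z \<in> D \<Longrightarrow> \<rho> z > 0" "\<And>z. z \<in> D \<Longrightarrow> uniform_limit (ball z (\<rho> z)) F h sequentially"
    using assms(1) by metis
  obtain C where C: "C \<subseteq> K" "finite C" "K \<subseteq> (\<Union>z\<in>C. ball z (\<rho> z))"
  proof (rule compactE_image[OF K(1), of K "\<lambda>z. ball z (\<rho> z)"])
    show "K \<subseteq> (\<Union>z\<in>K. ball z (\<rho> z))" using \<rho>(1) K(2) by force
  qed auto
  have "uniform_limit (\<Union>z\<in>C. ball z (\<rho> z)) F h sequentially"
    using C(2) by (rule uniform_limit_on_UNION) (use \<rho>(2) C(1) K(2) in auto)
  thus ?thesis using C(3) by (rule uniform_limit_on_subset)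
qed

text \<open>Marty's criterion. The bound is common to the family, so every sequence satisfies the
  hypothesis of \<open>Marty_compactness\<close>; a finite cover turns its local limits into uniform
  convergence on compact sets.\<close>

lemma normal_familyI:
  assumes D: "connected D" "D \<noteq> {}"
    and loc: "\<And>z. z \<in> D \<Longrightarrow> \<exists>\<delta>>0. \<exists>L. ball z \<delta> \<subseteq> D \<and> (\<forall>f\<in>\<F>. bounded_spherical_deriv f L (ball z \<delta>))"
  shows   "normal_family \<F> D"
  unfolding normal_family_def
proof (intro allI impI)
  fix f :: "nat \<Rightarrow> complex \<Rightarrow> complex" assume f: "range f \<subseteq> \<F>"
  have fj: "f j \<in> \<F>" for j using f by auto
  have "locally_spherically_bounded f D"
    unfolding locally_spherically_bounded_def
  proof
    fix z assume "z \<in> D"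
    then obtain \<delta> L where "\<delta> > 0" "ball z \<delta> \<subseteq> D" "\<forall>f\<in>\<F>. bounded_spherical_deriv f L (ball z \<delta>)"
      using loc by blast
    moreover from this have "\<forall>\<^sub>F j in sequentially. bounded_spherical_deriv (f j) L (ball z \<delta>)"
      using fj by (intro always_eventually) blast
    ultimately show "\<exists>\<delta>>0. \<exists>L. ball z \<delta> \<subseteq> D \<and> (\<forall>\<^sub>F j in sequentially. bounded_spherical_deriv (f j) L (ball z \<delta>))"
      by blast
  qed
  then obtain r where r: "strict_mono (r :: nat \<Rightarrow> nat)"
    "(\<exists>g. spherical_limit (\<lambda>j. f (r j)) g D) \<or> diverges_spherically (\<lambda>j. f (r j)) D"
    by (rule Marty_compactness[OF D(2,1)]) (rule that)
  from r(2) show "\<exists>r. strict_mono r \<and>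
         ((\<exists>g. g nicely_meromorphic_on D \<and>
             (\<forall>K. compact K \<and> K \<subseteq> D \<longrightarrow>
               uniform_limit K (\<lambda>j. sphere_value (f (r j))) (sphere_value g) sequentially)) \<or>
          (\<forall>K. compact K \<and> K \<subseteq> D \<longrightarrow>
             uniform_limit K (\<lambda>j. sphere_value (f (r j))) (\<lambda>_. sphere_infinity) sequentially))"
  proof (elim disjE exE)
    fix g assume g: "spherical_limit (\<lambda>j. f (r j)) g D"
    have "\<exists>\<rho>>0. uniform_limit (ball z \<rho>) (\<lambda>j. sphere_value (f (r j))) (sphere_value g) sequentially" if z: "z \<in> D" for z
    proof -
      obtain \<rho> where \<rho>: "\<rho> > 0" "fin_limit (\<lambda>j. f (r j)) g (ball z \<rho>) \<or>
        infinite_type g (ball z \<rho>) \<and> inf_limit (\<lambda>j. f (r j)) (\<lambda>z. inverse (g z)) (ball z \<rho>)"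
        using g z unfolding spherical_limit_def by blast
      from \<rho>(2) have "uniform_limit (ball z \<rho>) (\<lambda>j. sphere_value (f (r j))) (sphere_value g) sequentially"
      proof (elim disjE conjE)
        assume g: "infinite_type g (ball z \<rho>)" and l: "inf_limit (\<lambda>j. f (r j)) (\<lambda>z. inverse (g z)) (ball z \<rho>)"
        show ?thesis
          using uniform_limit_sphere_value_inf[OF l] sphere_value_infinite_type[OF g]
          unfolding uniform_limit_iff by simp
      qed (rule uniform_limit_sphere_value_fin, auto)
      thus ?thesis using \<rho>(1) by blast
    qed
    hence "\<forall>K. compact K \<and> K \<subseteq> D \<longrightarrow>
               uniform_limit K (\<lambda>j. sphere_value (f (r j))) (sphere_value g) sequentially"
      by (intro allI impI) (elim conjE, rule uniform_limit_compact_of_local)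
    thus ?thesis using g r(1) unfolding spherical_limit_def by blast
  next
    assume *: "diverges_spherically (\<lambda>j. f (r j)) D"
    have "\<exists>\<rho>>0. uniform_limit (ball z \<rho>) (\<lambda>j. sphere_value (f (r j))) (\<lambda>_. sphere_infinity) sequentially" if z: "z \<in> D" for z
    proof -
      obtain \<rho> where \<rho>: "\<rho> > 0" "inf_limit (\<lambda>j. f (r j)) (\<lambda>_. 0) (ball z \<rho>)"
        using * z unfolding diverges_spherically_def by blast
      show ?thesis using \<rho>(1) uniform_limit_sphere_value_inf[OF \<rho>(2)] by (auto simp: sphere_infinity_eq)
    qed
    hence "\<forall>K. compact K \<and> K \<subseteq> D \<longrightarrow>
               uniform_limit K (\<lambda>j. sphere_value (f (r j))) (\<lambda>_. sphere_infinity) sequentially"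
      by (intro allI impI) (elim conjE, rule uniform_limit_compact_of_local)
    thus ?thesis using r(1) by blast
  qed
qed

section \<open>Zalcman--Pang rescaling\<close>

lemma eventually_norm_bounded:
  assumes "isCont f z"
  shows   "\<forall>\<^sub>F w in nhds z. norm (f w) \<le> norm (f z) + 1"
proof -
  have "((\<lambda>w. norm (f w)) \<longlongrightarrow> norm (f z)) (nhds z)"
    using assms by (intro tendsto_norm) (simp add: isCont_def tendsto_nhds_iff)
  hence "\<forall>\<^sub>F w in nhds z. norm (f w) < norm (f z) + 1" by (rule order_tendstoD) auto
  thus ?thesis by (rule eventually_mono) auto
qed

text \<open>The two sides compare the numerator and the denominator of the spherical derivative at \<open>0\<close> of the
  rescaled function \<open>\<zeta> \<mapsto> f (z + \<sigma> \<zeta>) / \<sigma>\<^sup>k\<close>; see \<open>rescale\<close> below.\<close>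
definition small_at_scale :: "nat \<Rightarrow> (complex \<Rightarrow> complex) \<Rightarrow> complex \<Rightarrow> real \<Rightarrow> bool" where
  "small_at_scale k f z \<sigma> \<longleftrightarrow> \<sigma> ^ (k + 1) * norm (deriv f z) < \<sigma> ^ (2 * k) + (norm (f z))\<^sup>2"

text \<open>The third assumption amounts to a bound \<open>M\<close> for the derivative of 1/f, so
  the term |f|^2 alone dominates at small scales. It serves near poles and near nonzero
  values.\<close>

lemma small_at_scaleI:
  assumes "0 < \<sigma>" "\<sigma> \<le> 1" "norm (deriv f z) \<le> M * (norm (f z))\<^sup>2" "\<sigma> * M \<le> 1"
  shows   "small_at_scale k f z \<sigma>"
proof -
  have "\<sigma> ^ (k + 1) * norm (deriv f z) \<le> \<sigma> ^ (k + 1) * (M * (norm (f z))\<^sup>2)"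
    using assms by (intro mult_left_mono) auto
  also have "\<dots> = \<sigma> ^ k * ((\<sigma> * M) * (norm (f z))\<^sup>2)" by (simp add: mult_ac)
  also have "\<dots> \<le> 1 * (1 * (norm (f z))\<^sup>2)"
    by (rule order_trans[OF mult_left_mono[OF mult_right_mono[OF assms(4)]] mult_right_mono])
       (use assms power_le_one[of \<sigma> k] in auto)
  also have "\<dots> < \<sigma> ^ (2 * k) + (norm (f z))\<^sup>2" using assms by simp
  finally show ?thesis by (simp add: small_at_scale_def)
qed

text \<open>Here the order of the zeros above k enters. With x = |z - z0| and order p, |f'| \<le> C
  x^(p-1) and |f| \<ge> c x^p nearby. If x \<ge> K \<sigma> with K = C/c, then \<sigma> |f'| \<le>
  |f| and the claim is ab < a^2 + b^2. Otherwise x^(p-1) \<le> x^k \<le> (K \<sigma>)^k, and the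
  left side is at most \<sigma>^(2k) times \<sigma> C K^k, a factor that \<open>\<sigma>0\<close>
  keeps below 1.\<close>

lemma small_at_scale_near_zero:
  assumes f: "f analytic_on {z0}" and ev: "eventually (\<lambda>w. f w \<noteq> 0) (at z0)" and z0: "f z0 = 0"
    and ord: "zorder f z0 \<ge> int (k + 1)"
  shows "\<exists>\<sigma>0>0. \<forall>\<^sub>F z in nhds z0. \<forall>\<sigma>. 0 < \<sigma> \<and> \<sigma> < \<sigma>0 \<longrightarrow> small_at_scale k f z \<sigma>"
proof -
  obtain U where U: "open U" "z0 \<in> U" "f holomorphic_on U" using f by (auto simp: analytic_at)
  then obtain e where e: "e > 0" "ball z0 e \<subseteq> U" by (meson openE)
  have holo: "f holomorphic_on ball z0 e" using U(3) e(2) by (rule holomorphic_on_subset)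
  have nc: "\<exists>w\<in>ball z0 e. f w \<noteq> 0"
  proof -
    have "eventually (\<lambda>w. w \<in> ball z0 e) (at z0)" using e by (intro eventually_at_in_open') auto
    with ev have "eventually (\<lambda>w. w \<in> ball z0 e \<and> f w \<noteq> 0) (at z0)" by eventually_elim auto
    thus ?thesis using eventually_frequently frequently_ex at_neq_bot by (metis (mono_tags, lifting))
  qed
  define p where "p = nat (zorder f z0)"
  define g where "g = zor_poly f z0"
  have "z0 \<in> ball z0 e" using e(1) by simp
  from zorder_exist_zero[OF holo open_ball connected_ball this nc]
  have "\<exists>r. r > 0 \<and> cball z0 r \<subseteq> ball z0 e \<and> g holomorphic_on cball z0 r \<and>
      (\<forall>w\<in>cball z0 r. f w = g w * (w - z0) ^ p \<and> g w \<noteq> 0)"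
    unfolding p_def g_def by blast
  then obtain r where r: "r > 0" "cball z0 r \<subseteq> ball z0 e" "g holomorphic_on cball z0 r"
     "\<And>w. w \<in> cball z0 r \<Longrightarrow> f w = g w * (w - z0) ^ p \<and> g w \<noteq> 0" by blast
  have p: "p \<ge> k + 1" using ord by (simp add: p_def)
  then obtain p' where p': "p = Suc p'" by (cases p) auto
  have g_an: "g analytic_on {z0}"
    using r(1,3) unfolding analytic_at by (meson ball_subset_cball centre_in_ball holomorphic_on_subset open_ball)
  define C where "C = (real p * (norm (g z0) + 1) + (norm (deriv g z0) + 1)) * 1"
  define c where "c = norm (g z0) / 2"
  have c: "c > 0" using r(4)[of z0] r(1) by (simp add: c_def)
  have C: "C > 0" by (auto simp: C_def intro!: add_nonneg_pos add_nonneg_pos)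
  define K where "K = C / c"
  have K: "K > 0" using c C by (simp add: K_def)
  define \<sigma>0 where "\<sigma>0 = 1 / (C * K ^ k + 1)"
  have "C * K ^ k > 0" using C K by simp
  hence \<sigma>0: "\<sigma>0 > 0" "\<sigma>0 * (C * K ^ k) \<le> 1" by (auto simp: \<sigma>0_def field_simps)
  have "((\<lambda>w. norm (g w)) \<longlongrightarrow> norm (g z0)) (nhds z0)"
    using analytic_at_imp_isCont[OF g_an] by (intro tendsto_norm) (simp add: isCont_def tendsto_nhds_iff)
  hence ev1: "\<forall>\<^sub>F w in nhds z0. norm (g w) > c" using c by (intro order_tendstoD(1)) (auto simp: c_def)
  have ev2: "\<forall>\<^sub>F w in nhds z0. norm (g w) \<le> norm (g z0) + 1"
    using analytic_at_imp_isCont[OF g_an] by (rule eventually_norm_bounded)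
  have ev3: "\<forall>\<^sub>F w in nhds z0. norm (deriv g w) \<le> norm (deriv g z0) + 1"
    using analytic_deriv[OF g_an] by (intro eventually_norm_bounded analytic_at_imp_isCont)
  have ev4: "\<forall>\<^sub>F w in nhds z0. w \<in> ball z0 (min r 1)" using r(1) by (intro eventually_nhds_in_open) auto
  from ev1 ev2 ev3 ev4 have "\<forall>\<^sub>F w in nhds z0. \<forall>\<sigma>. 0 < \<sigma> \<and> \<sigma> < \<sigma>0 \<longrightarrow> small_at_scale k f w \<sigma>"
  proof eventually_elim
    case (elim w)
    define x where "x = norm (w - z0)"
    have x: "x < 1" "x < r" "x \<ge> 0" using elim(4) by (auto simp: x_def dist_norm norm_minus_commute)
    have w: "w \<in> ball z0 r" using elim(4) by auto
    have dg: "(g has_field_derivative deriv g w) (at w)"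
      using w by (intro holomorphic_derivI[OF holomorphic_on_subset[OF r(3) ball_subset_cball]]) auto
    have dp: "((\<lambda>w. (w - z0) ^ p) has_field_derivative of_nat p * (w - z0) ^ p') (at w)"
      by (rule derivative_eq_intros refl)+ (simp add: p')
    have "\<forall>\<^sub>F v in nhds w. v \<in> ball z0 r" using w by (intro eventually_nhds_in_open) auto
    hence ev: "\<forall>\<^sub>F v in nhds w. g v * (v - z0) ^ p = f v"
    proof eventually_elim
      case (elim v)
      thus ?case using r(4)[of v] by simp
    qed
    have "((\<lambda>w. g w * (w - z0) ^ p) has_field_derivative
            deriv g w * (w - z0) ^ p + (of_nat p * (w - z0) ^ p') * g w) (at w)"
      by (rule DERIV_mult[OF dg dp])
    also have "?this \<longleftrightarrow> (f has_field_derivative deriv g w * (w - z0) ^ p + (of_nat p * (w - z0) ^ p') * g w) (at w)"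
      using eventually_nhds_x_imp_x[OF ev] eventually_mono[OF ev]
      by (intro has_field_derivative_cong_ev refl) auto
    finally have df: "deriv f w = deriv g w * (w - z0) ^ p + (of_nat p * (w - z0) ^ p') * g w"
      by (rule DERIV_imp_deriv)
    have "norm (deriv f w) \<le> norm (deriv g w) * x ^ p + (real p * x ^ p') * norm (g w)"
      unfolding df by (rule order_trans[OF norm_triangle_ineq]) (simp add: norm_mult norm_power x_def)
    also have "\<dots> \<le> (norm (deriv g z0) + 1) * x ^ p' + (real p * x ^ p') * (norm (g z0) + 1)"
      using elim(2,3) x by (intro add_mono mult_mono) (auto simp: p' intro: mult_left_le_one_le)
    also have "\<dots> = C * x ^ p'" by (simp add: C_def algebra_simps)
    finally have df_le: "norm (deriv f w) \<le> C * x ^ p'" .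
    have f_ge: "norm (f w) \<ge> c * x ^ p"
      using r(4)[of w] w elim(1) by (auto simp: norm_mult norm_power x_def intro!: mult_right_mono)
    show ?case
    proof (intro allI impI, elim conjE)
      fix \<sigma> :: real assume \<sigma>: "0 < \<sigma>" "\<sigma> < \<sigma>0"
      show "small_at_scale k f w \<sigma>"
        unfolding small_at_scale_def
      proof (cases "K * \<sigma> \<le> x")
        case True
        have "\<sigma> ^ (k + 1) * norm (deriv f w) \<le> \<sigma> ^ k * (\<sigma> * (C * x ^ p'))"
          using df_le \<sigma> by (simp add: mult_ac)
        also have "\<sigma> * (C * x ^ p') = (K * \<sigma>) * (c * x ^ p')" using c by (simp add: K_def)
        also have "\<dots> \<le> x * (c * x ^ p')" using True c x by (intro mult_right_mono) auto
        also have "\<dots> = c * x ^ p" by (simp add: p')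
        also have "\<dots> \<le> norm (f w)" by (rule f_ge)
        finally have "\<sigma> ^ (k + 1) * norm (deriv f w) \<le> \<sigma> ^ k * norm (f w)" using \<sigma> by simp
        also have "\<dots> < (\<sigma> ^ k)\<^sup>2 + (norm (f w))\<^sup>2"
        proof -
          have "0 \<le> (\<sigma> ^ k - norm (f w))\<^sup>2" by simp
          moreover have "(\<sigma> ^ k)\<^sup>2 > 0" using \<sigma> by simp
          ultimately show ?thesis
            using zero_le_power2[of "norm (f w)"] unfolding power2_diff by linarith
        qed
        finally show "\<sigma> ^ (k + 1) * norm (deriv f w) < \<sigma> ^ (2 * k) + (norm (f w))\<^sup>2"
          by (simp add: power_mult[symmetric] mult.commute)
      next
        case False
        have "\<sigma> ^ (k + 1) * norm (deriv f w) \<le> \<sigma> ^ (k + 1) * (C * x ^ k)"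
        proof -
          have "x ^ p' \<le> x ^ k" using x p p' by (intro power_decreasing) auto
          hence "C * x ^ p' \<le> C * x ^ k" using C by (intro mult_left_mono) auto
          thus ?thesis using df_le \<sigma> by (intro mult_left_mono) auto
        qed
        also have "\<dots> \<le> \<sigma> ^ (k + 1) * (C * (K * \<sigma>) ^ k)"
          using False x \<sigma> C by (intro mult_left_mono power_mono) auto
        also have "\<dots> = \<sigma> ^ (2 * k) * (\<sigma> * (C * K ^ k))"
          unfolding mult_2 power_add by (simp add: power_mult_distrib mult_ac)
        also have "\<dots> < \<sigma> ^ (2 * k) * 1"
        proof (rule mult_strict_left_mono)
          have "\<sigma> * (C * K ^ k) < \<sigma>0 * (C * K ^ k)" using \<sigma> C K by (intro mult_strict_right_mono) auto
          thus "\<sigma> * (C * K ^ k) < 1" using \<sigma>0(2) by linarith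
        qed (use \<sigma> in auto)
        finally show "\<sigma> ^ (k + 1) * norm (deriv f w) < \<sigma> ^ (2 * k) + (norm (f w))\<^sup>2"
          using zero_le_power2[of "norm (f w)"] by linarith
      qed
    qed
  qed
  thus ?thesis using \<sigma>0(1) by blast
qed

text \<open>Four local pictures: at a pole 1/f has bounded derivative, at a nonzero value |f| is
  bounded below, at an isolated zero the multiplicity is used, and otherwise f vanishes
  nearby.\<close>

lemma small_at_scale_local:
  assumes f: "f nicely_meromorphic_on D" and z0: "z0 \<in> D"
    and zeros: "zeros_multiplicity_ge f D d" and d: "d \<ge> k + 1"
  shows "\<exists>\<sigma>0>0. \<forall>\<^sub>F z in nhds z0. \<forall>\<sigma>. 0 < \<sigma> \<and> \<sigma> < \<sigma>0 \<and> \<not>is_pole f z \<longrightarrow> small_at_scale k f z \<sigma>"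
proof (cases "is_pole f z0")
  case True
  define h where "h = (\<lambda>z. inverse (f z))"
  have iso: "isolated_singularity_at f z0"
    using f z0 by (auto simp: nicely_meromorphic_on_def meromorphic_on_altdef)
  have "h nicely_meromorphic_on D" unfolding h_def using f by (rule nicely_meromorphic_on_inverse)
  moreover have "\<not>is_pole h z0"
  proof -
    have "isolated_zero h z0" using True by (simp add: h_def isolated_zero_inverse_iff)
    thus ?thesis unfolding isolated_zero_def is_pole_def
      by (metis at_neq_bot not_tendsto_and_filterlim_at_infinity)
  qed
  ultimately have "h analytic_on {z0}" using z0 by (intro nicely_meromorphic_on_imp_analytic_at)
  hence "isCont (deriv h) z0" by (intro analytic_at_imp_isCont analytic_deriv)
  define M where "M = norm (deriv h z0) + 1"
  have M: "M > 0" by (simp add: M_def add_nonneg_pos)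
  have "\<forall>\<^sub>F w in nhds z0. norm (deriv h w) \<le> M"
    unfolding M_def using \<open>isCont (deriv h) z0\<close> by (rule eventually_norm_bounded)
  moreover have "\<forall>\<^sub>F w in nhds z0. w \<noteq> z0 \<longrightarrow> f w \<noteq> 0"
    using non_zero_neighbour_pole[OF True] by (simp add: eventually_at_filter)
  moreover have "\<forall>\<^sub>F w in nhds z0. w \<noteq> z0 \<longrightarrow> f analytic_on {w}"
    using iso isolated_singularity_at_altdef[of f z0] by (simp add: eventually_at_filter)
  ultimately have "\<forall>\<^sub>F z in nhds z0. \<forall>\<sigma>. 0 < \<sigma> \<and> \<sigma> < min 1 (1 / M) \<and> \<not>is_pole f z \<longrightarrow> small_at_scale k f z \<sigma>"
  proof eventually_elim
    case (elim w)
    show ?case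
    proof safe
      fix \<sigma> :: real assume \<sigma>: "0 < \<sigma>" "\<sigma> < min 1 (1 / M)" and np: "\<not>is_pole f w"
      hence "w \<noteq> z0" using True by auto
      hence w: "f w \<noteq> 0" "f analytic_on {w}" using elim by auto
      have df: "(f has_field_derivative deriv f w) (at w)"
        using analytic_on_imp_differentiable_at[OF w(2)] DERIV_deriv_iff_field_differentiable by blast
      have "(h has_field_derivative - (deriv f w / (f w)\<^sup>2)) (at w)"
        unfolding h_def using w(1) by (auto intro!: derivative_eq_intros df simp: power2_eq_square field_simps)
      hence "norm (deriv h w) = norm (deriv f w) / (norm (f w))\<^sup>2"
        by (simp add: DERIV_imp_deriv norm_divide norm_power)
      hence "norm (deriv f w) = norm (deriv h w) * (norm (f w))\<^sup>2" using w(1) by (simp add: field_simps)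
      also have "\<dots> \<le> M * (norm (f w))\<^sup>2" using elim(1) by (intro mult_right_mono) auto
      finally have "norm (deriv f w) \<le> M * (norm (f w))\<^sup>2" .
      thus "small_at_scale k f w \<sigma>"
        using \<sigma> M by (intro small_at_scaleI[of \<sigma> f w M]) (auto simp: field_simps)
    qed
  qed
  thus ?thesis using M by (intro exI[of _ "min 1 (1 / M)"]) auto
next
  case False
  hence an: "f analytic_on {z0}" using f z0 by (intro nicely_meromorphic_on_imp_analytic_at)
  consider "f z0 \<noteq> 0" | "f z0 = 0" "isolated_zero f z0" | "f z0 = 0" "\<not>isolated_zero f z0" by blast
  thus ?thesis
  proof cases
    case 1
    define \<epsilon> where "\<epsilon> = norm (f z0) / 2"
    have \<epsilon>: "\<epsilon> > 0" using 1 by (simp add: \<epsilon>_def)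
    define M where "M = (norm (deriv f z0) + 1) / \<epsilon>\<^sup>2"
    have M: "M > 0" using \<epsilon> by (auto simp: M_def intro!: divide_pos_pos add_nonneg_pos)
    have "\<forall>\<^sub>F w in nhds z0. norm (deriv f w) \<le> norm (deriv f z0) + 1"
      using analytic_deriv[OF an] by (intro eventually_norm_bounded analytic_at_imp_isCont)
    moreover have "((\<lambda>w. norm (f w)) \<longlongrightarrow> norm (f z0)) (nhds z0)"
      using analytic_at_imp_isCont[OF an] by (intro tendsto_norm) (simp add: isCont_def tendsto_nhds_iff)
    hence "\<forall>\<^sub>F w in nhds z0. norm (f w) > \<epsilon>" using \<epsilon> by (intro order_tendstoD(1)) (auto simp: \<epsilon>_def)
    ultimately have "\<forall>\<^sub>F z in nhds z0. \<forall>\<sigma>. 0 < \<sigma> \<and> \<sigma> < min 1 (1 / M) \<and> \<not>is_pole f z \<longrightarrow> small_at_scale k f z \<sigma>"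
    proof eventually_elim
      case (elim w)
      have "norm (deriv f w) \<le> M * \<epsilon>\<^sup>2" using elim(1) \<epsilon> by (simp add: M_def)
      also have "\<dots> \<le> M * (norm (f w))\<^sup>2" using elim(2) M \<epsilon> by (intro mult_left_mono power_mono) auto
      finally show ?case using M by (auto intro!: small_at_scaleI[of _ f w M] simp: field_simps)
    qed
    thus ?thesis using M by (intro exI[of _ "min 1 (1 / M)"]) auto
  next
    case 2
    have "zorder f z0 \<ge> int d" using zeros z0 2 by (auto simp: zeros_multiplicity_ge_def)
    hence "\<exists>\<sigma>0>0. \<forall>\<^sub>F z in nhds z0. \<forall>\<sigma>. 0 < \<sigma> \<and> \<sigma> < \<sigma>0 \<longrightarrow> small_at_scale k f z \<sigma>"
      using 2 an d by (intro small_at_scale_near_zero) (auto simp: isolated_zero_def)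
    then obtain \<sigma>0 where \<sigma>0: "\<sigma>0 > 0" "\<forall>\<^sub>F z in nhds z0. \<forall>\<sigma>. 0 < \<sigma> \<and> \<sigma> < \<sigma>0 \<longrightarrow> small_at_scale k f z \<sigma>"
      by blast
    from \<sigma>0(2) have "\<forall>\<^sub>F z in nhds z0. \<forall>\<sigma>. 0 < \<sigma> \<and> \<sigma> < \<sigma>0 \<and> \<not>is_pole f z \<longrightarrow> small_at_scale k f z \<sigma>"
      by eventually_elim blast
    thus ?thesis using \<sigma>0(1) by blast
  next
    case 3
    hence "\<forall>\<^sub>F z in nhds z0. f z = 0" using an by (intro non_isolated_zero_imp_eventually_zero')
    then obtain U where U: "open U" "z0 \<in> U" "\<And>z. z \<in> U \<Longrightarrow> f z = 0" by (auto simp: eventually_nhds)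
    have "deriv f z = 0" if "z \<in> U" for z
    proof -
      have "deriv f z = deriv (\<lambda>_. 0) z"
        using U that by (intro deriv_cong_ev refl eventually_mono[OF eventually_nhds_in_open[of U z]]) auto
      thus ?thesis by simp
    qed
    hence "\<forall>\<^sub>F z in nhds z0. \<forall>\<sigma>. 0 < \<sigma> \<and> \<sigma> < 1 \<and> \<not>is_pole f z \<longrightarrow> small_at_scale k f z \<sigma>"
      using U by (intro eventually_mono[OF eventually_nhds_in_open[of U z0]]) (auto simp: small_at_scale_def)
    thus ?thesis by (intro exI[of _ 1]) auto
  qed
qed

text \<open>Compactness merges the local scales into one, which keeps the infimum in
  \<open>zalcman_pang_point\<close> positive.\<close>

lemma small_at_scale_compact:
  assumes f: "f nicely_meromorphic_on D" and zeros: "zeros_multiplicity_ge f D d" and d: "d \<ge> k + 1"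
    and K: "compact K" "K \<subseteq> D"
  obtains \<sigma>0 where "\<sigma>0 > 0" "\<And>z \<sigma>. z \<in> K \<Longrightarrow> 0 < \<sigma> \<Longrightarrow> \<sigma> < \<sigma>0 \<Longrightarrow> \<not>is_pole f z \<Longrightarrow> small_at_scale k f z \<sigma>"
proof -
  have "\<forall>z0\<in>K. \<exists>\<sigma>0 U. \<sigma>0 > 0 \<and> open U \<and> z0 \<in> U \<and>
          (\<forall>z\<in>U. \<forall>\<sigma>. 0 < \<sigma> \<and> \<sigma> < \<sigma>0 \<and> \<not>is_pole f z \<longrightarrow> small_at_scale k f z \<sigma>)"
    using small_at_scale_local[OF f _ zeros d] K(2) unfolding eventually_nhds by (metis subsetD)
  then obtain \<Lambda> U where *: "\<And>z. z \<in> K \<Longrightarrow> \<Lambda> z > 0" "\<And>z. z \<in> K \<Longrightarrow> open (U z)" "\<And>z. z \<in> K \<Longrightarrow> z \<in> U z"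
    "\<And>z0 z \<sigma>. z0 \<in> K \<Longrightarrow> z \<in> U z0 \<Longrightarrow> 0 < \<sigma> \<Longrightarrow> \<sigma> < \<Lambda> z0 \<Longrightarrow> \<not>is_pole f z \<Longrightarrow> small_at_scale k f z \<sigma>"
    by metis
  obtain C where C: "C \<subseteq> K" "finite C" "K \<subseteq> (\<Union>z\<in>C. U z)"
    by (rule compactE_image[OF K(1), of K U]) (use * in auto)
  define \<sigma>0 where "\<sigma>0 = Min (insert 1 (\<Lambda> ` C))"
  show ?thesis
  proof (rule that[of \<sigma>0])
    show "\<sigma>0 > 0" using C *(1) by (auto simp: \<sigma>0_def)
    fix z \<sigma> assume z: "z \<in> K" "0 < \<sigma>" "\<sigma> < \<sigma>0" "\<not>is_pole f z"
    then obtain c where c: "c \<in> C" "z \<in> U c" using C(3) by blast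
    have "\<sigma>0 \<le> \<Lambda> c" using C(2) c(1) by (auto simp: \<sigma>0_def)
    thus "small_at_scale k f z \<sigma>" using *(4)[of c z \<sigma>] z c C(1) by auto
  qed
qed

text \<open>The division cancels the scale factor of the k-th derivative, which therefore equals
  that of \<open>f\<close> at w + s \<zeta>. With 0 for \<open>k\<close> this is plain affine
  substitution.\<close>

definition rescale :: "nat \<Rightarrow> (complex \<Rightarrow> complex) \<Rightarrow> complex \<Rightarrow> real \<Rightarrow> complex \<Rightarrow> complex" where
  "rescale k f w s = (\<lambda>\<zeta>. f (w + of_real s * \<zeta>) / of_real s ^ k)"

lemma filtermap_affine_at:
  assumes "c \<noteq> (0 :: complex)"
  shows   "filtermap (\<lambda>\<zeta>. w + c * \<zeta>) (at \<zeta>) = at (w + c * \<zeta>)"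
proof (rule filtermap_fun_inverse[where g = "\<lambda>z. (z - w) / c"])
  show "filterlim (\<lambda>\<zeta>. w + c * \<zeta>) (at (w + c * \<zeta>)) (at \<zeta>)"
    using assms by (auto simp: filterlim_at eventually_at_filter intro!: tendsto_intros)
  have "((\<lambda>z. (z - w) / c) \<longlongrightarrow> (w + c * \<zeta> - w) / c) (at (w + c * \<zeta>))"
    using assms by (intro tendsto_intros)
  moreover have "(w + c * \<zeta> - w) / c = \<zeta>" using assms by simp
  moreover have "(z - w) / c \<noteq> \<zeta>" if "z \<noteq> w + c * \<zeta>" for z
    using that assms by (auto simp: field_simps)
  ultimately show "filterlim (\<lambda>z. (z - w) / c) (at \<zeta>) (at (w + c * \<zeta>))"
    by (simp add: filterlim_at eventually_at_filter)
qed (use assms in auto)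

lemma is_pole_rescale:
  assumes "s > 0"
  shows   "is_pole (rescale k f w s) \<zeta> \<longleftrightarrow> is_pole f (w + of_real s * \<zeta>)"
proof -
  have s: "complex_of_real s \<noteq> 0" "complex_of_real s ^ k \<noteq> 0" using assms by auto
  have "is_pole (\<lambda>\<zeta>. f (w + of_real s * \<zeta>)) \<zeta> \<longleftrightarrow> is_pole f (w + of_real s * \<zeta>)"
    using is_pole_compose_iff[OF filtermap_affine_at[OF s(1)], of f w \<zeta>] by (simp add: o_def)
  moreover have "is_pole (rescale k f w s) \<zeta> \<longleftrightarrow> is_pole (\<lambda>\<zeta>. f (w + of_real s * \<zeta>)) \<zeta>"
    using is_pole_cmult_iff[of "1 / of_real s ^ k" "\<lambda>\<zeta>. f (w + of_real s * \<zeta>)" \<zeta>] s(2)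
    by (simp add: rescale_def del: is_pole_cmult_iff)
  ultimately show ?thesis by simp
qed

lemma nicely_meromorphic_rescale:
  assumes f: "f nicely_meromorphic_on D" and s: "s > 0" and B: "\<And>\<zeta>. \<zeta> \<in> B \<Longrightarrow> w + of_real s * \<zeta> \<in> D"
  shows   "rescale k f w s nicely_meromorphic_on B"
proof -
  have s0: "complex_of_real s \<noteq> 0" using s by simp
  have "(\<lambda>\<zeta>. f (w + of_real s * \<zeta>)) meromorphic_on B"
    using f B by (intro meromorphic_on_compose[of f D "\<lambda>\<zeta>. w + of_real s * \<zeta>" B])
                 (auto simp: nicely_meromorphic_on_def intro!: analytic_intros)
  hence "rescale k f w s meromorphic_on B" unfolding rescale_def by (intro meromorphic_intros)
  moreover have "is_pole (rescale k f w s) \<zeta> \<and> rescale k f w s \<zeta> = 0 \<or> rescale k f w s \<midarrow>\<zeta>\<rightarrow> rescale k f w s \<zeta>"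
    if \<zeta>: "\<zeta> \<in> B" for \<zeta>
  proof (cases "is_pole f (w + of_real s * \<zeta>)")
    case True
    hence "f (w + of_real s * \<zeta>) = 0" using is_pole_zero_at_nicely_mero[OF f True] B[OF \<zeta>] by simp
    thus ?thesis using True is_pole_rescale[OF s] by (simp add: rescale_def)
  next
    case False
    hence "f \<midarrow>(w + of_real s * \<zeta>)\<rightarrow> f (w + of_real s * \<zeta>)"
      using f B[OF \<zeta>] by (auto simp: nicely_meromorphic_on_def)
    hence "((\<lambda>\<zeta>. f (w + of_real s * \<zeta>)) \<longlongrightarrow> f (w + of_real s * \<zeta>)) (at \<zeta>)"
      by (subst (asm) filtermap_affine_at[OF s0, symmetric]) (simp add: filterlim_filtermap)
    hence "rescale k f w s \<midarrow>\<zeta>\<rightarrow> rescale k f w s \<zeta>"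
      unfolding rescale_def by (intro tendsto_intros) (use s0 in auto)
    thus ?thesis by blast
  qed
  ultimately show ?thesis by (simp add: nicely_meromorphic_on_def)
qed

lemma higher_deriv_rescale:
  assumes f: "f analytic_on {w + of_real s * \<zeta>}" and s: "s > 0"
  shows   "(deriv ^^ j) (rescale k f w s) \<zeta> = of_real s ^ j * (deriv ^^ j) f (w + of_real s * \<zeta>) / of_real s ^ k"
proof -
  obtain T where T: "open T" "w + of_real s * \<zeta> \<in> T" "f holomorphic_on T" using f by (auto simp: analytic_at)
  define S where "S = (\<lambda>\<zeta>. of_real s * \<zeta> + w) -` T"
  have S: "open S" unfolding S_def using T(1) by (intro open_vimage) (auto intro!: continuous_intros)
  have \<zeta>: "\<zeta> \<in> S" using T(2) by (simp add: S_def add.commute)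
  have comp: "(\<lambda>\<zeta>. f (of_real s * \<zeta> + w)) holomorphic_on S"
    by (rule holomorphic_on_compose_gen[of "\<lambda>\<zeta>. of_real s * \<zeta> + w" S f T, unfolded o_def])
       (use T in \<open>auto simp: S_def intro!: holomorphic_intros\<close>)
  have "(deriv ^^ j) (rescale k f w s) \<zeta> = (deriv ^^ j) (\<lambda>\<zeta>. (1 / of_real s ^ k) * f (of_real s * \<zeta> + w)) \<zeta>"
    by (simp add: rescale_def add.commute)
  also have "\<dots> = (1 / of_real s ^ k) * (deriv ^^ j) (\<lambda>\<zeta>. f (of_real s * \<zeta> + w)) \<zeta>"
    by (rule higher_deriv_cmult[OF comp \<zeta> S])
  also have "(deriv ^^ j) (\<lambda>\<zeta>. f (of_real s * \<zeta> + w)) \<zeta> = of_real s ^ j * (deriv ^^ j) f (of_real s * \<zeta> + w)"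
    by (rule higher_deriv_compose_linear'[OF T(3) S T(1) \<zeta>]) (simp add: S_def)
  finally show ?thesis by (simp add: add.commute)
qed

lemma scale_condition_iff:
  assumes f: "f analytic_on {w + of_real s * \<zeta>}" and s: "s > 0"
  shows   "small_at_scale k f (w + of_real s * \<zeta>) s \<longleftrightarrow>
           norm (deriv (rescale k f w s) \<zeta>) < 1 + (norm (rescale k f w s \<zeta>))\<^sup>2"
proof -
  define a b where "a = norm (deriv f (w + of_real s * \<zeta>))" and "b = norm (f (w + of_real s * \<zeta>))"
  have "norm (deriv (rescale k f w s) \<zeta>) = s * a / s ^ k"
    using higher_deriv_rescale[OF f s, of 1 k] s by (simp add: norm_mult norm_divide norm_power a_def)
  moreover have "norm (rescale k f w s \<zeta>) = b / s ^ k"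
    using s by (simp add: rescale_def norm_divide norm_power b_def)
  moreover have "s * a / s ^ k < 1 + (b / s ^ k)\<^sup>2 \<longleftrightarrow> s ^ (k + 1) * a < s ^ (2 * k) + b\<^sup>2"
  proof -
    have sk: "s ^ (2 * k) = s ^ k * s ^ k" by (simp add: mult_2 power_add)
    have pos: "s ^ k * s ^ k > 0" using s by simp
    have "s * a / s ^ k < 1 + (b / s ^ k)\<^sup>2 \<longleftrightarrow> (s ^ k * s ^ k) * (s * a / s ^ k) < (s ^ k * s ^ k) * (1 + (b / s ^ k)\<^sup>2)"
      using pos by (subst mult_less_cancel_left_pos) auto
    also have "(s ^ k * s ^ k) * (s * a / s ^ k) = s ^ (k + 1) * a" using s by simp
    also have "(s ^ k * s ^ k) * (1 + (b / s ^ k)\<^sup>2) = s ^ (2 * k) + b\<^sup>2"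
      unfolding sk using s by (simp add: field_simps power2_eq_square)
    finally show ?thesis .
  qed
  ultimately show ?thesis by (simp add: small_at_scale_def a_def b_def)
qed

text \<open>Zalcman's rescaling in Pang's form. Instead of a maximum of the spherical derivative, a point
  is picked which minimises, up to a factor \<open>2\<close>, the scale at which the rescaled function
  stops being small, relative to the distance from the boundary of the disc.\<close>
lemma zalcman_pang_point:
  assumes f: "f nicely_meromorphic_on D" and zeros: "zeros_multiplicity_ge f D d" and d: "d \<ge> k + 1"
    and r: "r > 0" "cball z0 r \<subseteq> D" and l: "l \<ge> 1"
    and z1: "z1 \<in> ball z0 (r / 2)" "\<not>is_pole f z1" "norm (deriv f z1) \<ge> l ^ (k + 1) * (1 + (norm (f z1))\<^sup>2)"
  obtains w s where "w \<in> ball z0 r" "0 < s" "s \<le> 4 / l"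
    "\<not>is_pole (rescale k f w s) 0"
    "norm (deriv (rescale k f w s) 0) \<ge> 1 + (norm (rescale k f w s 0))\<^sup>2"
    "\<And>\<zeta>. \<zeta> \<in> ball 0 (l * r / 8) \<Longrightarrow> w + of_real s * \<zeta> \<in> ball z0 r"
    "bounded_spherical_deriv (rescale k f w s) (4 ^ (k + 1)) (ball 0 (l * r / 8))"
proof -
  define dd where "dd = (\<lambda>z. r - dist z0 z)"
  define E where "E = {(z, s). z \<in> ball z0 r \<and> s > 0 \<and> \<not>is_pole f z \<and> \<not>small_at_scale k f z s}"
  \<comment> \<open>Scales are measured relative to the distance from the boundary, so that a
    near-minimal pair can still be compared with nearby points, where that distance changes by a
    bounded factor.\<close>
  define T where "T = (\<lambda>(z, s). s / dd z) ` E"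
  obtain s0 where s0: "s0 > 0" "\<And>z s. z \<in> cball z0 r \<Longrightarrow> 0 < s \<Longrightarrow> s < s0 \<Longrightarrow> \<not>is_pole f z \<Longrightarrow> small_at_scale k f z s"
    using small_at_scale_compact[OF f zeros d compact_cball r(2)] by blast
  have T_ge: "t \<ge> s0 / r" if tT: "t \<in> T" for t
  proof -
    obtain z s where "(z, s) \<in> E" and t: "t = s / dd z" using tT unfolding T_def by auto
    hence zs: "z \<in> ball z0 r" "s > 0" "\<not>is_pole f z" "\<not>small_at_scale k f z s" by (simp_all add: E_def)
    have "s \<ge> s0" using s0(2)[of z s] zs by force
    moreover have "0 < dd z" "dd z \<le> r" using zs(1) by (auto simp: dd_def)
    ultimately show ?thesis unfolding t using s0(1) by (intro frac_le) auto
  qed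
  hence bdd: "bdd_below T" by (intro bdd_belowI)
  \<comment> \<open>The large derivative at \<open>z1\<close> makes \<open>f\<close> fail to be
    small at scale 1/l, which bounds the infimum from above.\<close>
  have E1: "(z1, 1 / l) \<in> E"
  proof -
    have "(1 / l) ^ (2 * k) + (norm (f z1))\<^sup>2 \<le> 1 + (norm (f z1))\<^sup>2" using l by (simp add: power_le_one)
    also have "\<dots> = (1 / l) ^ (k + 1) * (l ^ (k + 1) * (1 + (norm (f z1))\<^sup>2))" using l by (simp add: power_divide)
    also have "\<dots> \<le> (1 / l) ^ (k + 1) * norm (deriv f z1)" using z1(3) l by (intro mult_left_mono) auto
    finally have "\<not>small_at_scale k f z1 (1 / l)" by (simp add: small_at_scale_def)
    thus ?thesis using z1 l r by (auto simp: E_def)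
  qed
  define t1 where "t1 = 1 / l / dd z1"
  have t1: "t1 \<in> T" using E1 by (force simp: T_def t1_def)
  have t1_le: "t1 \<le> 2 / (l * r)"
  proof -
    have "dd z1 \<ge> r / 2" using z1(1) by (simp add: dd_def)
    hence "1 / l / dd z1 \<le> 1 / l / (r / 2)" using l r by (intro divide_left_mono) auto
    thus ?thesis by (simp add: t1_def)
  qed
  define \<tau> where "\<tau> = Inf T"
  have "\<tau> \<ge> s0 / r" unfolding \<tau>_def using t1 T_ge by (intro cInf_greatest) auto
  hence \<tau>: "\<tau> > 0" using s0 r by (auto intro: less_le_trans[OF divide_pos_pos])
  have \<tau>_le: "\<tau> \<le> t" if "t \<in> T" for t unfolding \<tau>_def using that bdd by (rule cInf_lower)
  have "\<tau> < 2 * \<tau>" using \<tau> by simp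
  then obtain t where t: "t \<in> T" "t < 2 * \<tau>"
    unfolding \<tau>_def using cInf_less_iff[OF _ bdd, of "2 * Inf T"] t1 by auto
  obtain w s where "(w, s) \<in> E" and ts: "t = s / dd w" using t(1) unfolding T_def by auto
  hence ws: "w \<in> ball z0 r" "s > 0" "\<not>is_pole f w" "\<not>small_at_scale k f w s" by (simp_all add: E_def)
  have ddw: "0 < dd w" "dd w \<le> r" using ws(1) by (auto simp: dd_def)
  have t_pos: "t > 0" using ws ddw ts by simp
  have s_eq: "s = t * dd w" using ts ddw by simp
  have t_le: "t \<le> 4 / (l * r)" using t(2) \<tau>_le[OF t1] t1_le by simp
  have lr: "l * r > 0" using l r by simp
  \<comment> \<open>Since s is t times the distance \<open>dd w\<close>, a displacement s |\<zeta>|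
    with |\<zeta>| < 1/(2t) uses less than half of that distance.\<close>
  have ltr: "l * r / 8 \<le> 1 / (2 * t)" using t_le t_pos lr by (simp add: field_simps)
  have s_le: "s \<le> 4 / l"
  proof -
    have "s \<le> 4 / (l * r) * r" unfolding s_eq using t_le ddw lr t_pos by (intro mult_mono) auto
    thus ?thesis using r by simp
  qed
  have an: "f analytic_on {z}" if "z \<in> ball z0 r" "\<not>is_pole f z" for z
    using f that r(2) by (intro nicely_meromorphic_on_imp_analytic_at) auto
  have moved: "w + of_real s * \<zeta> \<in> ball z0 r" "dd (w + of_real s * \<zeta>) > dd w / 2" if "\<zeta> \<in> ball 0 (l * r / 8)" for \<zeta>
  proof -
    have "s * norm \<zeta> < s * (1 / (2 * t))" using that ltr ws(2) by (intro mult_strict_left_mono) auto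
    also have "\<dots> = dd w / 2" using t_pos by (simp add: s_eq)
    finally have "norm (of_real s * \<zeta>) < dd w / 2" using ws(2) by (simp add: norm_mult)
    moreover have "dist z0 (w + of_real s * \<zeta>) \<le> dist z0 w + norm (of_real s * \<zeta>)"
      by (metis dist_norm dist_triangle add_diff_cancel_left' norm_minus_commute)
    ultimately show "dd (w + of_real s * \<zeta>) > dd w / 2" by (simp add: dd_def)
    with ddw show "w + of_real s * \<zeta> \<in> ball z0 r" by (simp add: dd_def)
  qed
  show ?thesis
  proof (rule that[OF ws(1,2) s_le])
    show "\<not>is_pole (rescale k f w s) 0" using is_pole_rescale[OF ws(2), of k f w 0] ws(3) by simp
    show "norm (deriv (rescale k f w s) 0) \<ge> 1 + (norm (rescale k f w s 0))\<^sup>2"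
      using scale_condition_iff[of f w s 0 k] an[OF ws(1,3)] ws(2,4) by simp
    show "w + of_real s * \<zeta> \<in> ball z0 r" if "\<zeta> \<in> ball 0 (l * r / 8)" for \<zeta>
      by (rule moved(1)[OF that])
    show "bounded_spherical_deriv (rescale k f w s) (4 ^ (k + 1)) (ball 0 (l * r / 8))"
      unfolding bounded_spherical_deriv_def
    proof (intro conjI ballI impI)
      have "ball z0 r \<subseteq> D" using r(2) by auto
      thus "rescale k f w s nicely_meromorphic_on ball 0 (l * r / 8)"
        using moved(1) by (intro nicely_meromorphic_rescale[OF f ws(2)]) auto
      fix \<zeta> assume \<zeta>: "\<zeta> \<in> ball 0 (l * r / 8)" "\<not>is_pole (rescale k f w s) \<zeta>"
      define z where "z = w + of_real s * \<zeta>"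
      have z: "z \<in> ball z0 r" "dd z > dd w / 2" "\<not>is_pole f z"
        using moved[OF \<zeta>(1)] \<zeta>(2) is_pole_rescale[OF ws(2)] by (auto simp: z_def)
      \<comment> \<open>After the displacement more than half of the distance is left, so the scale
        s/4 has relative size below t/2 < \<tau>, under the infimum. Returning from s/4 to s costs
        the factor 4^(k+1).\<close>
      have small: "small_at_scale k f z (s / 4)"
      proof (rule ccontr)
        assume "\<not>small_at_scale k f z (s / 4)"
        hence "(z, s / 4) \<in> E" using z ws(2) by (simp add: E_def)
        hence "s / 4 / dd z \<in> T" by (force simp: T_def)
        hence "\<tau> \<le> s / 4 / dd z" by (rule \<tau>_le)
        moreover have "s / 4 / dd z < s / 4 / (dd w / 2)"
          using z(2) ddw ws(2) by (intro divide_strict_left_mono mult_pos_pos) auto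
        moreover have "s / 4 / (dd w / 2) = t / 2" using ts by simp
        ultimately show False using t(2) by simp
      qed
      have an_z: "f analytic_on {w + of_real s * \<zeta>}" using an[OF z(1,3)] by (simp add: z_def)
      have le: "s ^ (k + 1) * norm (deriv f z) \<le> 4 ^ (k + 1) * (s ^ (2 * k) + (norm (f z))\<^sup>2)"
      proof -
        have "(s / 4) ^ (2 * k) \<le> s ^ (2 * k)" using ws(2) by (intro power_mono) auto
        hence "(s / 4) ^ (k + 1) * norm (deriv f z) \<le> s ^ (2 * k) + (norm (f z))\<^sup>2"
          using small by (simp add: small_at_scale_def)
        hence "4 ^ (k + 1) * ((s / 4) ^ (k + 1) * norm (deriv f z)) \<le> 4 ^ (k + 1) * (s ^ (2 * k) + (norm (f z))\<^sup>2)"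
          by (intro mult_left_mono) auto
        thus ?thesis by (simp add: power_divide)
      qed
      have "norm (deriv (rescale k f w s) \<zeta>) = s ^ (k + 1) * norm (deriv f z) / (s ^ k * s ^ k)"
        using higher_deriv_rescale[OF an_z ws(2), of 1 k] ws(2)
        by (simp add: norm_mult norm_divide norm_power z_def)
      also have "\<dots> \<le> 4 ^ (k + 1) * (s ^ (2 * k) + (norm (f z))\<^sup>2) / (s ^ k * s ^ k)"
        using le ws(2) by (intro divide_right_mono) auto
      also have "\<dots> = 4 ^ (k + 1) * ((s ^ (2 * k) + (norm (f z))\<^sup>2) / (s ^ k * s ^ k))" by simp
      also have "(s ^ (2 * k) + (norm (f z))\<^sup>2) / (s ^ k * s ^ k) = 1 + (norm (rescale k f w s \<zeta>))\<^sup>2"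
        using ws(2) by (simp add: rescale_def norm_divide norm_power z_def power_divide mult_2 power_add
            add_divide_distrib power2_eq_square)
      finally show "norm (deriv (rescale k f w s) \<zeta>) \<le> 4 ^ (k + 1) * (1 + (norm (rescale k f w s \<zeta>))\<^sup>2)" .
    qed
  qed
qed

section \<open>Hurwitz's theorem with multiplicities\<close>

text \<open>Cauchy's inequality for the difference on discs of radius \<rho>/4; \<open>e'\<close> is
  the bound that it turns into e/2.\<close>

lemma uniform_limit_higher_deriv:
  assumes lim: "uniform_limit (ball a \<rho>) H h sequentially" and \<rho>: "\<rho> > 0"
    and H: "\<forall>\<^sub>F j in sequentially. H j holomorphic_on ball a \<rho>" and h: "h holomorphic_on ball a \<rho>"
  shows "uniform_limit (ball a (\<rho> / 2)) (\<lambda>j. (deriv ^^ k) (H j)) ((deriv ^^ k) h) sequentially"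
  unfolding uniform_limit_iff
proof safe
  fix e :: real assume e: "e > 0"
  define e' where "e' = e * (\<rho> / 4) ^ k / (2 * fact k)"
  have e': "e' > 0" using e \<rho> by (simp add: e'_def)
  have "\<forall>\<^sub>F j in sequentially. \<forall>z\<in>ball a \<rho>. dist (H j z) (h z) < e'"
    using lim e' by (simp add: uniform_limit_iff)
  with H show "\<forall>\<^sub>F j in sequentially. \<forall>z\<in>ball a (\<rho> / 2). dist ((deriv ^^ k) (H j) z) ((deriv ^^ k) h z) < e"
  proof eventually_elim
    case (elim j)
    show ?case
    proof
      fix z assume z: "z \<in> ball a (\<rho> / 2)"
      have sub: "cball z (\<rho> / 4) \<subseteq> ball a \<rho>"
      proof
        fix w assume "w \<in> cball z (\<rho> / 4)"
        thus "w \<in> ball a \<rho>" using z \<rho> dist_triangle[of a w z] by simp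
      qed
      have holo: "(\<lambda>w. H j w - h w) holomorphic_on ball a \<rho>" using elim(1) h by (intro holomorphic_intros)
      have za: "z \<in> ball a \<rho>" using subsetD[OF sub, of z] \<rho> by simp
      have "(deriv ^^ k) (H j) z - (deriv ^^ k) h z = (deriv ^^ k) (\<lambda>w. H j w - h w) z"
        by (rule higher_deriv_diff[OF elim(1) h open_ball za, symmetric])
      also have "norm \<dots> \<le> fact k * e' / (\<rho> / 4) ^ k"
      proof (rule Cauchy_inequality)
        show "(\<lambda>w. H j w - h w) holomorphic_on ball z (\<rho> / 4)"
          using holo sub ball_subset_cball by (meson holomorphic_on_subset order_trans)
        show "continuous_on (cball z (\<rho> / 4)) (\<lambda>w. H j w - h w)"
          using holo sub by (intro holomorphic_on_imp_continuous_on) (rule holomorphic_on_subset)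
        fix x assume "norm (z - x) = \<rho> / 4"
        hence "x \<in> ball a \<rho>" using sub by (auto simp: dist_norm)
        thus "norm (H j x - h x) \<le> e'" using elim(2) by (force simp: dist_norm)
      qed (use \<rho> in auto)
      also have "\<dots> = e / 2" using \<rho> by (simp add: e'_def)
      also have "\<dots> < e" using e by simp
      finally show "dist ((deriv ^^ k) (H j) z) ((deriv ^^ k) h z) < e" by (simp add: dist_norm)
    qed
  qed
qed

text \<open>Otherwise a subsequence would be zero-free near \<open>a\<close>, and Hurwitz's theorem
  would make \<open>h a\<close> nonzero.\<close>

lemma hurwitz_zero:
  assumes lim: "uniform_limit (ball a \<rho>) H h sequentially" and \<rho>: "\<rho> > 0"
    and H: "\<forall>\<^sub>F j in sequentially. H j holomorphic_on ball a \<rho>" and h: "h holomorphic_on ball a \<rho>"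
    and zero: "isolated_zero h a" and e: "e > 0"
  shows "\<forall>\<^sub>F j in sequentially. \<exists>w\<in>ball a e. H j w = 0"
proof (rule ccontr)
  assume *: "\<not>?thesis"
  define B where "B = ball a (min e \<rho>)"
  have B: "open B" "connected B" "a \<in> B" "B \<subseteq> ball a \<rho>" "B \<subseteq> ball a e" using e \<rho> by (auto simp: B_def)
  have "\<not>(\<forall>\<^sub>F j in sequentially. H j holomorphic_on ball a \<rho> \<longrightarrow> (\<exists>w\<in>ball a e. H j w = 0))"
  proof
    assume "\<forall>\<^sub>F j in sequentially. H j holomorphic_on ball a \<rho> \<longrightarrow> (\<exists>w\<in>ball a e. H j w = 0)"
    with H have "\<forall>\<^sub>F j in sequentially. \<exists>w\<in>ball a e. H j w = 0" by eventually_elim blast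
    with * show False by contradiction
  qed
  then obtain r where r: "strict_mono (r :: nat \<Rightarrow> nat)"
    "\<And>n. H (r n) holomorphic_on ball a \<rho>" "\<And>n w. w \<in> ball a e \<Longrightarrow> H (r n) w \<noteq> 0"
    using not_eventually_sequentiallyD by blast
  have "h a \<noteq> 0"
  proof (rule Hurwitz_no_zeros[OF B(1,2), of "\<lambda>n. H (r n)" h])
    show "H (r n) holomorphic_on B" for n using r(2) B(4) by (rule holomorphic_on_subset)
    show "h holomorphic_on B" using h B(4) by (rule holomorphic_on_subset)
    show "uniform_limit K (\<lambda>n. H (r n)) h sequentially" if "K \<subseteq> B" for K
    proof -
      have "uniform_limit (ball a \<rho>) (\<lambda>n. H (r n)) h sequentially"
        unfolding uniform_limit_iff using lim r(1) eventually_subseq by (auto simp: uniform_limit_iff)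
      thus ?thesis by (rule uniform_limit_on_subset) (use that B in auto)
    qed
    show "\<not>h constant_on B" using zero B by (intro isolated_zero_imp_not_constant_on)
    show "H (r n) z \<noteq> 0" if "z \<in> B" for n z using r(3) that B(5) by blast
  qed (use B in auto)
  moreover have "h analytic_on {a}" using h \<rho> unfolding analytic_at by (intro exI[of _ "ball a \<rho>"]) auto
  hence "h a = 0" using zero isolated_zero_analytic_iff by blast
  ultimately show False by contradiction
qed

text \<open>Multiplicity is stated through derivatives because this form passes to limits: zeros of
  the \<open>H j\<close> approach \<open>a\<close>, the lower derivatives vanish at them, and
  derivatives converge uniformly, so those of \<open>h\<close> vanish at \<open>a\<close>.\<close>

lemma hurwitz_multiplicity:
  assumes lim: "uniform_limit (ball a \<rho>) H h sequentially" and \<rho>: "\<rho> > 0"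
    and H: "\<forall>\<^sub>F j in sequentially. H j holomorphic_on ball a \<rho>" and h: "h holomorphic_on ball a \<rho>"
    and zero: "isolated_zero h a"
    and mult: "\<forall>\<^sub>F j in sequentially. \<forall>z\<in>ball a \<rho>. H j z = 0 \<longrightarrow> (\<forall>i<d. (deriv ^^ i) (H j) z = 0)"
  shows "zorder h a \<ge> int d"
proof -
  have an: "h analytic_on {a}" using h \<rho> unfolding analytic_at by (intro exI[of _ "ball a \<rho>"]) auto
  have deriv0: "(deriv ^^ i) h a = 0" if i: "i < d" for i
  proof -
    have "\<forall>n. \<exists>j w. n \<le> j \<and> w \<in> ball a (min (\<rho> / 2) (1 / (real n + 1))) \<and> (deriv ^^ i) (H j) w = 0"
    proof
      fix n :: nat
      have pos: "min (\<rho> / 2) (1 / (real n + 1)) > 0" using \<rho> by simp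
      have "\<forall>\<^sub>F j in sequentially. n \<le> j" by (rule eventually_ge_at_top)
      with mult hurwitz_zero[OF lim \<rho> H h zero pos]
      have "\<forall>\<^sub>F j in sequentially. n \<le> j \<and> (\<exists>w\<in>ball a (min (\<rho> / 2) (1 / (real n + 1))). (deriv ^^ i) (H j) w = 0)"
      proof eventually_elim
        case (elim j)
        then obtain w where w: "w \<in> ball a (min (\<rho> / 2) (1 / (real n + 1)))" "H j w = 0" by blast
        hence "w \<in> ball a \<rho>" using \<rho> by auto
        thus ?case using elim(1,3) w i by blast
      qed
      from eventually_happens'[OF sequentially_bot this]
      show "\<exists>j w. n \<le> j \<and> w \<in> ball a (min (\<rho> / 2) (1 / (real n + 1))) \<and> (deriv ^^ i) (H j) w = 0"
        by blast
    qed
    then obtain J w where Jw: "\<And>n. n \<le> J n" "\<And>n. w n \<in> ball a (min (\<rho> / 2) (1 / (real n + 1)))"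
      "\<And>n. (deriv ^^ i) (H (J n)) (w n) = 0" by metis
    have J: "filterlim J at_top sequentially"
      using filterlim_at_top_mono[OF filterlim_ident] Jw(1) by (auto intro: always_eventually)
    have w: "w \<longlonglongrightarrow> a"
    proof (rule metric_tendsto_imp_tendsto)
      show "(\<lambda>n. 1 / (real n + 1)) \<longlonglongrightarrow> 0" using LIMSEQ_inverse_real_of_nat by (simp add: field_simps)
      show "\<forall>\<^sub>F n in sequentially. dist (w n) a \<le> dist (1 / (real n + 1)) 0"
        using Jw(2) by (intro always_eventually) (auto simp: dist_commute less_imp_le)
    qed
    have "(deriv ^^ i) h analytic_on {a}" using an by (rule analytic_higher_deriv)
    hence "isCont ((deriv ^^ i) h) a" by (rule analytic_at_imp_isCont)
    hence "(\<lambda>n. (deriv ^^ i) h (w n)) \<longlonglongrightarrow> (deriv ^^ i) h a" using w by (rule isCont_tendsto_compose)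
    moreover have "(\<lambda>n. (deriv ^^ i) h (w n)) \<longlonglongrightarrow> 0"
    proof (rule tendstoI)
      fix e :: real assume e: "e > 0"
      have "\<forall>\<^sub>F j in sequentially. \<forall>z\<in>ball a (\<rho> / 2). dist ((deriv ^^ i) (H j) z) ((deriv ^^ i) h z) < e"
        using uniform_limit_higher_deriv[OF lim \<rho> H h, of i] e by (simp add: uniform_limit_iff)
      hence "\<forall>\<^sub>F n in sequentially. \<forall>z\<in>ball a (\<rho> / 2). dist ((deriv ^^ i) (H (J n)) z) ((deriv ^^ i) h z) < e"
        using J by (rule eventually_compose_filterlim)
      thus "\<forall>\<^sub>F n in sequentially. dist ((deriv ^^ i) h (w n)) 0 < e"
      proof eventually_elim
        case (elim n)
        have "w n \<in> ball a (\<rho> / 2)" using Jw(2)[of n] by auto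
        from bspec[OF elim this] show ?case using Jw(3)[of n] by (simp add: dist_commute)
      qed
    qed
    ultimately show ?thesis by (rule LIMSEQ_unique)
  qed
  show ?thesis
  proof (cases "\<forall>i. (deriv ^^ i) h a = 0")
    case True
    have "h z = 0" if "z \<in> ball a \<rho>" for z
      using holomorphic_fun_eq_0_on_connected[OF h open_ball connected_ball, of a z] True that \<rho> by auto
    hence "h constant_on ball a \<rho>" by (auto simp: constant_on_def)
    moreover have "\<not>h constant_on ball a \<rho>" using zero \<rho> by (intro isolated_zero_imp_not_constant_on) auto
    ultimately show ?thesis by contradiction
  next
    case False
    define l where "l = (LEAST l. (deriv ^^ l) h a \<noteq> 0)"
    have l: "(deriv ^^ l) h a \<noteq> 0" unfolding l_def using False by (metis (mono_tags, lifting) LeastI_ex)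
    have l': "(deriv ^^ i) h a = 0" if "i < l" for i
      using not_less_Least[of i "\<lambda>l. (deriv ^^ l) h a \<noteq> 0"] that by (auto simp: l_def)
    have "zorder h a = int l" using an l l' by (intro zorder_zero_eqI') auto
    moreover have "\<not>l < d" using deriv0 l by blast
    ultimately show ?thesis by simp
  qed
qed

text \<open>A zero that is not isolated escapes \<open>zeros_multiplicity_ge\<close>, but then the
  function vanishes nearby and all its derivatives are 0.\<close>

lemma higher_deriv_0_of_multiplicity:
  assumes P: "zeros_multiplicity_ge P D m" "z \<in> D" "P analytic_on {z}" "P z = 0" and i: "i < m"
  shows   "(deriv ^^ i) P z = 0"
proof (cases "isolated_zero P z")
  case True
  hence "zorder P z \<ge> int m" using P by (auto simp: zeros_multiplicity_ge_def)
  thus ?thesis using P(3) i by (intro zorder_ge_imp_higher_deriv_0)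
next
  case False
  hence "\<forall>\<^sub>F w in nhds z. P w = 0" using P by (intro non_isolated_zero_imp_eventually_zero')
  hence "(deriv ^^ i) P z = (deriv ^^ i) (\<lambda>_. 0) z" by (intro higher_deriv_cong_ev) auto
  thus ?thesis by (simp add: higher_deriv_const)
qed

text \<open>If the local limit is of infinite type, regularity of \<open>g\<close> at
  \<open>a\<close> keeps its reciprocal away from 0 near \<open>a\<close>, and there inversion
  preserves uniform convergence.\<close>

lemma spherical_limit_near_regular_point:
  assumes lim: "spherical_limit G g D" and a: "a \<in> D" "\<not>is_pole g a"
  obtains \<rho> where "\<rho> > 0" "g holomorphic_on ball a \<rho>" "uniform_limit (ball a \<rho>) G g sequentially"
    "\<forall>\<^sub>F j in sequentially. G j holomorphic_on ball a \<rho>"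
proof -
  obtain \<rho> where \<rho>: "\<rho> > 0" "fin_limit G g (ball a \<rho>) \<or>
      infinite_type g (ball a \<rho>) \<and> inf_limit G (\<lambda>z. inverse (g z)) (ball a \<rho>)"
    using lim a(1) unfolding spherical_limit_def by blast
  from \<rho>(2) show ?thesis
  proof (elim disjE conjE)
    assume "fin_limit G g (ball a \<rho>)"
    thus ?thesis using \<rho>(1) by (intro that[of \<rho>]) (auto simp: fin_limit_def finite_type_def elim: eventually_mono)
  next
    assume g: "infinite_type g (ball a \<rho>)" and G: "inf_limit G (\<lambda>z. inverse (g z)) (ball a \<rho>)"
    define q where "q = (\<lambda>z. inverse (g z))"
    have q: "q holomorphic_on ball a \<rho>" using g by (simp add: infinite_type_def q_def)
    have "g a \<noteq> 0" using g a(2) \<rho>(1) by (auto simp: infinite_type_def)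
    define \<eta> where "\<eta> = norm (q a) / 2"
    have \<eta>: "\<eta> > 0" using \<open>g a \<noteq> 0\<close> by (simp add: \<eta>_def q_def)
    have "isCont q a"
      using holomorphic_on_imp_continuous_on[OF q] \<rho>(1) by (auto simp: continuous_on_eq_continuous_at)
    hence "((\<lambda>w. norm (q w)) \<longlongrightarrow> norm (q a)) (nhds a)"
      by (intro tendsto_norm) (simp add: isCont_def tendsto_nhds_iff)
    hence "\<forall>\<^sub>F w in nhds a. norm (q w) > \<eta>" using \<eta> by (intro order_tendstoD(1)) (auto simp: \<eta>_def)
    then obtain \<rho>1 where \<rho>1: "\<rho>1 > 0" "\<And>w. dist w a < \<rho>1 \<Longrightarrow> norm (q w) > \<eta>"
      unfolding eventually_nhds_metric by blast
    define \<rho>2 where "\<rho>2 = min \<rho> \<rho>1"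
    have sub: "ball a \<rho>2 \<subseteq> ball a \<rho>" by (auto simp: \<rho>2_def)
    have q_ge: "norm (q w) > \<eta>" if "w \<in> ball a \<rho>2" for w
      using that \<rho>1(2)[of w] by (simp add: \<rho>2_def dist_commute)
    have ul: "uniform_limit (ball a \<rho>2) (\<lambda>j z. inverse (G j z)) q sequentially"
      using G sub unfolding inf_limit_def q_def by (blast intro: uniform_limit_on_subset)
    show ?thesis
    proof (rule that[of \<rho>2])
      show "\<rho>2 > 0" using \<rho>(1) \<rho>1(1) by (simp add: \<rho>2_def)
      have "(\<lambda>z. inverse (q z)) holomorphic_on ball a \<rho>2"
        using q_ge \<eta> by (intro holomorphic_intros holomorphic_on_subset[OF q sub]) force
      thus "g holomorphic_on ball a \<rho>2" by (simp add: q_def)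
      have "uniform_limit (ball a \<rho>2) (\<lambda>j z. inverse (inverse (G j z))) (inverse \<circ> q) sequentially"
        using q_ge \<eta> by (intro uniform_lim_inverse[OF ul, of \<eta>]) (auto simp: less_imp_le)
      thus "uniform_limit (ball a \<rho>2) G g sequentially" by (simp add: q_def o_def)
      have "\<forall>\<^sub>F j in sequentially. \<forall>z\<in>ball a \<rho>2. dist (inverse (G j z)) (q z) < \<eta>"
        using ul \<eta> by (simp add: uniform_limit_iff)
      moreover have "\<forall>\<^sub>F j in sequentially. infinite_type (G j) (ball a \<rho>)"
        using G by (simp add: inf_limit_def)
      ultimately show "\<forall>\<^sub>F j in sequentially. G j holomorphic_on ball a \<rho>2"
      proof eventually_elim
        case (elim j)
        have nz: "inverse (G j z) \<noteq> 0" if "z \<in> ball a \<rho>2" for z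
          using elim(1) q_ge[OF that] that by (metis dist_0_norm less_asym)
        have "(\<lambda>z. inverse (G j z)) holomorphic_on ball a \<rho>2"
          using elim(2) sub unfolding infinite_type_def by (blast intro: holomorphic_on_subset)
        hence "(\<lambda>z. inverse (inverse (G j z))) holomorphic_on ball a \<rho>2"
          using nz by (rule holomorphic_on_inverse)
        thus ?case by simp
      qed
    qed
  qed
qed

text \<open>The normalisation keeps |G'| \<ge> 1 at 0 for all members G, and likewise |G'| / |G|^2
  \<ge> 1 for the derivative of the reciprocal, while the derivative of a constant limit is
  0.\<close>

lemma spherical_limit_not_constant:
  assumes G: "\<And>j. G j analytic_on {0}" "\<And>j. norm (deriv (G j) 0) \<ge> 1 + (norm (G j 0))\<^sup>2" and \<rho>: "\<rho> > 0"
  shows "fin_limit G (\<lambda>_. c) (ball 0 \<rho>) \<Longrightarrow> False" "inf_limit G (\<lambda>_. c) (ball 0 \<rho>) \<Longrightarrow> False"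
proof -
  assume lim: "fin_limit G (\<lambda>_. c) (ball 0 \<rho>)"
  have "(\<lambda>j. deriv (G j) 0) \<longlonglongrightarrow> deriv (\<lambda>_. c) 0"
    using lim \<rho> unfolding fin_limit_def
    by (intro deriv_complex_uniform_limit[where A = "ball 0 \<rho>"]) (auto simp: finite_type_def elim: eventually_mono)
  hence "(\<lambda>j. norm (deriv (G j) 0)) \<longlonglongrightarrow> norm (deriv (\<lambda>_. c :: complex) 0)" by (rule tendsto_norm)
  moreover have "1 \<le> norm (deriv (G j) 0)" for j using G(2)[of j] by (smt (verit) zero_le_power2)
  ultimately have "1 \<le> norm (deriv (\<lambda>_. c :: complex) (0 :: complex))" by (intro LIMSEQ_le_const) auto
  thus False by simp
next
  assume lim: "inf_limit G (\<lambda>_. c) (ball 0 \<rho>)"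
  have "(\<lambda>j. deriv (\<lambda>z. inverse (G j z)) 0) \<longlonglongrightarrow> deriv (\<lambda>_. c) 0"
    using lim \<rho> unfolding inf_limit_def
    by (intro deriv_complex_uniform_limit[where A = "ball 0 \<rho>"]) (auto simp: finite_type_def infinite_type_def elim: eventually_mono)
  hence "(\<lambda>j. norm (deriv (\<lambda>z. inverse (G j z)) 0)) \<longlonglongrightarrow> norm (deriv (\<lambda>_. c :: complex) 0)" by (rule tendsto_norm)
  moreover have "\<forall>\<^sub>F j in sequentially. infinite_type (G j) (ball 0 \<rho>)" using lim by (simp add: inf_limit_def)
  hence "\<forall>\<^sub>F j in sequentially. 1 \<le> norm (deriv (\<lambda>z. inverse (G j z)) 0)"
  proof eventually_elim
    case (elim j)
    have "\<not>is_pole (G j) 0" using G(1) by (rule analytic_at_imp_no_pole)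
    hence nz: "G j 0 \<noteq> 0" using elim \<rho> by (auto simp: infinite_type_def)
    have "(G j has_field_derivative deriv (G j) 0) (at 0)"
      using analytic_on_imp_differentiable_at[OF G(1)] DERIV_deriv_iff_field_differentiable by blast
    hence "((\<lambda>z. inverse (G j z)) has_field_derivative - (deriv (G j) 0 / (G j 0)\<^sup>2)) (at 0)"
      using nz by (auto intro!: derivative_eq_intros simp: power2_eq_square field_simps)
    hence "norm (deriv (\<lambda>z. inverse (G j z)) 0) = norm (deriv (G j) 0) / (norm (G j 0))\<^sup>2"
      by (simp add: DERIV_imp_deriv norm_divide norm_power)
    moreover have "(norm (G j 0))\<^sup>2 \<le> norm (deriv (G j) 0)" using G(2)[of j] by simp
    ultimately show ?case using nz by simp
  qed
  ultimately have "1 \<le> norm (deriv (\<lambda>_. c :: complex) (0 :: complex))" by (intro tendsto_lowerbound) auto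
  thus False by simp
qed

section \<open>Limits of rescaled sequences\<close>

lemma isolated_zero_imp_not_pole: "isolated_zero g a \<Longrightarrow> \<not>is_pole g a" for g :: "complex \<Rightarrow> complex"
  unfolding isolated_zero_def is_pole_def using not_tendsto_and_filterlim_at_infinity[OF at_neq_bot] by blast

lemma zorder_inverse_pole:
  assumes "is_pole f z" "f meromorphic_on {z}"
  shows   "zorder (\<lambda>w. inverse (f w)) z = - zorder f z"
proof (rule zorder_inverse)
  show "isolated_singularity_at f z" "not_essential f z"
    using assms(2) meromorphic_on_isolated_singularity meromorphic_on_not_essential by blast+
  show "\<exists>\<^sub>F w in at z. f w \<noteq> 0"
    using non_zero_neighbour_pole[OF assms(1)] by (intro eventually_frequently) auto
qed

lemma analytic_rescale:
  assumes "f analytic_on {w + of_real s * \<zeta>}"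
  shows   "rescale k f w s analytic_on {\<zeta>}"
proof (cases "s = 0")
  case True
  thus ?thesis by (simp add: rescale_def)
next
  case False
  have "(\<lambda>\<zeta>. f (w + of_real s * \<zeta>)) analytic_on {\<zeta>}"
    by (rule analytic_on_compose[of "\<lambda>\<zeta>. w + of_real s * \<zeta>" "{\<zeta>}" f, unfolded o_def])
       (use assms in \<open>auto intro!: analytic_intros\<close>)
  thus ?thesis unfolding rescale_def using False by (intro analytic_intros) auto
qed

lemma higher_deriv_rescale_zero:
  assumes P: "zeros_multiplicity_ge P D m" "w + of_real s * \<zeta> \<in> D" "P analytic_on {w + of_real s * \<zeta>}"
    and s: "s > 0" and zero: "rescale k P w s \<zeta> = 0" and i: "i < m"
  shows "(deriv ^^ i) (rescale k P w s) \<zeta> = 0"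
proof -
  have "P (w + of_real s * \<zeta>) = 0" using zero s by (simp add: rescale_def)
  hence "(deriv ^^ i) P (w + of_real s * \<zeta>) = 0" using higher_deriv_0_of_multiplicity[OF P _ i] by blast
  thus ?thesis using higher_deriv_rescale[OF P(3) s, of i k] by simp
qed

text \<open>By \<open>in_K\<close> every fixed disc about 0 is eventually mapped into
  \<open>K\<close>, so limits on the whole plane see the \<open>f j\<close> only inside their
  domain.\<close>

locale rescaled_limit =
  fixes f :: "nat \<Rightarrow> complex \<Rightarrow> complex" and D K :: "complex set" and w :: "nat \<Rightarrow> complex"
    and s :: "nat \<Rightarrow> real" and k :: nat and g :: "complex \<Rightarrow> complex"
  assumes f: "\<And>j. f j nicely_meromorphic_on D" and s: "\<And>j. s j > 0"
    and in_K: "\<And>R. \<forall>\<^sub>F j in sequentially. \<forall>\<zeta>\<in>ball 0 R. w j + of_real (s j) * \<zeta> \<in> K" and K: "K \<subseteq> D"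
    and lim: "spherical_limit (\<lambda>j. rescale k (f j) (w j) (s j)) g UNIV"
begin

definition G :: "nat \<Rightarrow> complex \<Rightarrow> complex" where "G j = rescale k (f j) (w j) (s j)"

lemma limit_G: "spherical_limit G g UNIV"
  using lim by (simp add: G_def [abs_def])

lemma nicely_meromorphic_limit: "g nicely_meromorphic_on UNIV"
  using lim by (simp add: spherical_limit_def)

lemma eventually_in_K: "\<forall>\<^sub>F j in sequentially. \<forall>\<zeta>\<in>ball a \<rho>. w j + of_real (s j) * \<zeta> \<in> K"
proof -
  have "\<zeta> \<in> ball 0 (norm a + \<rho>)" if "\<zeta> \<in> ball a \<rho>" for \<zeta>
    using that norm_triangle_ineq[of a "\<zeta> - a"] by (simp add: dist_norm norm_minus_commute)
  with in_K[of "norm a + \<rho>"] show ?thesis by (auto elim!: eventually_mono)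
qed

lemma analytic_source:
  assumes "G j holomorphic_on ball a \<rho>" "\<forall>\<zeta>\<in>ball a \<rho>. w j + of_real (s j) * \<zeta> \<in> K" "\<zeta> \<in> ball a \<rho>"
  shows   "f j analytic_on {w j + of_real (s j) * \<zeta>}"
proof (rule nicely_meromorphic_on_imp_analytic_at[OF f])
  show "w j + of_real (s j) * \<zeta> \<in> D" using assms(2,3) K by blast
  have "G j analytic_on {\<zeta>}" using assms(1,3) unfolding analytic_at by blast
  hence "\<not>is_pole (G j) \<zeta>" by (rule analytic_at_imp_no_pole)
  thus "\<not>is_pole (f j) (w j + of_real (s j) * \<zeta>)" using is_pole_rescale[OF s] by (simp add: G_def)
qed

lemma zorder_limit_zero:
  assumes zeros: "\<And>j. zeros_multiplicity_ge (f j) D d" and a: "isolated_zero g a"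
  shows   "zorder g a \<ge> int d"
proof -
  obtain \<rho> where \<rho>: "\<rho> > 0" "g holomorphic_on ball a \<rho>" "uniform_limit (ball a \<rho>) G g sequentially"
    and holo: "\<forall>\<^sub>F j in sequentially. G j holomorphic_on ball a \<rho>"
    by (rule spherical_limit_near_regular_point[OF limit_G UNIV_I isolated_zero_imp_not_pole[OF a]]) (rule that)
  from holo eventually_in_K[of a \<rho>]
  have "\<forall>\<^sub>F j in sequentially. \<forall>z\<in>ball a \<rho>. G j z = 0 \<longrightarrow> (\<forall>i<d. (deriv ^^ i) (G j) z = 0)"
  proof eventually_elim
    case (elim j)
    show ?case
    proof (intro ballI impI allI)
      fix z i assume z: "z \<in> ball a \<rho>" "G j z = 0" "i < d"
      have "w j + of_real (s j) * z \<in> D" using elim(2) z(1) K by blast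
      thus "(deriv ^^ i) (G j) z = 0"
        using higher_deriv_rescale_zero[OF zeros _ analytic_source[OF elim z(1)] s] z unfolding G_def by blast
    qed
  qed
  thus ?thesis by (rule hurwitz_multiplicity[OF \<rho>(3,1) holo \<rho>(2) a])
qed

lemma zorder_limit_pole:
  assumes poles: "\<And>j. poles_multiplicity_ge (f j) D p" and a: "is_pole g a"
  shows   "zorder g a \<le> - int p"
proof -
  obtain \<rho> where \<rho>: "\<rho> > 0" "fin_limit G g (ball a \<rho>) \<or>
      infinite_type g (ball a \<rho>) \<and> inf_limit G (\<lambda>z. inverse (g z)) (ball a \<rho>)"
    using limit_G unfolding spherical_limit_def by blast
  have "\<not>fin_limit G g (ball a \<rho>)"
  proof
    assume "fin_limit G g (ball a \<rho>)"
    hence "g analytic_on {a}"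
      using \<rho>(1) unfolding fin_limit_def finite_type_def analytic_at by (intro exI[of _ "ball a \<rho>"]) auto
    thus False using a analytic_at_imp_no_pole by blast
  qed
  with \<rho>(2) have g: "infinite_type g (ball a \<rho>)" and G: "inf_limit G (\<lambda>z. inverse (g z)) (ball a \<rho>)"
    by auto
  have type: "\<forall>\<^sub>F j in sequentially. infinite_type (G j) (ball a \<rho>)" using G by (simp add: inf_limit_def)
  have mult_inv: "zeros_multiplicity_ge (\<lambda>z. inverse (f j z)) D p" for j
    unfolding zeros_multiplicity_ge_def
  proof (intro ballI impI)
    fix z assume z: "z \<in> D" "isolated_zero (\<lambda>z. inverse (f j z)) z"
    have "f j meromorphic_on {z}"
      using f[of j] z(1) meromorphic_on_subset[of "f j" D "{z}"] by (simp add: nicely_meromorphic_on_def)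
    moreover have "is_pole (f j) z" using z(2) by (simp add: isolated_zero_inverse_iff)
    moreover from this have "zorder (f j) z \<le> - int p"
      using poles[of j] z(1) by (simp add: poles_multiplicity_ge_def)
    ultimately show "zorder (\<lambda>z. inverse (f j z)) z \<ge> int p" using zorder_inverse_pole[of "f j" z] by simp
  qed
  have "zorder (\<lambda>z. inverse (g z)) a \<ge> int p"
  proof (rule hurwitz_multiplicity)
    show "uniform_limit (ball a \<rho>) (\<lambda>j z. inverse (G j z)) (\<lambda>z. inverse (g z)) sequentially"
      using G by (simp add: inf_limit_def)
    show "\<forall>\<^sub>F j in sequentially. (\<lambda>z. inverse (G j z)) holomorphic_on ball a \<rho>"
      using type by eventually_elim (simp add: infinite_type_def)
    show "(\<lambda>z. inverse (g z)) holomorphic_on ball a \<rho>" using g by (simp add: infinite_type_def)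
    show "isolated_zero (\<lambda>z. inverse (g z)) a" using a by (simp add: isolated_zero_inverse_iff)
    from type eventually_in_K[of a \<rho>]
    show "\<forall>\<^sub>F j in sequentially. \<forall>z\<in>ball a \<rho>. inverse (G j z) = 0 \<longrightarrow>
            (\<forall>i<p. (deriv ^^ i) (\<lambda>z. inverse (G j z)) z = 0)"
    proof eventually_elim
      case (elim j)
      show ?case
      proof (intro ballI impI allI)
        fix z i assume z: "z \<in> ball a \<rho>" "inverse (G j z) = 0" and i: "i < p"
        define y where "y = w j + of_real (s j) * z"
        define c where "c = complex_of_real (s j) ^ k"
        have y: "y \<in> D" using elim(2) z(1) K by (auto simp: y_def)
        have "is_pole (G j) z" using elim(1) z by (auto simp: infinite_type_def)
        hence pole: "is_pole (f j) y" using is_pole_rescale[OF s] by (simp add: G_def y_def)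
        have an: "(\<lambda>z. inverse (f j z)) analytic_on {y}"
        proof (rule nicely_meromorphic_on_imp_analytic_at)
          show "(\<lambda>z. inverse (f j z)) nicely_meromorphic_on D" by (rule nicely_meromorphic_on_inverse[OF f])
          show "\<not>is_pole (\<lambda>z. inverse (f j z)) y"
            using pole isolated_zero_imp_not_pole by (auto simp: is_pole_inverse_iff)
        qed (rule y)
        have fy: "f j y = 0" using is_pole_zero_at_nicely_mero[OF f pole y] .
        \<comment> \<open>The reciprocal of \<open>G j\<close> is \<open>c\<close> times the plain
          substitution into the reciprocal of \<open>f j\<close>; hence the exponent 0 here and the
          factor \<open>c\<close> below.\<close>
        have R: "rescale 0 (\<lambda>z. inverse (f j z)) (w j) (s j) z = 0"
          using fy by (simp add: rescale_def y_def)
        have R0: "(deriv ^^ i) (rescale 0 (\<lambda>z. inverse (f j z)) (w j) (s j)) z = 0"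
          using higher_deriv_rescale_zero[OF mult_inv y[unfolded y_def] an[unfolded y_def] s R i] .
        obtain S where S: "open S" "z \<in> S" "rescale 0 (\<lambda>z. inverse (f j z)) (w j) (s j) holomorphic_on S"
          using analytic_rescale[OF an[unfolded y_def], of 0] unfolding analytic_at by blast
        have "(\<lambda>z. inverse (G j z)) = (\<lambda>z. c * rescale 0 (\<lambda>z. inverse (f j z)) (w j) (s j) z)"
          by (auto simp: G_def rescale_def c_def field_simps)
        hence "(deriv ^^ i) (\<lambda>z. inverse (G j z)) z =
                 c * (deriv ^^ i) (rescale 0 (\<lambda>z. inverse (f j z)) (w j) (s j)) z"
          using higher_deriv_cmult[OF S(3,2,1)] by simp
        thus "(deriv ^^ i) (\<lambda>z. inverse (G j z)) z = 0" using R0 by simp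
      qed
    qed
  qed (rule \<rho>)
  moreover have "g meromorphic_on {a}"
    using nicely_meromorphic_limit meromorphic_on_subset[of g UNIV] by (simp add: nicely_meromorphic_on_def)
  ultimately show ?thesis using zorder_inverse_pole[OF a] by simp
qed

text \<open>Since \<open>n * k \<ge> 1\<close>, the term \<open>A f\<^sup>n\<close> equals \<open>s\<^sup>k\<^sup>n\<close> times a bounded function and disappears
  in the limit, while \<open>\<psi>\<close> freezes at the limit of the centres.\<close>
lemma zorder_limit_value:
  assumes D: "open D" and cK: "compact K" and A: "A holomorphic_on D" and \<psi>: "\<psi> holomorphic_on D"
    and "k > 0" "n > 0" and w: "w \<longlonglongrightarrow> v" "v \<in> K" and s0: "s \<longlonglongrightarrow> 0"
    and mult: "\<And>j. zeros_multiplicity_ge (\<lambda>z. (deriv ^^ k) (f j) z - A z * f j z ^ n - \<psi> z) D m"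
    and a: "isolated_zero (\<lambda>z. (deriv ^^ k) g z - \<psi> v) a"
  shows   "zorder (\<lambda>z. (deriv ^^ k) g z - \<psi> v) a \<ge> int m"
proof -
  have merg: "g meromorphic_on {a}"
    using nicely_meromorphic_limit meromorphic_on_subset[of g UNIV] by (simp add: nicely_meromorphic_on_def)
  \<comment> \<open>At a pole of \<open>g\<close> the k-th derivative minus \<psi> v has a pole as
    well, not a zero.\<close>
  have "\<not>is_pole g a"
  proof
    assume "is_pole g a"
    hence "is_pole ((deriv ^^ i) g) a" for i
    proof (induction i)
      case (Suc i)
      have "(deriv ^^ i) g meromorphic_on {a}" using merg by (intro meromorphic_intros)
      thus ?case using Suc by (simp add: is_pole_deriv_iff)
    qed simp
    from this[of k] have "is_pole (\<lambda>z. (deriv ^^ k) g z + (- \<psi> v)) a"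
      by (subst is_pole_plus_const_iff [symmetric])
    thus False using isolated_zero_imp_not_pole[OF a] by simp
  qed
  then obtain \<rho> where \<rho>: "\<rho> > 0" and g: "g holomorphic_on ball a \<rho>"
    and ul: "uniform_limit (ball a \<rho>) G g sequentially"
    and holo: "\<forall>\<^sub>F j in sequentially. G j holomorphic_on ball a \<rho>"
    by (rule spherical_limit_near_regular_point[OF limit_G UNIV_I])
  define B where "B = ball a (\<rho> / 2)"
  have B: "B \<subseteq> ball a \<rho>" "cball a (\<rho> / 2) \<subseteq> ball a \<rho>" using \<rho> by (auto simp: B_def)
  define P where "P = (\<lambda>j z. (deriv ^^ k) (f j) z - A z * f j z ^ n - \<psi> z)"
  \<comment> \<open>The exponent is 0 because the k-th derivative of \<open>f j\<close> is already
    that of \<open>G j\<close>; the expression is only substituted.\<close>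
  define H where "H = (\<lambda>j. rescale 0 (P j) (w j) (s j))"
  define y where "y = (\<lambda>j \<zeta>. w j + of_real (s j) * \<zeta>)"
  have P_an: "P j analytic_on {y j \<zeta>}"
    if "G j holomorphic_on ball a \<rho>" "\<forall>\<zeta>\<in>ball a \<rho>. w j + of_real (s j) * \<zeta> \<in> K" "\<zeta> \<in> ball a \<rho>" for j \<zeta>
  proof -
    have "f j analytic_on {y j \<zeta>}" unfolding y_def using that by (rule analytic_source)
    moreover have "y j \<zeta> \<in> D" using that K by (auto simp: y_def)
    hence "A analytic_on {y j \<zeta>}" "\<psi> analytic_on {y j \<zeta>}" using A \<psi> D unfolding analytic_at by blast+
    ultimately show ?thesis unfolding P_def by (intro analytic_intros)
  qed
  have H_holo: "\<forall>\<^sub>F j in sequentially. H j holomorphic_on B"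
    using holo eventually_in_K[of a \<rho>]
  proof eventually_elim
    case (elim j)
    have "H j analytic_on {\<zeta>}" if "\<zeta> \<in> B" for \<zeta>
      unfolding H_def using P_an[OF elim, of \<zeta>] that B(1) by (intro analytic_rescale) (auto simp: y_def)
    hence "H j analytic_on B" by (subst analytic_on_analytic_at) blast
    thus ?case by (rule analytic_imp_holomorphic)
  qed
  have H_mult: "\<forall>\<^sub>F j in sequentially. \<forall>z\<in>B. H j z = 0 \<longrightarrow> (\<forall>i<m. (deriv ^^ i) (H j) z = 0)"
    using holo eventually_in_K[of a \<rho>]
  proof eventually_elim
    case (elim j)
    show ?case
    proof (intro ballI impI allI)
      fix z i assume z: "z \<in> B" "H j z = 0" "i < m"
      have "w j + of_real (s j) * z \<in> D" using elim(2) z(1) K B(1) by blast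
      moreover have "P j analytic_on {w j + of_real (s j) * z}"
        using P_an[OF elim, of z] z(1) B(1) by (auto simp: y_def)
      ultimately show "(deriv ^^ i) (H j) z = 0"
        using higher_deriv_rescale_zero[OF mult[of j, folded P_def] _ _ s] z unfolding H_def P_def by blast
    qed
  qed
  have lim1: "uniform_limit B (\<lambda>j. (deriv ^^ k) (G j)) ((deriv ^^ k) g) sequentially"
    unfolding B_def by (rule uniform_limit_higher_deriv[OF ul \<rho> holo g])
  have "bounded (A ` K)"
    using cK A K by (intro compact_imp_bounded compact_continuous_image)
                    (auto intro: holomorphic_on_imp_continuous_on holomorphic_on_subset)
  then obtain M where M: "M > 0" "\<And>z. z \<in> K \<Longrightarrow> norm (A z) \<le> M"
    unfolding bounded_pos by blast
  have lim2: "uniform_limit B (\<lambda>j \<zeta>. A (y j \<zeta>) * (of_real (s j) ^ k * G j \<zeta>) ^ n) (\<lambda>_. 0) sequentially"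
    unfolding uniform_limit_iff
  proof safe
    fix e :: real assume e: "e > 0"
    have "bounded (g ` cball a (\<rho> / 2))"
      using g B(2) by (intro compact_imp_bounded compact_continuous_image compact_cball)
                      (auto intro: holomorphic_on_imp_continuous_on holomorphic_on_subset)
    hence bdd: "bounded (g ` B)" unfolding B_def by (rule bounded_subset) auto
    have "(\<lambda>j. complex_of_real (s j) ^ k) \<longlonglongrightarrow> of_real 0 ^ k" using s0 by (intro tendsto_intros)
    hence "(\<lambda>j. complex_of_real (s j) ^ k) \<longlonglongrightarrow> 0" using \<open>k > 0\<close> by (simp add: zero_power)
    hence "uniform_limit B (\<lambda>j _. complex_of_real (s j) ^ k) (\<lambda>_. 0) sequentially"
      by (auto simp: uniform_limit_iff tendsto_iff elim: eventually_mono)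
    hence "uniform_limit B (\<lambda>j \<zeta>. of_real (s j) ^ k * G j \<zeta>) (\<lambda>\<zeta>. 0 * g \<zeta>) sequentially"
    proof (rule uniform_lim_mult)
      show "bounded ((\<lambda>_. 0 :: complex) ` B)" by (rule bounded_subset[of "{0}"]) auto
    qed (rule uniform_limit_on_subset[OF ul B(1)] bdd)+
    \<comment> \<open>Below 1 the n-th power is at most the first power, so one bound serves every n
      \<ge> 1.\<close>
    moreover have "min 1 (e / M) > 0" using e M(1) by simp
    ultimately have "\<forall>\<^sub>F j in sequentially. \<forall>\<zeta>\<in>B. dist (of_real (s j) ^ k * G j \<zeta>) (0 * g \<zeta>) < min 1 (e / M)"
      unfolding uniform_limit_iff by blast
    with eventually_in_K[of a \<rho>]
    show "\<forall>\<^sub>F j in sequentially. \<forall>\<zeta>\<in>B. dist (A (y j \<zeta>) * (of_real (s j) ^ k * G j \<zeta>) ^ n) 0 < e"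
    proof eventually_elim
      case (elim j)
      show ?case
      proof
        fix \<zeta> assume \<zeta>: "\<zeta> \<in> B"
        define x where "x = of_real (s j) ^ k * G j \<zeta>"
        have x: "norm x < 1" "norm x < e / M" using elim(2) \<zeta> by (auto simp: x_def)
        have "norm x ^ n \<le> norm x ^ 1" using x(1) \<open>n > 0\<close> by (intro power_decreasing) auto
        hence "norm (A (y j \<zeta>) * x ^ n) \<le> M * norm x"
          using M \<zeta> B(1) elim(1) unfolding norm_mult norm_power y_def by (intro mult_mono) auto
        also have "\<dots> < e" using x(2) M(1) by (simp add: field_simps)
        finally show "dist (A (y j \<zeta>) * (of_real (s j) ^ k * G j \<zeta>) ^ n) 0 < e" by (simp add: x_def)
      qed
    qed
  qed
  have lim3: "uniform_limit B (\<lambda>j \<zeta>. \<psi> (y j \<zeta>)) (\<lambda>_. \<psi> v) sequentially"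
    unfolding uniform_limit_iff
  proof safe
    fix e :: real assume e: "e > 0"
    have "v \<in> D" using w(2) K by blast
    hence "isCont \<psi> v"
      using holomorphic_on_imp_continuous_on[OF \<psi>] D by (simp add: continuous_on_eq_continuous_at)
    then obtain \<delta> where \<delta>: "\<delta> > 0" "\<And>z. dist z v < \<delta> \<Longrightarrow> dist (\<psi> z) (\<psi> v) < e"
      using e unfolding continuous_at_eps_delta by (auto simp: dist_norm)
    define R where "R = norm a + \<rho>"
    have R: "R > 0" using \<rho> by (simp add: R_def add_nonneg_pos)
    have "\<forall>\<^sub>F j in sequentially. dist (w j) v < \<delta> / 2" "\<forall>\<^sub>F j in sequentially. dist (s j) 0 < \<delta> / 2 / R"
      using tendstoD[OF w(1), of "\<delta> / 2"] tendstoD[OF s0, of "\<delta> / 2 / R"] \<delta>(1) R by auto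
    thus "\<forall>\<^sub>F j in sequentially. \<forall>\<zeta>\<in>B. dist (\<psi> (y j \<zeta>)) (\<psi> v) < e"
    proof eventually_elim
      case (elim j)
      show ?case
      proof
        fix \<zeta> assume \<zeta>: "\<zeta> \<in> B"
        have "norm \<zeta> \<le> R"
          using \<zeta> B(1) norm_triangle_ineq[of a "\<zeta> - a"] by (force simp: dist_norm norm_minus_commute R_def)
        hence "s j * norm \<zeta> \<le> s j * R" using s[of j] by (intro mult_left_mono) auto
        also have "\<dots> < \<delta> / 2" using elim(2) R s[of j] by (simp add: field_simps)
        finally have *: "s j * norm \<zeta> < \<delta> / 2" .
        have "dist (y j \<zeta>) v = norm ((w j - v) + of_real (s j) * \<zeta>)" by (simp add: y_def dist_norm algebra_simps)
        also have "\<dots> \<le> norm (w j - v) + norm (of_real (s j) * \<zeta>)" by (rule norm_triangle_ineq)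
        also have "norm (of_real (s j) * \<zeta>) = s j * norm \<zeta>" using s[of j] by (simp add: norm_mult)
        finally have "dist (y j \<zeta>) v < \<delta>" using * elim(1) by (simp add: dist_norm)
        thus "dist (\<psi> (y j \<zeta>)) (\<psi> v) < e" by (rule \<delta>(2))
      qed
    qed
  qed
  \<comment> \<open>This is \<open>H\<close> written through \<open>G j\<close>, by f = s^k G and
    the invariance of the k-th derivative; in this form the three limits apply term by term.\<close>
  define H' where "H' = (\<lambda>j \<zeta>. (deriv ^^ k) (G j) \<zeta> - A (y j \<zeta>) * (of_real (s j) ^ k * G j \<zeta>) ^ n - \<psi> (y j \<zeta>))"
  have H_eq: "\<forall>\<^sub>F j in sequentially. \<forall>\<zeta>\<in>B. H' j \<zeta> = H j \<zeta>"
    using holo eventually_in_K[of a \<rho>]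
  proof eventually_elim
    case (elim j)
    show ?case
    proof
      fix \<zeta> assume "\<zeta> \<in> B"
      hence "\<zeta> \<in> ball a \<rho>" using B(1) by blast
      hence an: "f j analytic_on {w j + of_real (s j) * \<zeta>}" by (rule analytic_source[OF elim])
      have "(deriv ^^ k) (G j) \<zeta> = (deriv ^^ k) (f j) (y j \<zeta>)"
        using higher_deriv_rescale[OF an s, of k k] s[of j] by (simp add: G_def y_def)
      moreover have "of_real (s j) ^ k * G j \<zeta> = f j (y j \<zeta>)" using s[of j] by (simp add: G_def rescale_def y_def)
      ultimately show "H' j \<zeta> = H j \<zeta>" by (simp add: H'_def H_def rescale_def P_def y_def)
    qed
  qed
  have "uniform_limit B H' (\<lambda>\<zeta>. (deriv ^^ k) g \<zeta> - 0 - \<psi> v) sequentially"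
    unfolding H'_def by (intro uniform_limit_minus lim1 lim2 lim3)
  hence "uniform_limit B H (\<lambda>\<zeta>. (deriv ^^ k) g \<zeta> - \<psi> v) sequentially"
    using uniform_limit_cong[OF H_eq, of "\<lambda>\<zeta>. (deriv ^^ k) g \<zeta> - \<psi> v"] by simp
  thus ?thesis
    unfolding B_def
  proof (rule hurwitz_multiplicity)
    have "g holomorphic_on ball a (\<rho> / 2)" using g B(1) unfolding B_def by (rule holomorphic_on_subset)
    thus "(\<lambda>\<zeta>. (deriv ^^ k) g \<zeta> - \<psi> v) holomorphic_on ball a (\<rho> / 2)"
      by (intro holomorphic_intros holomorphic_higher_deriv) auto
  qed (use \<rho> a H_holo H_mult in \<open>auto simp: B_def\<close>)
qed

end

theorem theorem1p1:
  fixes D :: "complex set" and \<F> :: "(complex \<Rightarrow> complex) set"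
    and a \<psi> :: "complex \<Rightarrow> complex" and d k m n :: nat
  assumes "open D" and "connected D" and "D \<noteq> {}"
    and "\<And>f. f \<in> \<F> \<Longrightarrow> f nicely_meromorphic_on D"
    and "d > 0" and "k > 0" and "m > 0" and "n > 0"
    and "(real k + 1) / real d + (real k + 2) / (2 * real m) < 1 / 2"
    and "a holomorphic_on D" and "\<psi> holomorphic_on D"
    and "\<And>z. z \<in> D \<Longrightarrow> \<psi> z \<noteq> 0"
    and "\<And>f. f \<in> \<F> \<Longrightarrow> zeros_multiplicity_ge f D d"
    and "\<And>f. f \<in> \<F> \<Longrightarrow> poles_multiplicity_ge f D 2"
    and "\<And>f. f \<in> \<F> \<Longrightarrow>
           zeros_multiplicity_ge (\<lambda>z. (deriv ^^ k) f z - a z * f z ^ n - \<psi> z) D m"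
  shows "normal_family \<F> D"
proof (rule normal_familyI[OF \<open>connected D\<close> \<open>D \<noteq> {}\<close>], rule ccontr)
  fix z0 assume z0: "z0 \<in> D"
  assume unbounded: "\<not>(\<exists>\<delta>>0. \<exists>L. ball z0 \<delta> \<subseteq> D \<and> (\<forall>f\<in>\<F>. bounded_spherical_deriv f L (ball z0 \<delta>)))"
  obtain r where r: "r > 0" "cball z0 r \<subseteq> D" using \<open>open D\<close> z0 open_contains_cball by blast
  have d: "d \<ge> k + 1"
  proof -
    have "(real k + 1) / real d < 1 / 2"
      using assms(9) by (smt (verit) divide_nonneg_nonneg of_nat_0_le_iff)
    hence "2 * (real k + 1) < real d" using \<open>d > 0\<close> by (simp add: field_simps)
    hence "real (2 * (k + 1)) < real d" by simp
    hence "2 * (k + 1) < d" by (subst (asm) of_nat_less_iff)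
    thus ?thesis by simp
  qed
  \<comment> \<open>The conclusion of \<open>zalcman_pang_point\<close> at level \<open>l\<close>,
    packaged so that one choice at level j + 1 for each j yields the sequences.\<close>
  define Q where "Q = (\<lambda>l f w s. f \<in> \<F> \<and> w \<in> ball z0 r \<and> 0 < s \<and> s \<le> 4 / l \<and>
    \<not>is_pole (rescale k f w s) 0 \<and> norm (deriv (rescale k f w s) 0) \<ge> 1 + (norm (rescale k f w s 0))\<^sup>2 \<and>
    (\<forall>\<zeta>\<in>ball 0 (l * r / 8). w + of_real s * \<zeta> \<in> ball z0 r) \<and>
    bounded_spherical_deriv (rescale k f w s) (4 ^ (k + 1)) (ball 0 (l * r / 8)))"
  have "\<exists>f w s. Q l f w s" if l: "l \<ge> 1" for l
  proof -
    have sub: "ball z0 (r / 2) \<subseteq> D" using r by (auto intro: subsetD[OF r(2)])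
    \<comment> \<open>Boundedness fails on every disc about \<open>z0\<close>, in particular on the
      one of radius r/2 with the constant l^(k+1), the size that \<open>zalcman_pang_point\<close>
      asks for.\<close>
    have "\<exists>f\<in>\<F>. \<not>bounded_spherical_deriv f (l ^ (k + 1)) (ball z0 (r / 2))"
    proof (rule ccontr)
      assume "\<not>?thesis"
      hence "\<exists>\<delta>>0. \<exists>L. ball z0 \<delta> \<subseteq> D \<and> (\<forall>f\<in>\<F>. bounded_spherical_deriv f L (ball z0 \<delta>))"
        using sub r(1) by (intro exI[of _ "r / 2"] exI[of _ "l ^ (k + 1)"] conjI) auto
      with unbounded show False by contradiction
    qed
    then obtain f where f: "f \<in> \<F>" "\<not>bounded_spherical_deriv f (l ^ (k + 1)) (ball z0 (r / 2))" by blast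
    have nice: "f nicely_meromorphic_on D" using f(1) assms(4) by blast
    hence "f nicely_meromorphic_on ball z0 (r / 2)" using sub by (rule nicely_meromorphic_on_subset)
    then obtain z1 where z1: "z1 \<in> ball z0 (r / 2)" "\<not>is_pole f z1"
        "norm (deriv f z1) \<ge> l ^ (k + 1) * (1 + (norm (f z1))\<^sup>2)"
      using f(2) unfolding bounded_spherical_deriv_def by (auto simp: not_le less_imp_le)
    obtain w s where "w \<in> ball z0 r" "0 < s" "s \<le> 4 / l" "\<not>is_pole (rescale k f w s) 0"
      "norm (deriv (rescale k f w s) 0) \<ge> 1 + (norm (rescale k f w s 0))\<^sup>2"
      "\<And>\<zeta>. \<zeta> \<in> ball 0 (l * r / 8) \<Longrightarrow> w + of_real s * \<zeta> \<in> ball z0 r"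
      "bounded_spherical_deriv (rescale k f w s) (4 ^ (k + 1)) (ball 0 (l * r / 8))"
      by (rule zalcman_pang_point[OF nice assms(13)[OF f(1)] d r l z1]) (rule that)
    hence "Q l f w s" using f(1) unfolding Q_def by blast
    thus ?thesis by blast
  qed
  hence "\<exists>f w s. Q (real j + 1) f w s" for j by simp
  then obtain f w s where Q: "\<And>j. Q (real j + 1) (f j) (w j) (s j)" by metis
  have "\<forall>j. w j \<in> cball z0 r" using Q unfolding Q_def by (simp add: less_imp_le)
  then obtain v p1 where v: "v \<in> cball z0 r" and p1: "strict_mono (p1 :: nat \<Rightarrow> nat)" and w1: "(w \<circ> p1) \<longlonglongrightarrow> v"
    by (rule seq_compactE[OF compact_imp_seq_compact[OF compact_cball]])
  \<comment> \<open>The discs of radius (j + 1) r / 8 on which the spherical derivative is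
    controlled exhaust the plane, also along a subsequence.\<close>
  have radius: "\<forall>\<^sub>F j in sequentially. R \<le> (real (p j) + 1) * r / 8" if p: "strict_mono p" for R p
    using eventually_ge_at_top[of "nat \<lceil>8 * R / r\<rceil>"]
  proof eventually_elim
    case (elim j)
    have "8 * R / r \<le> real j" using elim by linarith
    also have "\<dots> \<le> real (p j) + 1" using seq_suble[OF p, of j] by simp
    finally show ?case using r(1) by (simp add: field_simps)
  qed
  have "locally_spherically_bounded (\<lambda>j. rescale k (f (p1 j)) (w (p1 j)) (s (p1 j))) UNIV"
    unfolding locally_spherically_bounded_def
  proof
    fix z :: complex
    have "\<forall>\<^sub>F j in sequentially. bounded_spherical_deriv
            (rescale k (f (p1 j)) (w (p1 j)) (s (p1 j))) (4 ^ (k + 1)) (ball z 1)"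
      using radius[OF p1, of "norm z + 1"]
    proof eventually_elim
      case (elim j)
      have "ball z 1 \<subseteq> ball 0 ((real (p1 j) + 1) * r / 8)"
      proof
        fix x assume "x \<in> ball z 1"
        thus "x \<in> ball 0 ((real (p1 j) + 1) * r / 8)"
          using elim norm_triangle_ineq[of z "x - z"] by (simp add: dist_norm norm_minus_commute)
      qed
      moreover have "bounded_spherical_deriv (rescale k (f (p1 j)) (w (p1 j)) (s (p1 j))) (4 ^ (k + 1))
          (ball 0 ((real (p1 j) + 1) * r / 8))"
        using Q[of "p1 j"] unfolding Q_def by (elim conjE)
      ultimately show ?case using bounded_spherical_deriv_mono[OF _ order_refl] by blast
    qed
    thus "\<exists>\<delta>>0. \<exists>L. ball z \<delta> \<subseteq> UNIV \<and> (\<forall>\<^sub>F j in sequentially.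
            bounded_spherical_deriv (rescale k (f (p1 j)) (w (p1 j)) (s (p1 j))) L (ball z \<delta>))"
      by (intro exI[of _ 1] exI[of _ "4 ^ (k + 1)"] conjI) auto
  qed
  then obtain p2 where p2: "strict_mono (p2 :: nat \<Rightarrow> nat)"
    and dich: "(\<exists>g. spherical_limit (\<lambda>j. rescale k (f (p1 (p2 j))) (w (p1 (p2 j))) (s (p1 (p2 j)))) g UNIV) \<or>
      diverges_spherically (\<lambda>j. rescale k (f (p1 (p2 j))) (w (p1 (p2 j))) (s (p1 (p2 j)))) UNIV"
    by (rule Marty_compactness[OF UNIV_not_empty connected_UNIV])
  define p where "p = p1 \<circ> p2"
  have p: "strict_mono p" unfolding p_def using p1 p2 by (rule strict_mono_o)
  define G where "G = (\<lambda>j. rescale k (f (p j)) (w (p j)) (s (p j)))"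
  have Gp: "(\<exists>g. spherical_limit G g UNIV) \<or> diverges_spherically G UNIV"
    using dich by (simp add: G_def p_def)
  have G_an: "G j analytic_on {0}" for j
  proof (rule nicely_meromorphic_on_imp_analytic_at)
    show "G j nicely_meromorphic_on ball 0 ((real (p j) + 1) * r / 8)" "\<not>is_pole (G j) 0"
      using Q[of "p j"] by (simp_all add: Q_def bounded_spherical_deriv_def G_def)
  qed (use r(1) in auto)
  have G_deriv: "norm (deriv (G j) 0) \<ge> 1 + (norm (G j 0))\<^sup>2" for j
    using Q[of "p j"] by (simp add: Q_def G_def)
  note not_constant = spherical_limit_not_constant[of G, OF G_an G_deriv]
  from Gp show False
  proof (elim disjE exE)
    assume "diverges_spherically G UNIV"
    then obtain \<rho> where "\<rho> > 0" "inf_limit G (\<lambda>_. 0) (ball 0 \<rho>)" unfolding diverges_spherically_def by blast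
    thus False by (rule not_constant(2))
  next
    fix g assume g: "spherical_limit G g UNIV"
    have fp: "f (p j) \<in> \<F>" for j using Q[of "p j"] unfolding Q_def by blast
    interpret rescaled_limit "\<lambda>j. f (p j)" D "cball z0 r" "\<lambda>j. w (p j)" "\<lambda>j. s (p j)" k g
    proof
        show "f (p j) nicely_meromorphic_on D" for j using fp assms(4) by blast
        show "s (p j) > 0" for j using Q[of "p j"] unfolding Q_def by blast
        show "\<forall>\<^sub>F j in sequentially. \<forall>\<zeta>\<in>ball 0 R. w (p j) + of_real (s (p j)) * \<zeta> \<in> cball z0 r" for R
          using radius[OF p, of R]
        proof eventually_elim
          case (elim j)
          have "w (p j) + of_real (s (p j)) * \<zeta> \<in> ball z0 r" if "\<zeta> \<in> ball 0 R" for \<zeta>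
            using Q[of "p j"] that elim unfolding Q_def by auto
          thus ?case using ball_subset_cball by blast
        qed
        show "spherical_limit (\<lambda>j. rescale k (f (p j)) (w (p j)) (s (p j))) g UNIV"
          using g by (simp add: G_def)
    qed (rule r(2))
    have wp: "(\<lambda>j. w (p j)) \<longlonglongrightarrow> v"
      using LIMSEQ_subseq_LIMSEQ[OF w1 p2] by (simp add: p_def o_def)
    have sp: "(\<lambda>j. s (p j)) \<longlonglongrightarrow> 0"
    proof (rule tendsto_sandwich[of "\<lambda>_. 0" _ _ "\<lambda>j. 4 / (real j + 1)"])
      have "(\<lambda>j. 4 * inverse (real (Suc j))) \<longlonglongrightarrow> 4 * 0"
        by (intro tendsto_intros LIMSEQ_inverse_real_of_nat)
      thus "(\<lambda>j. 4 / (real j + 1)) \<longlonglongrightarrow> 0" by (simp add: field_simps)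
      show "\<forall>\<^sub>F j in sequentially. 0 \<le> s (p j)" by (intro always_eventually allI less_imp_le s)
      have "s (p j) \<le> 4 / (real j + 1)" for j
      proof -
        have "s (p j) \<le> 4 / (real (p j) + 1)" using Q[of "p j"] unfolding Q_def by blast
        also have "\<dots> \<le> 4 / (real j + 1)" using seq_suble[OF p, of j] by (intro divide_left_mono) auto
        finally show ?thesis .
      qed
      thus "\<forall>\<^sub>F j in sequentially. s (p j) \<le> 4 / (real j + 1)" by (intro always_eventually) blast
    qed (rule tendsto_const)
    have "\<psi> v \<noteq> 0" using assms(12) v r(2) by blast
    have "\<exists>b. \<forall>z. g z = b"
    proof (rule milloux_rigidity[OF nicely_meromorphic_limit \<open>\<psi> v \<noteq> 0\<close> \<open>d > 0\<close> \<open>m > 0\<close> assms(9)])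
      show "zorder g x \<ge> int d" if "isolated_zero g x" for x
        using assms(13)[OF fp] that by (rule zorder_limit_zero)
      show "zorder g x \<le> -2" if "is_pole g x" for x
        using zorder_limit_pole[OF assms(14)[OF fp] that] by simp
      show "zorder (\<lambda>z. (deriv ^^ k) g z - \<psi> v) x \<ge> int m"
        if "isolated_zero (\<lambda>z. (deriv ^^ k) g z - \<psi> v) x" for x
        using \<open>open D\<close> compact_cball assms(10,11) \<open>k > 0\<close> \<open>n > 0\<close> wp v sp assms(15)[OF fp] that
        by (rule zorder_limit_value)
    qed
    then obtain b where b: "g = (\<lambda>_. b)" by blast
    obtain \<rho> where \<rho>: "\<rho> > 0"
        "fin_limit G g (ball 0 \<rho>) \<or> infinite_type g (ball 0 \<rho>) \<and> inf_limit G (\<lambda>z. inverse (g z)) (ball 0 \<rho>)"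
      using g unfolding spherical_limit_def by blast
    from \<rho>(2) show False
      unfolding b by (elim disjE conjE) (erule not_constant[OF \<rho>(1)])+
  qed
qed

end
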